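(* Let $G$ be a connected negative definite plumbing tree (all genera $0$) with set of nodes $\mathcal N\neq\emptyset$. Let $V_{\mathcal N}=\mathbb R\langle E_n^*\rangle_{n\in\mathcal N}\subset L\otimes\mathbb R$, $\mathcal S_{\mathcal N}=\mathbb R_{\ge0}\langle E_n^*\rangle_{n\in\mathcal N}$, $L_{\mathcal N}=\mathbb Z\langle E_n\rangle_{n\in\mathcal N}$, and let $pr_{\mathcal N}:L\otimes\mathbb R\to L_{\mathcal N}\otimes\mathbb R$ be the projection on the node coordinates. Let $h\in H$. (a) The restriction of $\mathcal L_h(\mathcal T,l')$ to $V_{\mathcal N}$ depends only on those coordinates of $l'$ which are indexed by the nodes (that is, it depends only on $pr_{\mathcal N}(l')$ whenever $l'\in V_{\mathcal N}$). (b) The same is true for the counting function $Q_h$ associated with $Z_h(\mathbf t)$. In other words, if $Z_h(\mathbf t_{\mathcal N}):=Z_h(\mathbf t)|_{t_v=1\text{ for all }v\notin\mathcal N}$, then for any element of $L_{\mathcal N}$ the counting functions of $Z_h(\mathbf t)$ and of $Z_h(\mathbf t_{\mathcal N})$ are the same: if $l_{\mathcal N}\in L_{\mathcal N}$ and $l'\in V_{\mathcal N}$ is the element with $pr_{\mathcal N}(l')=l_{\mathcal N}$, then $$\sum_{[l'']=h,\ l''\not\ge l'}p_{l''}=\sum_{[l'']=h,\ pr_{\mathcal N}(l'')\not\ge l_{\mathcal N}}p_{l''}.$$ (c) Consider the chamber decomposition of $\mathcal S_{\mathcal N}$ by the intersections $\mathcal C_{\mathcal N}:=\mathcal C\cap\mathcal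 S_{\mathcal N}$, where $\mathcal C$ denotes a chamber of $Z$ such that $\mathrm{int}(\mathcal C\cap\mathcal S)\ne\emptyset$ and the intersection of $\mathcal C$ with the relative interior of $\mathcal S_{\mathcal N}$ is also non-empty. Then $$\mathrm{pc}^{\mathcal C}(Z_h(\mathbf t))=\mathrm{pc}^{\mathcal C_{\mathcal N}}(Z_h(\mathbf t_{\mathcal N})).$$
   Context: **Lattice.** $\mathcal V$ is the vertex set, $b_v$ the decorations, $\delta_v$ the valencies; $\mathcal N=\{v:\delta_v\ge3\}$, $\mathcal E=\{v:\delta_v=1\}$. $L=\bigoplus_v\mathbb ZE_v$ with negative definite form $(E_v,E_v)=b_v$, $(E_v,E_w)=1$ or $0$ for $v\ne w$ adjacent or not; $L'=\{l'\in L\otimes\mathbb Q:(l',L)\subseteq\mathbb Z\}$; $E_v^*\in L'$, $(E_v^*,E_w)=-1$ if $v=w$, $0$ otherwise; $H=L'/L$, $[l']$ the class of $l'$. $\le$ is the coordinatewise order with respect to $\{E_v\}$ (and with respect to $\{E_n\}_{n\in\mathcal N}$ on $L_{\mathcal N}\otimes\mathbb R$). $\mathcal S=\{x\in L\otimes\mathbb R:(x,E_v)\le0\ \forall v\}$. The restriction $pr_{\mathcal N}:V_{\mathcal N}\to L_{\mathcal N}\otimes\mathbb R$ is an isomorphism; via it, subcones of $\mathcal S_{\mathcal N}$ are viewed in $L_{\mathcal N}\otimes\mathbb R$. **Series.** $Z(\mathbf t)=\sum p_{l'}\mathbf t^{l'}$ is the Taylor expansion at the origin of $\prod_v(1-\mathbf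 t^{E_v^*})^{\delta_v-2}$ ($\mathbf t^{l'}=\prod_v t_v^{l'_v}$), and $Z_h(\mathbf t)=\sum_{[l']=h}p_{l'}\mathbf t^{l'}$. Counting function: $Q_h(l')=\sum_{l''\not\ge l',[l'']=h}p_{l''}$; analogously for a series in the variables $\{t_n\}_{n\in\mathcal N}$, using the order on $L_{\mathcal N}\otimes\mathbb R$ (only the coefficients of the given series $Z_h(\mathbf t_{\mathcal N})$ are summed; the decomposition by $h\in H$ is made before substituting $t_v=1$). $\mathcal L_h(\mathcal T,l')=\#\{x\in\mathbb Z_{\ge0}^{\mathcal E}:\sum_ex_eE_e^*\not\ge l',\ [\sum_ex_eE_e^*]=h\}$. **Chambers.** Let $\mathbf M$ be the list of vectors $E_e^*$ ($e\in\mathcal E$) and $-E_v$ ($v\in\mathcal V$). The chamber decomposition of $L\otimes\mathbb R$ is the common refinement of all closed cones generated by subsets of $\mathbf M$ forming a basis; a chamber (of $Z$) is a closed cone of the subdivision with non-empty interior. **Periodic constant.** For a series with counting function $Q$ on a lattice ($L$, resp. $L_{\mathcal N}$) and a closed real cone $\mathcal K$ with affine closure of positive dimension, suppose there are $l'_*\in\mathcal K$, a finite-index sublattice $\widetilde L$ of $L$ (resp. $L_{\mathcal N}$) and a quasipolynomial $\widetilde Q$ on $\widetilde L\cap\mathrm{aff}(\mathcal K)$ with $Q(l')=\widetilde Q(l')$ for all $l'\in\widetilde L\cap(l'_*+\mathcal K)$; then $\mathrm{pc}^{\mathcal K}:=\widetilde Q(0)$. Here $\mathrm{pc}^{\mathcal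 C}(Z_h(\mathbf t))$ is computed from $Q_h$ on $L$, and $\mathrm{pc}^{\mathcal C_{\mathcal N}}(Z_h(\mathbf t_{\mathcal N}))$ from the counting function of $Z_h(\mathbf t_{\mathcal N})$ on $L_{\mathcal N}$. *)

theory Defs
  imports "HOL-Analysis.Analysis"
begin

section \<open>Plumbing trees\<close>

text \<open>The vertex set is the (finite) type \<open>'v\<close>, so that \<open>L \<otimes> \<real>\<close> is \<^typ>\<open>real ^ 'v\<close> with
  coordinates taken with respect to the basis \<open>{E\<^sub>v}\<close>; all genera are zero and carry no data.\<close>

record 'v plumbing_graph =
  adjacent :: "'v \<Rightarrow> 'v \<Rightarrow> bool"
  decoration :: "'v \<Rightarrow> int"

definition is_tree :: "'v plumbing_graph \<Rightarrow> bool" where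
  "is_tree G \<longleftrightarrow>
     symp (adjacent G) \<and> irreflp (adjacent G) \<and>
     (\<forall>u v. (adjacent G)\<^sup>*\<^sup>* u v) \<and>
     (\<nexists>c. length c \<ge> 3 \<and> distinct c \<and> successively (adjacent G) c \<and> adjacent G (last c) (hd c))"

definition valency :: "'v::finite plumbing_graph \<Rightarrow> 'v \<Rightarrow> nat" where
  "valency G v = card {w. adjacent G v w}"

definition nodes :: "'v::finite plumbing_graph \<Rightarrow> 'v set" where
  "nodes G = {v. valency G v \<ge> 3}"

definition ends :: "'v::finite plumbing_graph \<Rightarrow> 'v set" where
  "ends G = {v. valency G v = 1}"

abbreviation E_base :: "'v::finite \<Rightarrow> real ^ 'v" where
  "E_base v \<equiv> axis v 1"

definition intersection_matrix :: "'v::finite plumbing_graph \<Rightarrow> real ^ 'v ^ 'v" where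
  "intersection_matrix G =
     (\<chi> v w. if v = w then of_int (decoration G v) else if adjacent G v w then 1 else 0)"

definition form :: "'v::finite plumbing_graph \<Rightarrow> real ^ 'v \<Rightarrow> real ^ 'v \<Rightarrow> real" where
  "form G x y = x \<bullet> (intersection_matrix G *v y)"

definition negative_definite :: "'v::finite plumbing_graph \<Rightarrow> bool" where
  "negative_definite G \<longleftrightarrow> (\<forall>x. x \<noteq> 0 \<longrightarrow> form G x x < 0)"


section \<open>Lattices and cones\<close>

definition L_int :: "(real ^ 'v::finite) set" where
  "L_int = {x. \<forall>v. x $ v \<in> \<int>}"

definition L_dual :: "'v::finite plumbing_graph \<Rightarrow> (real ^ 'v) set" where
  "L_dual G = {x. (\<forall>v. x $ v \<in> \<rat>) \<and> (\<forall>y\<in>L_int. form G x y \<in> \<int>)}"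

definition E_star :: "'v::finite plumbing_graph \<Rightarrow> 'v \<Rightarrow> real ^ 'v" where
  "E_star G v = (THE x. x \<in> L_dual G \<and> (\<forall>w. form G x (E_base w) = (if w = v then - 1 else 0)))"

definition congruence :: "'a::ab_group_add set \<Rightarrow> 'a set \<Rightarrow> ('a \<times> 'a) set" where
  "congruence A B = {(x, y). x \<in> A \<and> y \<in> A \<and> x - y \<in> B}"

text \<open>The elements of \<open>H = L'/L\<close> are the cosets, as subsets of \<open>L'\<close>; the class of a vector
  outside \<open>L'\<close> is the empty set, which is not an element of \<open>H\<close>.\<close>

definition H_classes :: "'v::finite plumbing_graph \<Rightarrow> (real ^ 'v) set set" where
  "H_classes G = L_dual G // congruence (L_dual G) L_int"

definition cls :: "'v::finite plumbing_graph \<Rightarrow> real ^ 'v \<Rightarrow> (real ^ 'v) set" where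
  "cls G x = congruence (L_dual G) L_int `` {x}"

definition S_cone :: "'v::finite plumbing_graph \<Rightarrow> (real ^ 'v) set" where
  "S_cone G = {x. \<forall>v. form G x (E_base v) \<le> 0}"

definition V_nodes :: "'v::finite plumbing_graph \<Rightarrow> (real ^ 'v) set" where
  "V_nodes G = span (E_star G ` nodes G)"

definition S_nodes :: "'v::finite plumbing_graph \<Rightarrow> (real ^ 'v) set" where
  "S_nodes G = convex_cone hull (E_star G ` nodes G)"

text \<open>\<open>L\<^sub>\<N> \<otimes> \<real>\<close> is realised inside \<open>L \<otimes> \<real>\<close> as the coordinate subspace of the vectors that vanish
  outside the nodes. On this subspace the coordinatewise order of \<open>L \<otimes> \<real>\<close> is the one
  with respect to the node coordinates.\<close>

definition L_nodes :: "'v::finite plumbing_graph \<Rightarrow> (real ^ 'v) set" where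
  "L_nodes G = {x \<in> L_int. \<forall>v. v \<notin> nodes G \<longrightarrow> x $ v = 0}"

definition pr_nodes :: "'v::finite plumbing_graph \<Rightarrow> real ^ 'v \<Rightarrow> real ^ 'v" where
  "pr_nodes G x = (\<chi> v. if v \<in> nodes G then x $ v else 0)"


section \<open>Series and counting functions\<close>

text \<open>A series \<open>\<Sum> p\<^sub>m t\<^sup>m\<close> is represented by its coefficient function \<open>m \<mapsto> p\<^sub>m\<close> on exponent
  vectors. All sums of coefficients below have finite support, since on a negative
  definite tree every \<open>E\<^sub>v\<^sup>*\<close> has strictly positive coordinates.

  \<open>Z_coeff\<close> is obtained by expanding each factor of \<open>Z\<close> as the one-variable Taylor series of
  \<open>(1 - X) powi (\<delta>\<^sub>v - 2)\<close> with \<open>X\<close> replaced by the monomial with exponent \<open>E\<^sub>v\<^sup>*\<close>, and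
  multiplying out: \<open>x v\<close> is the degree of the term taken from the factor of \<open>v\<close>.\<close>

definition Z_coeff :: "'v::finite plumbing_graph \<Rightarrow> real ^ 'v \<Rightarrow> real" where
  "Z_coeff G l =
     (\<Sum>x | (\<Sum>v\<in>UNIV. real (x v) *\<^sub>R E_star G v) = l.
        \<Prod>v\<in>UNIV. fps_nth ((1 - fps_X) powi (int (valency G v) - 2)) (x v))"

definition Z_h :: "'v::finite plumbing_graph \<Rightarrow> (real ^ 'v) set \<Rightarrow> real ^ 'v \<Rightarrow> real" where
  "Z_h G h l = (if cls G l = h then Z_coeff G l else 0)"

text \<open>Setting \<open>t\<^sub>v = 1\<close> for all \<open>v \<notin> \<N>\<close> adds up the coefficients of all exponents with the
  same node coordinates.\<close>

definition Z_h_nodes :: "'v::finite plumbing_graph \<Rightarrow> (real ^ 'v) set \<Rightarrow> real ^ 'v \<Rightarrow> real" where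
  "Z_h_nodes G h m = (\<Sum>\<^sub>\<infinity>l\<in>{l. pr_nodes G l = m}. Z_h G h l)"

definition counting_function :: "(real ^ 'v::finite \<Rightarrow> real) \<Rightarrow> real ^ 'v \<Rightarrow> real" where
  "counting_function p l = (\<Sum>\<^sub>\<infinity>m\<in>{m. \<not> l \<le> m}. p m)"

definition end_sum :: "'v::finite plumbing_graph \<Rightarrow> ('v \<Rightarrow> nat) \<Rightarrow> real ^ 'v" where
  "end_sum G x = (\<Sum>e\<in>ends G. real (x e) *\<^sub>R E_star G e)"

definition ehrhart_count ::
    "'v::finite plumbing_graph \<Rightarrow> (real ^ 'v) set \<Rightarrow> real ^ 'v \<Rightarrow> nat" where
  "ehrhart_count G h l =
     card {x \<in> ends G \<rightarrow>\<^sub>E (UNIV :: nat set). \<not> l \<le> end_sum G x \<and> cls G (end_sum G x) = h}"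


section \<open>Chambers\<close>

definition M_vectors :: "'v::finite plumbing_graph \<Rightarrow> (real ^ 'v) set" where
  "M_vectors G = E_star G ` ends G \<union> range (\<lambda>v. - E_base v)"

definition basic_cones :: "'v::finite plumbing_graph \<Rightarrow> (real ^ 'v) set set" where
  "basic_cones G = {convex_cone hull B | B. B \<subseteq> M_vectors G \<and> independent B \<and> span B = UNIV}"

text \<open>The cell of the common refinement that has the point \<open>x\<close> in its relative interior is the
  intersection of all the basic cones that contain \<open>x\<close> (these cones cover \<open>L \<otimes> \<real>\<close>).\<close>

definition refinement_cell :: "'v::finite plumbing_graph \<Rightarrow> real ^ 'v \<Rightarrow> (real ^ 'v) set" where
  "refinement_cell G x = \<Inter>{K \<in> basic_cones G. x \<in> K}"

definition is_chamber :: "'v::finite plumbing_graph \<Rightarrow> (real ^ 'v) set \<Rightarrow> bool" where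
  "is_chamber G C \<longleftrightarrow> C \<in> range (refinement_cell G) \<and> interior C \<noteq> {}"


section \<open>Periodic constants\<close>

definition finite_index_sublattice :: "'a::ab_group_add set \<Rightarrow> 'a set \<Rightarrow> bool" where
  "finite_index_sublattice B A \<longleftrightarrow>
     B \<subseteq> A \<and> 0 \<in> B \<and> (\<forall>x\<in>B. \<forall>y\<in>B. x - y \<in> B) \<and> finite (A // congruence A B)"

definition quasipolynomial_on :: "'a::euclidean_space set \<Rightarrow> ('a \<Rightarrow> real) \<Rightarrow> bool" where
  "quasipolynomial_on A q \<longleftrightarrow>
     (\<exists>B. finite_index_sublattice B A \<and>
        (\<forall>x\<in>A. \<exists>g. real_polynomial_function g \<and> (\<forall>y\<in>A. y - x \<in> B \<longrightarrow> q y = g y)))"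

definition has_periodic_constant ::
    "'a::euclidean_space set \<Rightarrow> ('a \<Rightarrow> real) \<Rightarrow> 'a set \<Rightarrow> real \<Rightarrow> bool" where
  "has_periodic_constant A Q K c \<longleftrightarrow>
     closed K \<and> cone K \<and> aff_dim K > 0 \<and>
     (\<exists>l\<^sub>0\<in>K. \<exists>B q. finite_index_sublattice B A \<and> quasipolynomial_on (B \<inter> affine hull K) q \<and>
        (\<forall>l\<in>B \<inter> (\<lambda>k. l\<^sub>0 + k) ` K. Q l = q l) \<and> c = q 0)"

definition periodic_constant :: "'a::euclidean_space set \<Rightarrow> ('a \<Rightarrow> real) \<Rightarrow> 'a set \<Rightarrow> real" where
  "periodic_constant A Q K = (THE c. has_periodic_constant A Q K c)"

end

theory Submission
  imports Defs
begin

text \<open>By the minimum principle for a negative definite tree, a vector whose products with all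
  non-nodes are nonpositive is nonnegative as soon as its node coordinates are. Applied to the
  differences of exponents and elements of \<open>V\<^sub>\<N>\<close>, this gives (a) and (b).

  For (c), call a real \<open>x\<close> deep if \<open>- (x, E\<^sub>u) > \<delta>\<^sub>u - 2\<close> for all \<open>u\<close>. For a coset point
  \<open>w\<close> that lies above a deep point \<open>x\<close> by at most one in every coordinate, with
  \<open>w\<^sub>v = x\<^sub>v\<close>, eliminating the leaves of the tree one by one shows that
  \<open>Q\<^sub>h(w + E\<^sub>v) - Q\<^sub>h(w) = 1 - (w, E\<^sub>v)\<close>. Moving along segments, it follows that
  \<open>Q\<^sub>h(x) = c + q(\<lceil>x\<rceil>)\<close> on the whole convex set of deep points, with one constant \<open>c\<close>, one
  quadratic polynomial \<open>q\<close> and \<open>\<lceil>x\<rceil>\<close> the least element of \<open>h\<close> above \<open>x\<close>. A chamber that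
  meets the interior of \<open>S\<close> is contained in \<open>S\<close>, so far out it consists of deep points; and a
  point far out in \<open>S\<^sub>\<N>\<close> becomes deep after a shift that does not change \<open>\<lceil>x\<rceil>\<close>. Hence both
  periodic constants are \<open>c + q(\<lceil>0\<rceil>)\<close>. They are well defined because both cones are
  rational, so that each contains a lattice ray on which two candidate quasipolynomials agree.\<close>

section \<open>Trees\<close>

text \<open>Origin of the bound \<open>\<delta>\<^sub>u - 2\<close>: summing out the coordinate of a
  leaf multiplies the series of its neighbour by 1 / (1 - X) times a polynomial with value 1 at X =
  1; at the last vertex only 1 / (1 - X)^2 is left, whose coefficient of degree a is a + 1. Such a
  polynomial is invisible as long as its degree does not exceed the exponent that is read off. The
  degrees are controlled by ratios to a positive vector \<eta> whose product with every E_u is -1;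
  rounding loses at most 1 per eliminated neighbour, and deepness pays exactly for this. The real
  point x is carried along because the coset points visited need not be deep: only their gap to x,
  between 0 and 1, is under control. The obstacle for chambers is that a cell is given by an
  arbitrary base point. Its position relative to S is decided by writing S as the intersection, over
  all w, of the cones generated by M without -E_w. The obstacle on V_nodes is that all products with
  vertices of valency 2 are 0 there, whereas deepness asks for positive ones.\<close>

lemma rtranclp_distinct_path:
  assumes "r\<^sup>*\<^sup>* x y"
  shows "\<exists>xs. xs \<noteq> [] \<and> hd xs = x \<and> last xs = y \<and> distinct xs \<and> successively r xs"
  using assms
proof (induction rule: converse_rtranclp_induct)
  case base
  show ?case by (rule exI[of _ "[y]"]) simp
next
  case (step x z)
  then obtain xs where xs: "xs \<noteq> []" "hd xs = z" "last xs = y" "distinct xs" "successively r xs"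
    by blast
  show ?case
  proof (cases "x \<in> set xs")
    case True
    then obtain us vs where "xs = us @ x # vs" by (meson split_list)
    with xs show ?thesis
      by (intro exI[of _ "x # vs"]) (auto simp: successively_append_iff)
  next
    case False
    with xs step.hyps show ?thesis
      by (intro exI[of _ "x # xs"]) (cases xs; auto)
  qed
qed

text \<open>Closed up through \<open>u\<close>, such a path would be a cycle; with p \<noteq> q it
  has at least two vertices, which gives the length 3 that \<open>is_tree\<close> forbids.\<close>

lemma tree_paths_avoiding:
  assumes tree: "is_tree G" and "adjacent G u p" "adjacent G u q"
    and path: "(\<lambda>a b. adjacent G a b \<and> a \<noteq> u \<and> b \<noteq> u)\<^sup>*\<^sup>* p q"
  shows "p = q"
proof (rule ccontr)
  assume "p \<noteq> q"
  have sym: "symp (adjacent G)" and irr: "irreflp (adjacent G)" using tree by (auto simp: is_tree_def)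
  have "p \<noteq> u" "q \<noteq> u" using assms irr by (auto dest: irreflpD)
  obtain xs where xs: "xs \<noteq> []" "hd xs = p" "last xs = q" "distinct xs"
    "successively (\<lambda>a b. adjacent G a b \<and> a \<noteq> u \<and> b \<noteq> u) xs"
    using rtranclp_distinct_path[OF path] by blast
  have u: "u \<notin> set xs"
    using xs(1,2,5) \<open>p \<noteq> u\<close> by (induction xs arbitrary: p rule: induct_list012) auto
  obtain z zs where zs: "xs = p # z # zs"
    using xs(1-3) \<open>p \<noteq> q\<close> by (cases xs; cases "tl xs") auto
  have succ: "successively (adjacent G) xs"
    using xs(5) by (rule successively_mono) auto
  have "length (u # xs) \<ge> 3 \<and> distinct (u # xs) \<and> successively (adjacent G) (u # xs)
      \<and> adjacent G (last (u # xs)) (hd (u # xs))"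
    using zs u xs succ assms sym by (auto dest: sympD)
  with tree show False unfolding is_tree_def by blast
qed

text \<open>\<open>d\<close> is the distance from \<open>v\<close>. Shortest paths to
  \<open>v\<close> from two neighbours of \<open>u\<close> that are no farther away than
  \<open>u\<close> both avoid \<open>u\<close>, so the neighbours coincide; in particular no edge
  joins two vertices of equal distance.\<close>

lemma tree_depth:
  fixes v :: "'v::finite"
  assumes tree: "is_tree G"
  obtains d :: "'v \<Rightarrow> nat" where "d v = 0"
    "\<And>u. u \<noteq> v \<Longrightarrow> \<exists>p. adjacent G u p \<and> d p < d u \<and> (\<forall>q. adjacent G u q \<and> q \<noteq> p \<longrightarrow> d u < d q)"
proof -
  define d where "d u = (LEAST n. (adjacent G ^^ n) v u)" for u
  have sym: "symp (adjacent G)" and irr: "irreflp (adjacent G)" using tree by (auto simp: is_tree_def)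
  have ex: "\<exists>n. (adjacent G ^^ n) v u" for u
    using tree by (meson is_tree_def rtranclp_imp_relpowp)
  have d: "(adjacent G ^^ d u) v u" for u
    unfolding d_def by (rule LeastI_ex) (rule ex)
  have d_le: "d u \<le> n" if "(adjacent G ^^ n) v u" for u n
    unfolding d_def using that by (rule Least_le)
  have d0: "d v = 0" using d_le[of 0 v] by simp
  have pred: "\<exists>p. adjacent G u p \<and> d p < d u" if "u \<noteq> v" for u
  proof -
    have "d u \<noteq> 0" using d[of u] that by (metis relpowp_0_E)
    then obtain k where k: "d u = Suc k" by (cases "d u") auto
    then obtain p where "(adjacent G ^^ k) v p" "adjacent G p u"
      using d[of u] by (metis relpowp_Suc_E)
    with k d_le show ?thesis using sym by (metis less_Suc_eq_le sympD)
  qed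
  have down: "(\<lambda>a b. adjacent G a b \<and> a \<noteq> u \<and> b \<noteq> u)\<^sup>*\<^sup>* p v" if "d p \<le> d u" "p \<noteq> u" "u \<noteq> v" for u p
    using that
  proof (induction "d p" arbitrary: p rule: less_induct)
    case less
    show ?case
    proof (cases "p = v")
      case False
      then obtain q where q: "adjacent G p q" "d q < d p" using pred by blast
      then have "q \<noteq> u" using less by auto
      with less q show ?thesis
        by (intro converse_rtranclp_into_rtranclp[of _ p q]) auto
    qed auto
  qed
  have "\<exists>p. adjacent G u p \<and> d p < d u \<and> (\<forall>q. adjacent G u q \<and> q \<noteq> p \<longrightarrow> d u < d q)" if "u \<noteq> v" for u
  proof -
    obtain p where p: "adjacent G u p" "d p < d u" using pred \<open>u \<noteq> v\<close> by blast
    have "q = p" if q: "adjacent G u q" "d q \<le> d u" for q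
    proof -
      let ?r = "\<lambda>a b. adjacent G a b \<and> a \<noteq> u \<and> b \<noteq> u"
      have "q \<noteq> u" "p \<noteq> u" using q p irr by (auto dest: irreflpD)
      then have "?r\<^sup>*\<^sup>* q v" "?r\<^sup>*\<^sup>* p v"
        using down q p \<open>u \<noteq> v\<close> by auto
      moreover have "symp (?r\<^sup>*\<^sup>*)"
        by (rule symp_rtranclp) (use sym in \<open>auto simp: symp_def\<close>)
      ultimately have "?r\<^sup>*\<^sup>* q p"
        by (blast intro: rtranclp_trans dest: sympD)
      then show "q = p" using tree_paths_avoiding[OF tree] q p by blast
    qed
    with p show ?thesis by (meson not_le)
  qed
  with d0 show thesis using that by blast
qed

text \<open>Root the tree at \<open>w\<close>: a deepest descendant \<open>e\<close> of
  \<open>v\<close> is an end, and \<open>U\<close> is the complement of the descendants of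
  \<open>v\<close>, attached to them through \<open>v\<close> alone.\<close>

lemma tree_separating_end:
  fixes G :: "'v::finite plumbing_graph"
  assumes tree: "is_tree G" and "valency G v \<ge> 2" "w \<noteq> v"
  obtains e U where "e \<in> ends G" "w \<in> U" "v \<notin> U" "e \<notin> U"
    "\<And>a b. a \<in> U \<Longrightarrow> adjacent G a b \<Longrightarrow> b \<in> U \<or> b = v"
proof -
  have sym: "adjacent G a b \<Longrightarrow> adjacent G b a" for a b using tree by (auto simp: is_tree_def dest: sympD)
  obtain d :: "'v \<Rightarrow> nat" where d0: "d w = 0"
    and d: "\<And>u. u \<noteq> w \<Longrightarrow> \<exists>p. adjacent G u p \<and> d p < d u \<and> (\<forall>q. adjacent G u q \<and> q \<noteq> p \<longrightarrow> d u < d q)"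
    using tree_depth[OF tree] by blast
  define r where "r a b \<longleftrightarrow> adjacent G a b \<and> d a < d b" for a b
  define D where "D = {u. r\<^sup>*\<^sup>* v u}"
  have vD: "v \<in> D" by (simp add: D_def)
  have Dstep: "b \<in> D" if "a \<in> D" "r a b" for a b
    using that by (auto simp: D_def)
  have Dpred: "\<exists>a\<in>D. r a b" if "b \<in> D" "b \<noteq> v" for b
    using that unfolding D_def mem_Collect_eq by (metis rtranclp.cases mem_Collect_eq)
  have wD: "w \<notin> D" using Dpred[of w] assms d0 by (auto simp: r_def)
  obtain p where p: "adjacent G v p" "d p < d v" "\<And>q. adjacent G v q \<Longrightarrow> q \<noteq> p \<Longrightarrow> d v < d q"
    using d[of v] assms by blast
  obtain c where c: "adjacent G v c" "c \<noteq> p"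
  proof -
    have "{x. adjacent G v x} \<noteq> {p}" using assms(2) by (auto simp: valency_def)
    with p that show thesis by blast
  qed
  have cD: "c \<in> D" using c p by (intro Dstep[OF vD]) (auto simp: r_def)
  obtain e where e: "e \<in> D" "\<And>u. u \<in> D \<Longrightarrow> d u \<le> d e"
  proof -
    have "Max (d ` D) \<in> d ` D" using vD by (intro Max_in) auto
    then obtain e where "e \<in> D" "d e = Max (d ` D)" by force
    then show thesis using that by (metis Max_ge finite finite_imageI imageI)
  qed
  have "e \<noteq> v" using e(2)[OF cD] c p by force
  have "e \<noteq> w" using e wD by auto
  obtain q where q: "adjacent G e q" "\<And>u. adjacent G e u \<Longrightarrow> u \<noteq> q \<Longrightarrow> d e < d u"
    using d[OF \<open>e \<noteq> w\<close>] by blast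
  have "{u. adjacent G e u} = {q}"
  proof -
    have "u = q" if "adjacent G e u" for u
    proof (rule ccontr)
      assume "u \<noteq> q"
      then have "d e < d u" using q that by auto
      then have "u \<in> D" using Dstep[OF e(1)] that by (auto simp: r_def)
      with e(2) \<open>d e < d u\<close> show False by force
    qed
    with q(1) show ?thesis by blast
  qed
  then have "e \<in> ends G" by (simp add: ends_def valency_def)
  \<comment> \<open>A neighbour of a descendant b \<noteq> v is either its parent, which lies in
    \<open>D\<close>, or a child, which is again a descendant.\<close>
  moreover have "b \<in> - D \<or> b = v" if "a \<in> - D" "adjacent G a b" for a b
  proof (rule ccontr)
    assume "\<not> (b \<in> - D \<or> b = v)"
    then have b: "b \<in> D" "b \<noteq> v" by auto
    then have "b \<noteq> w" using wD by auto
    obtain p' where p': "adjacent G b p'" "d p' < d b" "\<And>q. adjacent G b q \<Longrightarrow> q \<noteq> p' \<Longrightarrow> d b < d q"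
      using d[OF \<open>b \<noteq> w\<close>] by blast
    obtain a' where a': "a' \<in> D" "r a' b" using Dpred[OF b] by blast
    then have "adjacent G b a'" "d a' < d b" using sym by (auto simp: r_def)
    then have "a' = p'" using p'(3)[of a'] by (metis less_asym)
    with a' that have "a \<noteq> p'" by auto
    have ba: "adjacent G b a" using that(2) by (rule sym)
    then have "d b < d a" using p'(3) \<open>a \<noteq> p'\<close> by blast
    then have "a \<in> D" using Dstep[OF b(1)] ba unfolding r_def by blast
    with that show False by simp
  qed
  ultimately show thesis
    using that[of e "- D"] wD vD e by auto
qed

section \<open>Summation over a rooted tree\<close>

text \<open>Extended by zero to negative degrees, so that exponents with a negative star coordinate
  drop out of products without a separate condition.\<close>

definition int_coeff :: "real fps \<Rightarrow> int \<Rightarrow> real" where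
  "int_coeff F k = (if k < 0 then 0 else fps_nth F (nat k))"

section \<open>Power series whose coefficients are eventually 1\<close>

lemma one_minus_X_inverse: "inverse (1 - fps_X :: real fps) = Abs_fps (\<lambda>_. 1)"
  by (rule fps_inverse_one_minus_fps_X)

lemma one_minus_X_powi_step:
  "(1 - fps_X :: real fps) powi k * inverse (1 - fps_X) = (1 - fps_X) powi (k - 1)"
proof -
  let ?u = "1 - fps_X :: real fps"
  have u: "?u * inverse ?u = 1" by (rule inverse_mult_eq_1') simp
  show ?thesis
  proof (cases "k \<ge> 1")
    case True
    then have "?u powi k = ?u powi (k - 1) * ?u"
      by (simp add: power_int_def nat_diff_distrib power_eq_if mult.commute)
    with u show ?thesis by (simp add: mult.assoc)
  next
    case False
    then have "nat (1 - k) = Suc (nat (- k))" by simp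
    with False show ?thesis
      by (auto simp: power_int_def mult.commute)
  qed
qed

text \<open>Division by 1 - X takes partial sums of coefficients, and from the degree of
  \<open>g\<close> on these equal g(1).\<close>

lemma poly_div_one_minus_X_nth:
  assumes "F = fps_of_poly g * inverse (1 - fps_X)" "poly g 1 = (1::real)" "degree g \<le> n"
  shows "fps_nth F n = 1"
proof -
  have "fps_nth F n = (\<Sum>i=0..n. coeff g i)"
    using assms by (simp add: fps_mult_nth one_minus_X_inverse)
  also have "\<dots> = (\<Sum>i\<le>degree g. coeff g i)"
    using assms(3) by (intro sum.mono_neutral_right) (auto simp: coeff_eq_0)
  also have "\<dots> = 1" using assms(2) by (simp add: poly_altdef)
  finally show ?thesis .
qed

text \<open>The converse: \<open>g\<close> is (1 - X) times \<open>H\<close>, so its coefficients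
  are successive differences and their sum telescopes to the constant 1.\<close>

lemma eventually_one_eq_poly_div:
  fixes H :: "real fps"
  assumes H: "\<And>t. t \<ge> m \<Longrightarrow> fps_nth H t = 1"
  obtains g where "H = fps_of_poly g * inverse (1 - fps_X)" "poly g 1 = 1" "degree g \<le> m"
proof -
  define c where "c i = (if i = 0 then fps_nth H 0 else fps_nth H i - fps_nth H (i - 1))" for i
  define g where "g = (\<Sum>i\<le>m. monom (c i) i)"
  have coeff: "coeff g i = (if i \<le> m then c i else 0)" for i
    by (simp add: g_def coeff_sum if_distrib sum.delta cong: if_cong)
  have deg: "degree g \<le> m" by (rule degree_le) (simp add: coeff)
  have c0: "c i = 0" if "i > m" for i
    using that H by (simp add: c_def)
  have "fps_of_poly g = H * (1 - fps_X)"
  proof (rule fps_ext)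
    fix n show "fps_nth (fps_of_poly g) n = fps_nth (H * (1 - fps_X)) n"
      using c0[of n] by (cases n) (auto simp: coeff c_def algebra_simps)
  qed
  then have "H = fps_of_poly g * inverse (1 - fps_X)"
    using inverse_mult_eq_1'[of "1 - fps_X :: real fps"] by (simp add: mult.assoc)
  moreover have "(\<Sum>i\<le>k. c i) = fps_nth H k" for k
    by (induction k) (auto simp: c_def)
  then have "poly g 1 = 1" using H by (simp add: g_def poly_sum poly_monom)
  ultimately show thesis using deg that by blast
qed

text \<open>This turns summation over the value t of a leaf into multiplication of its neighbour's
  series: raising the leaf by t lowers the exponent at the neighbour by t. Terms with t > k
  vanish.\<close>

lemma int_coeff_mult_Abs_fps:
  "int_coeff (F * Abs_fps h) k = (\<Sum>\<^sub>\<infinity>t. int_coeff F (k - int t) * h t)"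
proof -
  have "(\<Sum>\<^sub>\<infinity>t. int_coeff F (k - int t) * h t) = (\<Sum>\<^sub>\<infinity>t\<in>{..nat k}. int_coeff F (k - int t) * h t)"
    by (rule infsum_cong_neutral) (auto simp: int_coeff_def)
  also have "\<dots> = (\<Sum>t\<le>nat k. int_coeff F (k - int t) * h t)" by simp
  also have "\<dots> = int_coeff (F * Abs_fps h) k"
  proof (cases "k < 0")
    case False
    then have "int_coeff (F * Abs_fps h) k = (\<Sum>t\<le>nat k. h t * fps_nth F (nat k - t))"
      by (simp add: int_coeff_def mult.commute[of F] fps_mult_nth atLeast0AtMost)
    also have "\<dots> = (\<Sum>t\<le>nat k. int_coeff F (k - int t) * h t)"
      using False by (intro sum.cong) (auto simp: int_coeff_def nat_diff_distrib)
    finally show ?thesis by simp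
  qed (simp add: int_coeff_def)
  finally show ?thesis by simp
qed

lemma real_nat_ceiling_le: "x \<ge> - 1 \<Longrightarrow> real (nat \<lceil>x\<rceil>) \<le> x + 1"
  by linarith

text \<open>One step of the counting function at a coset point w above a deep point x:
  \<open>\<beta>\<close> is minus the decoration, \<open>a\<close> lists the products -(w, E_u),
  \<open>\<xi>\<close> is the gap w - x, and \<open>\<eta>\<close> is a positive vector with
  nonpositive products with all E_u. \<open>a_bound\<close> is the deepness of x rewritten at
  w.\<close>

locale rooted_tree_sum =
  fixes adj :: "'v::finite \<Rightarrow> 'v \<Rightarrow> bool" and v :: 'v and d :: "'v \<Rightarrow> nat"
    and \<beta> a :: "'v \<Rightarrow> int" and \<eta> \<xi> :: "'v \<Rightarrow> real"
  assumes adj_commute: "adj u w \<longleftrightarrow> adj w u"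
    and adj_irrefl: "\<not> adj u u"
    and depth_root: "d v = 0"
    and parent: "u \<noteq> v \<Longrightarrow> \<exists>p. adj u p \<and> d p < d u \<and> (\<forall>q. adj u q \<and> q \<noteq> p \<longrightarrow> d u < d q)"
    and \<eta>_pos: "\<eta> u > 0"
    and \<eta>_super: "(\<Sum>w | adj u w. \<eta> w) \<le> \<beta> u * \<eta> u"
    and \<xi>_nonneg: "0 \<le> \<xi> u" and \<xi>_le_1: "\<xi> u \<le> 1" and \<xi>_root: "\<xi> v = 0"
    and a_bound: "u \<noteq> v \<Longrightarrow> \<beta> u * \<xi> u - (\<Sum>w | adj u w. \<xi> w) + real (card {w. adj u w}) - 2 < a u"
    and a_root: "a v \<ge> - 1"
begin

definition nb :: "'v set \<Rightarrow> 'v \<Rightarrow> 'v set" where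
  "nb R u = {w \<in> R. adj u w}"

text \<open>For R = UNIV this is -(w + y, E_u), the exponent at which the factor of \<open>u\<close>
  is read off. For smaller \<open>R\<close> the influence of the eliminated neighbours sits in the
  series \<open>\<Phi>\<close> instead.\<close>

definition charge :: "'v set \<Rightarrow> ('v \<Rightarrow> nat) \<Rightarrow> 'v \<Rightarrow> int" where
  "charge R y u = a u + \<beta> u * int (y u) - (\<Sum>w\<in>nb R u. int (y w))"

definition weight :: "'v set \<Rightarrow> ('v \<Rightarrow> nat \<Rightarrow> real fps) \<Rightarrow> ('v \<Rightarrow> nat) \<Rightarrow> real" where
  "weight R \<Phi> y = (\<Prod>u\<in>R. int_coeff (\<Phi> u (y u)) (charge R y u))"

text \<open>The root value is 0 because the exponents to be summed lie above w but not above w +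
  E_v.\<close>

definition confs :: "'v set \<Rightarrow> ('v \<Rightarrow> nat) set" where
  "confs R = {y. (\<forall>u. u \<notin> R \<longrightarrow> y u = 0) \<and> y v = 0}"

definition threshold :: "'v \<Rightarrow> 'v \<Rightarrow> nat \<Rightarrow> nat" where
  "threshold u w s = nat \<lceil>\<eta> w * (real s + \<xi> u) / \<eta> u - \<xi> w\<rceil>"

text \<open>The factor \<open>(1 - fps_X) powi (r - 2)\<close>, with \<open>r\<close> the number of remaining neighbours, is what
  the original factor of \<open>u\<close> becomes if each eliminated neighbour contributes \<open>1 / (1 - fps_X)\<close>. The
  polynomial \<open>g\<close> accounts for the initial terms that differ from \<open>1\<close>. The threshold comes from
  the ratio \<open>(y\<^sub>u + \<xi>\<^sub>u) / \<eta>\<^sub>u\<close>: a leaf contributes \<open>1\<close> once its ratio is at least that of its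
  parent.\<close>

definition admissible :: "'v set \<Rightarrow> ('v \<Rightarrow> nat \<Rightarrow> real fps) \<Rightarrow> bool" where
  "admissible R \<Phi> \<longleftrightarrow> (\<forall>u\<in>R. \<forall>s. \<exists>g.
     \<Phi> u s = fps_of_poly g * (1 - fps_X) powi (int (card (nb R u)) - 2) \<and>
     poly g 1 = 1 \<and> degree g \<le> (\<Sum>w | adj u w \<and> w \<notin> R. threshold u w s))"

text \<open>The degree of the correction polynomial is compared with the exponent. An eliminated
  neighbour w contributes at most \<tau> \<eta>_w - \<xi>_w + 1, where \<tau> is the ratio at
  \<open>e\<close>; \<open>\<eta>_super\<close> bounds the sum of the \<eta>_w, and \<open>t\<close>
  beyond the threshold makes \<tau> at least the ratio at \<open>p\<close>. Rounding costs the
  number of neighbours minus 1, which \<open>a_bound\<close> absorbs up to a strict 1; integrality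
  removes that.\<close>

lemma leaf_series_eventually_one:
  assumes adm: "admissible R \<Phi>" and e: "e \<in> R" "e \<noteq> v" and nb: "nb R e = {p}"
    and t: "t \<ge> threshold p e s"
  shows "int_coeff (\<Phi> e t) (a e + \<beta> e * int t - int s) = 1"
proof -
  obtain g where g: "\<Phi> e t = fps_of_poly g * (1 - fps_X) powi (int (card (nb R e)) - 2)"
    "poly g 1 = 1" "degree g \<le> (\<Sum>w | adj e w \<and> w \<notin> R. threshold e w t)"
    using adm e by (auto simp: admissible_def)
  define D where "D = (\<Sum>w | adj e w \<and> w \<notin> R. threshold e w t)"
  define N where "N = {w. adj e w}"
  have p: "p \<in> N" "{w. adj e w \<and> w \<notin> R} = N - {p}"
    using nb by (auto simp: nb_def N_def)
  have fin: "finite N" by simp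
  define \<tau> where "\<tau> = (real t + \<xi> e) / \<eta> e"
  have \<tau>: "0 \<le> \<tau>" "real t + \<xi> e = \<tau> * \<eta> e"
    using \<eta>_pos[of e] \<xi>_nonneg[of e] by (auto simp: \<tau>_def)
  \<comment> \<open>Rounding up costs at most 1; \<open>\<xi>_le_1\<close> keeps the argument at
    least -1, so truncation by \<open>nat\<close> costs no more.\<close>
  have "real (threshold e w t) \<le> \<tau> * \<eta> w - \<xi> w + 1" for w
  proof -
    have "\<tau> * \<eta> w \<ge> 0" using \<tau> \<eta>_pos[of w] by simp
    then show ?thesis
      using real_nat_ceiling_le[of "\<tau> * \<eta> w - \<xi> w"] \<xi>_le_1[of w]
      by (simp add: threshold_def \<tau>_def mult_ac)
  qed
  then have "real D \<le> (\<Sum>w\<in>N - {p}. \<tau> * \<eta> w - \<xi> w + 1)"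
    unfolding D_def p(2) of_nat_sum by (intro sum_mono)
  also have "\<dots> = \<tau> * (sum \<eta> N - \<eta> p) - (sum \<xi> N - \<xi> p) + (real (card N) - 1)"
    using p(1) fin by (simp add: sum.distrib sum_subtractf sum_diff1 sum_distrib_left[symmetric] card_gt_0_iff of_nat_diff)
      (metis card_gt_0_iff empty_iff fin of_nat_1 of_nat_diff One_nat_def Suc_leI)
  also have "\<dots> \<le> \<tau> * (\<beta> e * \<eta> e - \<eta> p) - (sum \<xi> N - \<xi> p) + (real (card N) - 1)"
    using \<eta>_super[of e] \<tau> by (simp add: N_def mult_left_mono)
  also have "\<dots> = \<beta> e * (real t + \<xi> e) - \<tau> * \<eta> p - (sum \<xi> N - \<xi> p) + (real (card N) - 1)"
    by (simp add: \<tau>(2) algebra_simps)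
  also have "\<dots> \<le> \<beta> e * (real t + \<xi> e) - (real s + \<xi> p) - (sum \<xi> N - \<xi> p) + (real (card N) - 1)"
  proof -
    have "\<eta> e * (real s + \<xi> p) / \<eta> p - \<xi> e \<le> real t"
      using t unfolding threshold_def by linarith
    then have "\<eta> e * (real s + \<xi> p) / \<eta> p \<le> \<tau> * \<eta> e" using \<tau> by simp
    then have "\<eta> e * ((real s + \<xi> p) / \<eta> p) \<le> \<eta> e * \<tau>" by (simp add: mult.commute[of \<tau>])
    then have "(real s + \<xi> p) / \<eta> p \<le> \<tau>" using \<eta>_pos[of e] mult_le_cancel_left_pos by blast
    then show ?thesis using \<eta>_pos[of p] by (simp add: divide_le_eq)
  qed
  also have "\<dots> < a e + \<beta> e * real t - real s + 1"
    using a_bound[OF e(2)] by (simp add: N_def algebra_simps)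
  finally have "of_int (int D) < (of_int (a e + \<beta> e * int t - int s + 1) :: real)"
    by simp
  then have "int D < a e + \<beta> e * int t - int s + 1"
    by (simp only: of_int_less_iff)
  then have D: "int D \<le> a e + \<beta> e * int t - int s" by simp
  have "card (nb R e) = 1" using nb by simp
  then have "\<Phi> e t = fps_of_poly g * inverse (1 - fps_X)"
    using g(1) by (simp add: power_int_def)
  then have "fps_nth (\<Phi> e t) (nat (a e + \<beta> e * int t - int s)) = 1"
    using g(2,3) D unfolding D_def[symmetric] by (intro poly_div_one_minus_X_nth) auto
  then show ?thesis using D by (simp add: int_coeff_def)
qed

text \<open>The value t of \<open>e\<close> enters only the charge of \<open>e\<close> and, as -t,
  that of \<open>p\<close>. Summing it out is a convolution, absorbed into the series at
  \<open>p\<close>. Finite support justifies exchanging the sums.\<close>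

lemma eliminate_leaf:
  assumes e: "e \<in> R" "e \<noteq> v" and nb: "nb R e = {p}"
    and adm: "admissible R \<Phi>" and fin: "finite {y \<in> confs R. weight R \<Phi> y \<noteq> 0}"
  obtains \<Psi> where "admissible (R - {e}) \<Psi>"
    "finite {y \<in> confs (R - {e}). weight (R - {e}) \<Psi> y \<noteq> 0}"
    "infsum (weight R \<Phi>) (confs R) = infsum (weight (R - {e}) \<Psi>) (confs (R - {e}))"
proof -
  \<comment> \<open>For a fixed value s of the neighbour \<open>p\<close>, the factors of
    \<open>e\<close> form a sequence in its own value t, which becomes a series.\<close>
  define H where "H s t = int_coeff (\<Phi> e t) (a e + \<beta> e * int t - int s)" for s t
  define \<Psi> where "\<Psi> u s = (if u = p then \<Phi> p s * Abs_fps (H s) else \<Phi> u s)" for u s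
  let ?R = "R - {e}"
  have p: "p \<in> ?R" "adj e p" "adj p e"
    using nb adj_irrefl adj_commute by (auto simp: nb_def)
  have nbp: "nb R p = insert e (nb ?R p)" "e \<notin> nb ?R p"
    using p e by (auto simp: nb_def)
  have nbu: "nb ?R u = nb R u" "\<not> adj u e" if "u \<in> ?R" "u \<noteq> p" for u
  proof -
    show "\<not> adj u e" using nb that adj_commute[of u e] by (auto simp: nb_def)
    then show "nb ?R u = nb R u" by (auto simp: nb_def)
  qed
  have admissible': "admissible ?R \<Psi>"
    unfolding admissible_def
  proof (intro ballI allI)
    fix u s assume u: "u \<in> ?R"
    obtain g where g: "\<Phi> u s = fps_of_poly g * (1 - fps_X) powi (int (card (nb R u)) - 2)"
      "poly g 1 = 1" "degree g \<le> (\<Sum>w | adj u w \<and> w \<notin> R. threshold u w s)"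
      using adm u by (fastforce simp: admissible_def)
    show "\<exists>g. \<Psi> u s = fps_of_poly g * (1 - fps_X) powi (int (card (nb ?R u)) - 2) \<and>
       poly g 1 = 1 \<and> degree g \<le> (\<Sum>w | adj u w \<and> w \<notin> ?R. threshold u w s)"
    proof (cases "u = p")
      case False
      then have "{w. adj u w \<and> w \<notin> ?R} = {w. adj u w \<and> w \<notin> R}" using nbu u by auto
      with False g nbu[OF u] show ?thesis by (auto simp: \<Psi>_def)
    next
      case True
      have "fps_nth (Abs_fps (H s)) t = 1" if "t \<ge> threshold p e s" for t
        using leaf_series_eventually_one[OF adm e nb that] by (simp add: H_def)
      then obtain h where h: "Abs_fps (H s) = fps_of_poly h * inverse (1 - fps_X)" "poly h 1 = 1"
        "degree h \<le> threshold p e s"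
        by (rule eventually_one_eq_poly_div)
      have set: "{w. adj u w \<and> w \<notin> ?R} = insert e {w. adj u w \<and> w \<notin> R}" using p e True by auto
      have "\<Psi> u s = fps_of_poly (g * h) * ((1 - fps_X) powi (int (card (nb R u)) - 2) * inverse (1 - fps_X))"
        using True g(1) h(1) by (simp add: \<Psi>_def fps_of_poly_mult mult_ac)
      also have "\<dots> = fps_of_poly (g * h) * (1 - fps_X) powi (int (card (nb ?R u)) - 2)"
        using nbp True by (simp add: one_minus_X_powi_step nb_def)
      finally have "\<Psi> u s = fps_of_poly (g * h) * (1 - fps_X) powi (int (card (nb ?R u)) - 2)" .
      moreover have "degree (g * h) \<le> (\<Sum>w | adj u w \<and> w \<notin> ?R. threshold u w s)"
        unfolding set using e g(3) h(3) True
        by (intro order.trans[OF degree_mult_le]) (simp add: add.commute add_mono)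
      moreover have "poly (g * h) 1 = 1" using g h by simp
      ultimately show ?thesis by blast
    qed
  qed
  define A where "A y = (\<Prod>u\<in>?R - {p}. int_coeff (\<Phi> u (y u)) (charge ?R y u))" for y
  have split: "weight R \<Phi> (y(e := t)) =
      A y * (int_coeff (\<Phi> p (y p)) (charge ?R y p - int t) * H (y p) t)" for y t
  proof -
    let ?y = "y(e := t)"
    have "weight R \<Phi> ?y = int_coeff (\<Phi> e t) (charge R ?y e) *
        (int_coeff (\<Phi> p (y p)) (charge R ?y p) * (\<Prod>u\<in>?R - {p}. int_coeff (\<Phi> u (?y u)) (charge R ?y u)))"
      unfolding weight_def using e p
      by (subst prod.remove[of R e], simp, simp, subst prod.remove[of ?R p]) auto
    also have "(\<Prod>u\<in>?R - {p}. int_coeff (\<Phi> u (?y u)) (charge R ?y u)) = A y"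
      unfolding A_def
    proof (intro prod.cong refl)
      fix u assume "u \<in> ?R - {p}"
      then have u: "u \<in> ?R" "u \<noteq> p" by auto
      have "(\<Sum>w\<in>nb ?R u. int (?y w)) = (\<Sum>w\<in>nb ?R u. int (y w))"
        by (intro sum.cong) (auto simp: nb_def)
      then have "charge R ?y u = charge ?R y u"
        using u nbu(1)[OF u, symmetric] by (simp add: charge_def)
      with u show "int_coeff (\<Phi> u (?y u)) (charge R ?y u) = int_coeff (\<Phi> u (y u)) (charge ?R y u)"
        by simp
    qed
    also have "charge R ?y p = charge ?R y p - int t"
    proof -
      have "(\<Sum>w\<in>nb ?R p. int (?y w)) = (\<Sum>w\<in>nb ?R p. int (y w))"
        by (intro sum.cong) (auto simp: nb_def)
      then show ?thesis using p nbp by (simp add: charge_def)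
    qed
    also have "charge R ?y e = a e + \<beta> e * int t - int (y p)"
      using p nb by (simp add: charge_def)
    finally show ?thesis by (simp only: H_def mult_ac)
  qed
  have inner: "(\<Sum>\<^sub>\<infinity>t. weight R \<Phi> (y(e := t))) = weight ?R \<Psi> y" for y
  proof -
    have "(\<Sum>\<^sub>\<infinity>t. weight R \<Phi> (y(e := t)))
        = A y * (\<Sum>\<^sub>\<infinity>t. int_coeff (\<Phi> p (y p)) (charge ?R y p - int t) * H (y p) t)"
      by (simp add: split infsum_cmult_right')
    also have "\<dots> = A y * int_coeff (\<Psi> p (y p)) (charge ?R y p)"
      by (simp add: \<Psi>_def int_coeff_mult_Abs_fps)
    also have "\<dots> = weight ?R \<Psi> y"
      unfolding weight_def A_def using p
      by (subst prod.remove[of ?R p]) (auto simp: \<Psi>_def intro!: prod.cong)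
    finally show ?thesis .
  qed
  have bij: "bij_betw (\<lambda>(y, t). y(e := t)) (confs ?R \<times> UNIV) (confs R)"
    by (rule bij_betwI[where g = "\<lambda>y. (y(e := 0), y e)"]) (use e in \<open>auto simp: confs_def fun_eq_iff\<close>)
  have supp: "finite {z \<in> confs ?R \<times> UNIV. (\<lambda>(y, t). weight R \<Phi> (y(e := t))) z \<noteq> 0}"
  proof (rule finite_imageD)
    have "(\<lambda>(y, t). y(e := t)) ` {z \<in> confs ?R \<times> UNIV. (\<lambda>(y, t). weight R \<Phi> (y(e := t))) z \<noteq> 0}
        \<subseteq> {y \<in> confs R. weight R \<Phi> y \<noteq> 0}"
      using bij unfolding bij_betw_def by force
    then show "finite ((\<lambda>(y, t). y(e := t)) ` {z \<in> confs ?R \<times> UNIV. (\<lambda>(y, t). weight R \<Phi> (y(e := t))) z \<noteq> 0})"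
      by (rule finite_subset) (rule fin)
    show "inj_on (\<lambda>(y, t). y(e := t)) {z \<in> confs ?R \<times> UNIV. (\<lambda>(y, t). weight R \<Phi> (y(e := t))) z \<noteq> 0}"
      using bij unfolding bij_betw_def by (rule inj_on_subset[OF conjunct1]) auto
  qed
  have "infsum (weight R \<Phi>) (confs R)
      = infsum (\<lambda>(y, t). weight R \<Phi> (y(e := t))) (confs ?R \<times> UNIV)"
    using infsum_reindex_bij_betw[OF bij, of "weight R \<Phi>"] by (simp add: case_prod_unfold)
  also have "\<dots> = infsum (\<lambda>y. \<Sum>\<^sub>\<infinity>t. weight R \<Phi> (y(e := t))) (confs ?R)"
    by (rule infsum_Sigma'_banach[symmetric, where B = "\<lambda>_. UNIV"])
      (rule finite_nonzero_values_imp_summable_on[OF supp])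
  finally have eq: "infsum (weight R \<Phi>) (confs R) = infsum (weight ?R \<Psi>) (confs ?R)"
    by (simp add: inner)
  \<comment> \<open>A nonzero sum over t has a nonzero term, so finite support survives the
    elimination.\<close>
  have "{y \<in> confs ?R. weight ?R \<Psi> y \<noteq> 0}
      \<subseteq> fst ` {z \<in> confs ?R \<times> UNIV. (\<lambda>(y, t). weight R \<Phi> (y(e := t))) z \<noteq> 0}"
  proof
    fix y assume y: "y \<in> {y \<in> confs ?R. weight ?R \<Psi> y \<noteq> 0}"
    then have "(\<Sum>\<^sub>\<infinity>t. weight R \<Phi> (y(e := t))) \<noteq> 0" by (simp add: inner)
    then obtain t where "weight R \<Phi> (y(e := t)) \<noteq> 0" by (metis (mono_tags, lifting) infsum_0)
    with y show "y \<in> fst ` {z \<in> confs ?R \<times> UNIV. (\<lambda>(y, t). weight R \<Phi> (y(e := t))) z \<noteq> 0}"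
      by (intro image_eqI[of _ _ "(y, t)"]) auto
  qed
  then have "finite {y \<in> confs ?R. weight ?R \<Psi> y \<noteq> 0}"
    using supp finite_subset by blast
  with admissible' eq show thesis using that by blast
qed

text \<open>Vertices are removed from the deepest upwards. The second assumption keeps the parent of
  every remaining vertex, so a deepest one is a leaf of what is left.\<close>

lemma infsum_weight:
  assumes "v \<in> R" and closed: "\<And>u p. u \<in> R \<Longrightarrow> u \<noteq> v \<Longrightarrow> adj u p \<Longrightarrow> d p < d u \<Longrightarrow> p \<in> R"
    and "admissible R \<Phi>" and "finite {y \<in> confs R. weight R \<Phi> y \<noteq> 0}"
  shows "infsum (weight R \<Phi>) (confs R) = of_int (a v + 1)"
  using assms
proof (induction "card R" arbitrary: R \<Phi> rule: less_induct)
  case less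
  show ?case
  proof (cases "R = {v}")
    case True
    have nbv: "nb {v} v = {}" using adj_irrefl by (auto simp: nb_def)
    obtain g where g: "\<Phi> v 0 = fps_of_poly g * (1 - fps_X) powi (int (card (nb R v)) - 2)"
      "poly g 1 = 1" "degree g \<le> (\<Sum>w | adj v w \<and> w \<notin> R. threshold v w 0)"
      using less.prems unfolding admissible_def by blast
    \<comment> \<open>At the root the value and the gap are both 0, so all thresholds vanish and no
      correction polynomial survives: the series is exactly 1 / (1 - X)^2.\<close>
    have "threshold v w 0 = 0" for w
      using \<xi>_nonneg[of w] by (simp add: threshold_def \<xi>_root)
    then have "degree g = 0" using g(3) by simp
    then obtain k where "g = [:k:]" by (rule degree_eq_zeroE)
    then have "g = 1" using g(2) by simp
    then have \<Phi>: "\<Phi> v 0 = inverse ((1 - fps_X)^2)"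
      using g(1) True nbv by (simp add: power_int_def fps_inverse_power)
    have "confs R = {\<lambda>_. 0}" using True by (auto simp: confs_def fun_eq_iff) metis
    then have "infsum (weight R \<Phi>) (confs R) = int_coeff (\<Phi> v 0) (a v)"
      using True nbv by (simp add: weight_def charge_def)
    \<comment> \<open>The coefficient of degree a is a + 1; for a = -1 both sides are 0 because
      \<open>int_coeff\<close> is extended by zero.\<close>
    also have "\<dots> = of_int (a v + 1)"
      using a_root by (auto simp: int_coeff_def \<Phi> fps_one_over_one_minus_fps_X_squared')
    finally show ?thesis .
  next
    case False
    have "R - {v} \<noteq> {}" using False less.prems(1) by auto
    then have "Max (d ` (R - {v})) \<in> d ` (R - {v})" by (intro Max_in) auto
    then obtain e where "e \<in> R - {v}" "d e = Max (d ` (R - {v}))" by force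
    then have e: "e \<in> R - {v}" "\<And>u. u \<in> R - {v} \<Longrightarrow> d u \<le> d e" by simp_all
    obtain p where p: "adj e p" "d p < d e" "\<And>q. adj e q \<Longrightarrow> q \<noteq> p \<Longrightarrow> d e < d q"
      using parent[of e] e by blast
    have "q = p" if "adj e q" "q \<in> R" for q
      using p(3)[OF that(1)] e(2)[of q] that depth_root by force
    moreover have "p \<in> R" using less.prems(2)[of e p] e p by auto
    ultimately have nb: "nb R e = {p}" using p(1) unfolding nb_def by blast
    obtain \<Psi> where \<Psi>: "admissible (R - {e}) \<Psi>"
      "finite {y \<in> confs (R - {e}). weight (R - {e}) \<Psi> y \<noteq> 0}"
      "infsum (weight R \<Phi>) (confs R) = infsum (weight (R - {e}) \<Psi>) (confs (R - {e}))"
      using eliminate_leaf[OF _ _ nb less.prems(3,4)] e by blast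
    have closed': "q \<in> R - {e}" if "u \<in> R - {e}" "u \<noteq> v" "adj u q" "d q < d u" for u q
      using less.prems(2)[of u q] e(2)[of u] that by force
    have "card (R - {e}) < card R" using e by (intro card_Diff1_less) auto
    then have "infsum (weight (R - {e}) \<Psi>) (confs (R - {e})) = of_int (a v + 1)"
      by (rule less.hyps) (use closed' \<Psi>(1,2) e(1) less.prems(1) in \<open>blast+\<close>)
    with \<Psi>(3) show ?thesis by (rule trans)
  qed
qed

end

section \<open>The dual basis and the minimum principle\<close>

lemma det_Rats:
  fixes A :: "real ^ 'n ^ 'n::finite"
  assumes "\<And>i j. A $ i $ j \<in> \<rat>"
  shows "det A \<in> \<rat>"
  unfolding det_def using assms by (intro Rats_sum Rats_mult Rats_prod) auto

text \<open>Cramer's rule writes the solution as quotients of rational determinants.\<close>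

lemma rational_linear_system:
  fixes A :: "real ^ 'n ^ 'n::finite"
  assumes A: "\<And>i j. A $ i $ j \<in> \<rat>" and b: "\<And>i. b $ i \<in> \<rat>"
    and ker: "\<And>x. A *v x = 0 \<Longrightarrow> x = 0"
  obtains x where "A *v x = b" "\<And>i. x $ i \<in> \<rat>"
proof -
  have "invertible A"
    using ker matrix_left_invertible_ker[of A] invertible_left_inverse by blast
  then have det: "det A \<noteq> 0" by (simp add: invertible_det_nz)
  define x where "x = (\<chi> k. det (\<chi> i j. if j = k then b $ i else A $ i $ j) / det A)"
  have "A *v x = b" using cramer[OF det, of x b] by (simp add: x_def)
  moreover have "x $ i \<in> \<rat>" for i
    unfolding x_def vec_lambda_beta using A b by (intro Rats_divide det_Rats) auto
  ultimately show thesis using that by blast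
qed

text \<open>The coordinates in the basis of the \<open>E_star\<close> vectors (see
  \<open>E_star_expansion\<close>); the sign makes \<open>S_cone\<close> the nonnegative
  orthant.\<close>

definition star_coord :: "'v::finite plumbing_graph \<Rightarrow> real ^ 'v \<Rightarrow> 'v \<Rightarrow> real" where
  "star_coord G x u = - form G x (E_base u)"

lemma form_add_left: "form G (x + y) z = form G x z + form G y z"
  by (simp add: form_def inner_add_left)

lemma form_scaleR_left: "form G (c *\<^sub>R x) z = c * form G x z"
  by (simp add: form_def)

lemma form_add_right: "form G x (y + z) = form G x y + form G x z"
  by (simp add: form_def matrix_vector_right_distrib inner_add_right)

lemma linear_star_coord: "linear (\<lambda>x. star_coord G x u)"
  by (rule linearI) (simp_all add: star_coord_def form_add_left form_scaleR_left)

lemma star_coord_simps [simp]: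
  "star_coord G (x + y) u = star_coord G x u + star_coord G y u"
  "star_coord G (x - y) u = star_coord G x u - star_coord G y u"
  "star_coord G (- x) u = - star_coord G x u"
  "star_coord G (c *\<^sub>R x) u = c * star_coord G x u"
  "star_coord G 0 u = 0"
  using linear_add[OF linear_star_coord[of G u]] linear_diff[OF linear_star_coord[of G u]]
    linear_neg[OF linear_star_coord[of G u]] linear_scale[OF linear_star_coord[of G u]]
    linear_0[OF linear_star_coord[of G u]]
  by auto

lemma star_coord_sum: "star_coord G (sum f A) u = (\<Sum>i\<in>A. star_coord G (f i) u)"
  by (rule linear_sum[OF linear_star_coord])

lemma form_eq_star_coord_sum: "form G x y = - (\<Sum>u\<in>UNIV. star_coord G x u * y $ u)"
proof -
  have "form G x y = x \<bullet> (intersection_matrix G *v (\<Sum>u\<in>UNIV. y $ u *\<^sub>R E_base u))"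
    using basis_expansion[of y] by (simp add: form_def scalar_mult_eq_scaleR)
  also have "\<dots> = (\<Sum>u\<in>UNIV. y $ u * form G x (E_base u))"
    by (simp add: linear_sum[OF matrix_vector_mul_linear] inner_sum_right form_def
        matrix_vector_mult_scaleR)
  finally show ?thesis
    by (simp add: star_coord_def sum_negf[symmetric] mult.commute)
qed

locale plumbing_tree =
  fixes G :: "'v::finite plumbing_graph"
  assumes tree: "is_tree G" and neg_def: "negative_definite G"
begin

abbreviation co :: "real ^ 'v \<Rightarrow> 'v \<Rightarrow> real" where "co \<equiv> star_coord G"

abbreviation nbrs :: "'v \<Rightarrow> 'v set" where "nbrs u \<equiv> {w. adjacent G u w}"

lemma adjacent_commute: "adjacent G u w \<longleftrightarrow> adjacent G w u"
  using tree by (auto simp: is_tree_def dest: sympD)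

lemma not_adjacent_self [simp]: "\<not> adjacent G u u"
  using tree by (auto simp: is_tree_def dest: irreflpD)

lemma form_commute: "form G x y = form G y x"
proof -
  have "transpose (intersection_matrix G) = intersection_matrix G"
    using adjacent_commute by (auto simp: vec_eq_iff transpose_def intersection_matrix_def)
  then show ?thesis
    unfolding form_def by (metis dot_lmul_matrix inner_commute transpose_matrix_vector)
qed

lemma star_coord_eq:
  "co x u = - of_int (decoration G u) * x $ u - (\<Sum>w\<in>nbrs u. x $ w)"
proof -
  have "(intersection_matrix G *v E_base u) $ i =
      (if i = u then of_int (decoration G u) else 0) + (if i \<in> nbrs u then 1 else 0)" for i
    using adjacent_commute[of i u]
    by (simp add: matrix_vector_mult_basis column_def intersection_matrix_def)
  then have "form G x (E_base u) = (\<Sum>i\<in>UNIV. x $ i * (if i = u then of_int (decoration G u) else 0)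
      + x $ i * (if i \<in> nbrs u then 1 else 0))"
    by (simp add: form_def inner_vec_def distrib_left)
  also have "\<dots> = x $ u * of_int (decoration G u) + (\<Sum>w\<in>nbrs u. x $ w)"
    by (simp add: sum.distrib if_distrib[of "\<lambda>c. _ * c"] sum.delta' sum.If_cases cong: if_cong)
  finally show ?thesis by (simp add: star_coord_def)
qed

lemma co_E_base:
  "co (E_base w) u = (if w = u then - of_int (decoration G u) else if adjacent G u w then - 1 else 0)"
proof -
  have "(\<Sum>i\<in>nbrs u. E_base w $ i) = (if adjacent G u w then 1 else (0 :: real))"
    by (simp add: axis_def sum.delta)
  then show ?thesis by (auto simp: star_coord_eq axis_def)
qed

text \<open>Let \<open>y\<close> be the negative part and \<open>z\<close> the positive part of
  \<open>x\<close>. The hypothesis gives (x, y) \<le> 0, and disjoint supports with nonnegative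
  off-diagonal entries give (z, y) \<ge> 0; so (y, y) \<ge> 0 and y = 0. Asking for the sign only
  where \<open>x\<close> is negative is what admits boundary values at chosen vertices.\<close>

lemma minimum_principle:
  assumes "\<And>u. x $ u < 0 \<Longrightarrow> co x u \<ge> 0"
  shows "x $ u \<ge> 0"
proof -
  define y :: "real ^ 'v" where "y = (\<chi> u. max 0 (- x $ u))"
  define z where "z = x + y"
  have z: "z $ u \<ge> 0" "y $ u * z $ u = 0" "y $ u \<ge> 0" for u
    by (auto simp: z_def y_def max_def)
  have "form G x y \<le> 0"
  proof -
    have "co x u * y $ u \<ge> 0" for u
      using assms[of u] by (cases "x $ u < 0") (auto simp: y_def mult_nonneg_nonpos)
    then show ?thesis by (simp add: form_eq_star_coord_sum sum_nonneg)
  qed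
  moreover have "form G z y \<ge> 0"
  proof -
    have "- (\<Sum>u\<in>UNIV. co z u * y $ u) = (\<Sum>u\<in>UNIV. y $ u * (\<Sum>w\<in>nbrs u. z $ w))"
    proof -
      have "co z u * y $ u = - (y $ u * (\<Sum>w\<in>nbrs u. z $ w))" for u
        using z(2)[of u] by (auto simp: star_coord_eq algebra_simps)
      then show ?thesis by (simp add: sum_negf)
    qed
    also have "\<dots> \<ge> 0" using z by (intro sum_nonneg mult_nonneg_nonneg) auto
    finally show ?thesis by (simp add: form_eq_star_coord_sum)
  qed
  ultimately have "form G y y \<ge> 0" by (simp add: z_def form_add_left)
  then have "y = 0" using neg_def by (auto simp: negative_definite_def not_less[symmetric])
  then have "y $ u = 0" by simp
  then show ?thesis by (simp add: y_def)
qed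

lemma star_coord_inject:
  assumes "\<And>u. co x u = co y u"
  shows "x = y"
proof -
  have *: "(x - y) $ u \<ge> 0" "(y - x) $ u \<ge> 0" for u
    using assms by (intro minimum_principle; simp)+
  have "x $ u = y $ u" for u using *(1)[of u] *(2)[of u] by simp
  then show ?thesis by (simp add: vec_eq_iff)
qed

lemma L_dual_iff: "x \<in> L_dual G \<longleftrightarrow> (\<forall>v. x $ v \<in> \<rat>) \<and> (\<forall>u. co x u \<in> \<int>)"
proof -
  have "co x u \<in> \<int>" if "\<forall>y\<in>L_int. form G x y \<in> \<int>" for u
  proof -
    have "E_base u \<in> (L_int :: (real ^ 'v) set)" by (auto simp: L_int_def axis_def)
    with that show ?thesis by (auto simp: star_coord_def)
  qed
  then show ?thesis
    by (auto simp: L_dual_def form_eq_star_coord_sum L_int_def intro!: Ints_sum Ints_mult)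
qed

lemma E_star_exists: "\<exists>x. x \<in> L_dual G \<and> (\<forall>w. co x w = (if w = v then 1 else 0))"
proof -
  have I: "(intersection_matrix G *v x) $ w = - co x w" for x w
    using form_commute[of x "E_base w"] by (simp add: star_coord_def form_def inner_axis')
  obtain x where x: "intersection_matrix G *v x = - E_base v" "\<And>i. x $ i \<in> \<rat>"
  proof (rule rational_linear_system[of "intersection_matrix G" "- E_base v"])
    show "x = 0" if "intersection_matrix G *v x = 0" for x
      using that I[of x] by (intro star_coord_inject) simp
  qed (auto simp: intersection_matrix_def axis_def)
  have "co x w = (if w = v then 1 else 0)" for w
    using I[of x w] x(1) by (simp add: axis_def)
  then show ?thesis using x(2) by (intro exI[of _ x]) (auto simp: L_dual_iff)
qed

lemma E_star: "E_star G v \<in> L_dual G" "co (E_star G v) w = (if w = v then 1 else 0)"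
proof -
  have "\<exists>!x. x \<in> L_dual G \<and> (\<forall>w. co x w = (if w = v then 1 else 0))"
    using E_star_exists[of v] star_coord_inject by (metis (no_types, lifting))
  then have "\<exists>!x. x \<in> L_dual G \<and> (\<forall>w. form G x (E_base w) = (if w = v then - 1 else 0))"
    unfolding star_coord_def by (smt (verit, best))
  from theI'[OF this] show "E_star G v \<in> L_dual G" "co (E_star G v) w = (if w = v then 1 else 0)"
    unfolding E_star_def[symmetric] star_coord_def by auto
qed

lemma star_coord_combination:
  "finite A \<Longrightarrow> co (\<Sum>v\<in>A. c v *\<^sub>R E_star G v) u = (if u \<in> A then c u else 0)"
  by (simp add: star_coord_sum E_star if_distrib sum.delta cong: if_cong)

lemma star_coord_full: "co (\<Sum>v\<in>UNIV. c v *\<^sub>R E_star G v) u = c u"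
  by (simp add: star_coord_combination)

lemma E_star_expansion: "x = (\<Sum>v\<in>UNIV. co x v *\<^sub>R E_star G v)"
  by (rule star_coord_inject) (simp add: star_coord_combination)

text \<open>The strong form: a nonnegative vector of this kind that vanishes at a vertex vanishes at
  its neighbours, hence everywhere by connectedness.\<close>

lemma superharmonic_pos:
  assumes "\<And>u. co x u \<ge> 0" "x \<noteq> 0"
  shows "x $ u > 0"
proof (rule ccontr)
  have nonneg: "x $ w \<ge> 0" for w using assms(1) by (intro minimum_principle)
  assume "\<not> x $ u > 0"
  then have u0: "x $ u = 0" using nonneg[of u] by simp
  have step: "x $ b = 0" if "x $ a = 0" "adjacent G a b" for a b
  proof -
    have "(\<Sum>w\<in>nbrs a. x $ w) \<le> 0"
      using assms(1)[of a] that(1) by (simp add: star_coord_eq)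
    then have "(\<Sum>w\<in>nbrs a. x $ w) = 0" using nonneg by (intro antisym sum_nonneg) auto
    then show ?thesis using nonneg that by (subst (asm) sum_nonneg_eq_0_iff) auto
  qed
  have "x $ w = 0" for w
  proof -
    have "(adjacent G)\<^sup>*\<^sup>* u w" using tree by (auto simp: is_tree_def)
    then show ?thesis by induction (use u0 step in auto)
  qed
  then show False using assms(2) by (auto simp: vec_eq_iff)
qed

lemma E_star_pos: "E_star G v $ u > 0"
proof (rule superharmonic_pos)
  show "E_star G v \<noteq> 0" using E_star(2)[of v v] by auto
qed (simp add: E_star)

lemma V_nodes_iff: "x \<in> V_nodes G \<longleftrightarrow> (\<forall>u. u \<notin> nodes G \<longrightarrow> co x u = 0)"
proof
  assume "x \<in> V_nodes G"
  then show "\<forall>u. u \<notin> nodes G \<longrightarrow> co x u = 0"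
    unfolding V_nodes_def
    by (induction rule: span_induct_alt) (use E_star(2) in \<open>auto split: if_splits\<close>)
next
  assume *: "\<forall>u. u \<notin> nodes G \<longrightarrow> co x u = 0"
  have "x = (\<Sum>v\<in>nodes G. co x v *\<^sub>R E_star G v)"
    by (rule star_coord_inject) (use * in \<open>auto simp: star_coord_combination\<close>)
  also have "\<dots> \<in> V_nodes G"
    unfolding V_nodes_def by (intro span_sum span_scale span_base) auto
  finally show "x \<in> V_nodes G" .
qed

text \<open>At a non-node m - l has the same star coordinate as m. The exponents in the support of
  \<open>Z\<close> and the end sums satisfy the condition on \<open>m\<close>.\<close>

lemma le_iff_pr_nodes_le:
  assumes "l \<in> V_nodes G" and "\<And>u. u \<notin> nodes G \<Longrightarrow> co m u \<ge> 0"
  shows "l \<le> m \<longleftrightarrow> pr_nodes G l \<le> pr_nodes G m"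
proof
  assume "pr_nodes G l \<le> pr_nodes G m"
  then have nodes: "(m - l) $ u \<ge> 0" if "u \<in> nodes G" for u
    using that by (auto simp: less_eq_vec_def pr_nodes_def split: if_splits)
  have "(m - l) $ u \<ge> 0" for u
  proof (rule minimum_principle)
    fix u assume "(m - l) $ u < 0"
    then have "u \<notin> nodes G" using nodes[of u] by auto
    then show "co (m - l) u \<ge> 0" using assms by (simp add: V_nodes_iff)
  qed
  then show "l \<le> m" by (simp add: less_eq_vec_def)
qed (auto simp: less_eq_vec_def pr_nodes_def)

end

section \<open>Counting functions\<close>

lemma L_int_diff: "x \<in> L_int \<Longrightarrow> y \<in> L_int \<Longrightarrow> x - y \<in> L_int"
  by (simp add: L_int_def)

lemma L_int_add: "x \<in> L_int \<Longrightarrow> y \<in> L_int \<Longrightarrow> x + y \<in> L_int"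
  by (simp add: L_int_def)

lemma counting_function_cong:
  assumes "\<And>m. p m \<noteq> 0 \<Longrightarrow> l \<le> m \<longleftrightarrow> l' \<le> m"
  shows "counting_function p l = counting_function p l'"
  unfolding counting_function_def by (rule infsum_cong_neutral) (use assms in auto)

context plumbing_tree
begin

section \<open>The coefficients of \<open>Z\<close> and their support\<close>

abbreviation factor :: "'v \<Rightarrow> real fps" where
  "factor u \<equiv> (1 - fps_X) powi (int (valency G u) - 2)"

text \<open>The \<open>E_star\<close> vectors form a basis, so the defining sum has at most one
  term.\<close>

lemma Z_coeff_eq:
  assumes "\<And>u. co l u \<in> \<int>"
  shows "Z_coeff G l = (\<Prod>u\<in>UNIV. int_coeff (factor u) \<lfloor>co l u\<rfloor>)"
proof -
  have iff: "(\<Sum>v\<in>UNIV. real (x v) *\<^sub>R E_star G v) = l \<longleftrightarrow> (\<forall>u. real (x u) = co l u)" for x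
    using star_coord_full[of "\<lambda>v. real (x v)"] star_coord_inject by metis
  show ?thesis
  proof (cases "\<forall>u. co l u \<ge> 0")
    case True
    have "{x. \<forall>u. real (x u) = co l u} = {\<lambda>u. nat \<lfloor>co l u\<rfloor>}"
    proof -
      have "real (nat \<lfloor>co l u\<rfloor>) = co l u" for u
        using True assms[of u] by (auto elim!: Ints_cases)
      moreover have "x = (\<lambda>u. nat \<lfloor>co l u\<rfloor>)" if "\<forall>u. real (x u) = co l u" for x
        using that[rule_format, symmetric] by (simp add: fun_eq_iff)
      ultimately show ?thesis by auto
    qed
    with True show ?thesis by (simp add: Z_coeff_def iff int_coeff_def not_less[symmetric])
  next
    case False
    then obtain u where u: "co l u < 0" by (auto simp: not_le)
    then have "{x. \<forall>u. real (x u) = co l u} = {}"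
      by (smt (verit) empty_Collect_eq of_nat_0_le_iff)
    moreover have "int_coeff (factor u) \<lfloor>co l u\<rfloor> = 0" using u by (simp add: int_coeff_def)
    then have "(\<Prod>u\<in>UNIV. int_coeff (factor u) \<lfloor>co l u\<rfloor>) = 0" by (auto intro: prod_zero)
    ultimately show ?thesis unfolding Z_coeff_def iff by (simp only: sum.empty)
  qed
qed

lemma Z_coeff_support:
  assumes "Z_coeff G l \<noteq> 0"
  shows "co l u \<in> \<nat>"
proof -
  obtain x :: "'v \<Rightarrow> nat" where "(\<Sum>v\<in>UNIV. real (x v) *\<^sub>R E_star G v) = l"
    using assms unfolding Z_coeff_def by (metis (mono_tags, lifting) empty_Collect_eq sum.empty)
  then have "co l u = real (x u)"
    using star_coord_full[of "\<lambda>v. real (x v)" u] by simp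
  then show ?thesis by simp
qed

lemma Z_coeff_support_nonneg: "Z_coeff G l \<noteq> 0 \<Longrightarrow> co l u \<ge> 0"
  using Z_coeff_support[of l u] by (auto simp: Nats_def)

text \<open>All coordinates of every \<open>E_star\<close> vector are positive, so a bound on a
  single coordinate bounds every multiplicity.\<close>

lemma finite_bounded_coordinate: "finite {m. (\<forall>u. co m u \<in> \<nat>) \<and> m $ v \<le> c}"
proof (rule finite_imageD)
  define B where "B u = nat \<lfloor>c / E_star G u $ v\<rfloor>" for u
  have "nat \<lfloor>co m u\<rfloor> \<le> B u" if m: "\<forall>u. co m u \<in> \<nat>" "m $ v \<le> c" for m u
  proof -
    have nonneg: "co m w \<ge> 0" for w using m(1) by (auto simp: Nats_def dest!: spec[of _ w])
    have "co m u * E_star G u $ v \<le> (\<Sum>w\<in>UNIV. co m w * E_star G w $ v)"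
      by (rule member_le_sum) (auto intro!: mult_nonneg_nonneg nonneg less_imp_le[OF E_star_pos])
    also have "\<dots> = m $ v"
      by (subst E_star_expansion[of m]) simp
    finally have "co m u \<le> c / E_star G u $ v"
      using m(2) E_star_pos[of u v] by (simp add: pos_le_divide_eq)
    then show ?thesis unfolding B_def by (intro nat_mono floor_mono)
  qed
  then have "(\<lambda>m u. nat \<lfloor>co m u\<rfloor>) ` {m. (\<forall>u. co m u \<in> \<nat>) \<and> m $ v \<le> c} \<subseteq> (\<Pi>\<^sub>E u\<in>UNIV. {..B u})"
    by auto
  then show "finite ((\<lambda>m u. nat \<lfloor>co m u\<rfloor>) ` {m. (\<forall>u. co m u \<in> \<nat>) \<and> m $ v \<le> c})"
    by (rule finite_subset) (intro finite_PiE; simp)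
  show "inj_on (\<lambda>m u. nat \<lfloor>co m u\<rfloor>) {m. (\<forall>u. co m u \<in> \<nat>) \<and> m $ v \<le> c}"
  proof (rule inj_onI)
    fix m m' assume mm: "m \<in> {m. (\<forall>u. co m u \<in> \<nat>) \<and> m $ v \<le> c}"
      "m' \<in> {m. (\<forall>u. co m u \<in> \<nat>) \<and> m $ v \<le> c}"
      and eq: "(\<lambda>u. nat \<lfloor>co m u\<rfloor>) = (\<lambda>u. nat \<lfloor>co m' u\<rfloor>)"
    show "m = m'"
    proof (rule star_coord_inject)
      fix u
      have "co m u \<in> \<nat>" "co m' u \<in> \<nat>" using mm by auto
      then show "co m u = co m' u" using fun_cong[OF eq, of u] by (auto elim!: Nats_cases)
    qed
  qed
qed

lemma finite_not_above: "finite {m. Z_coeff G m \<noteq> 0 \<and> \<not> l \<le> m}"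
proof (rule finite_subset)
  show "{m. Z_coeff G m \<noteq> 0 \<and> \<not> l \<le> m} \<subseteq> (\<Union>v. {m. (\<forall>u. co m u \<in> \<nat>) \<and> m $ v \<le> l $ v})"
    by (auto simp: less_eq_vec_def not_le intro: less_imp_le Z_coeff_support)
  show "finite (\<Union>v. {m. (\<forall>u. co m u \<in> \<nat>) \<and> m $ v \<le> l $ v})"
    by (simp add: finite_bounded_coordinate)
qed

section \<open>Cosets of the lattice\<close>

lemma L_int_subset_L_dual: "L_int \<subseteq> L_dual G"
proof
  fix x :: "real ^ 'v" assume x: "x \<in> L_int"
  then have "co x u \<in> \<int>" for u
    by (auto simp: star_coord_eq L_int_def intro!: Ints_diff Ints_mult Ints_sum)
  then show "x \<in> L_dual G" using x Ints_subset_Rats by (auto simp: L_dual_iff L_int_def)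
qed

lemma L_dual_add: "x \<in> L_dual G \<Longrightarrow> y \<in> L_dual G \<Longrightarrow> x + y \<in> L_dual G"
  by (auto simp: L_dual_iff intro: Rats_add)

lemma cls_eq_iff:
  assumes "r \<in> L_dual G"
  shows "cls G m = cls G r \<longleftrightarrow> m - r \<in> L_int"
proof
  assume "cls G m = cls G r"
  moreover have "r \<in> cls G r" using assms by (auto simp: cls_def congruence_def L_int_def)
  ultimately show "m - r \<in> L_int" by (auto simp: cls_def congruence_def)
next
  assume m: "m - r \<in> L_int"
  then have "m \<in> L_dual G"
    using L_dual_add[OF _ assms, of "m - r"] L_int_subset_L_dual by auto
  moreover have "m - x \<in> L_int \<longleftrightarrow> r - x \<in> L_int" for x
    using L_int_diff[OF _ m, of "m - x"] L_int_add[OF m, of "r - x"] by auto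
  ultimately show "cls G m = cls G r"
    using assms by (auto simp: cls_def congruence_def)
qed

lemma H_classes_cases:
  assumes "h \<in> H_classes G"
  obtains r where "r \<in> L_dual G" "h = cls G r"
  using assms unfolding H_classes_def cls_def by (elim quotientE) blast

end

locale plumbing_tree_class = plumbing_tree G for G :: "'v::finite plumbing_graph" +
  fixes h :: "(real ^ 'v) set" and r :: "real ^ 'v"
  assumes r: "r \<in> L_dual G" and h: "h = cls G r"
begin

abbreviation Q :: "real ^ 'v \<Rightarrow> real" where "Q \<equiv> counting_function (Z_h G h)"

text \<open>The least element of the coset \<open>r + L\<close> above \<open>x\<close>. Within the
  coset \<open>x\<close> and \<open>up x\<close> have the same upper bounds, so \<open>Q\<close>
  takes the same value at both.\<close>

definition up :: "real ^ 'v \<Rightarrow> real ^ 'v" where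
  "up x = (\<chi> u. r $ u + of_int \<lceil>x $ u - r $ u\<rceil>)"

lemma Z_h_eq: "Z_h G h m = (if m - r \<in> L_int then Z_coeff G m else 0)"
  by (simp add: Z_h_def h cls_eq_iff[OF r])

lemma Z_h_nonzero: "Z_h G h m \<noteq> 0 \<Longrightarrow> m - r \<in> L_int \<and> Z_coeff G m \<noteq> 0"
  by (simp add: Z_h_eq split: if_splits)

lemma co_coset_Ints: "m - r \<in> L_int \<Longrightarrow> co m u \<in> \<int>"
  using L_dual_add[OF subsetD[OF L_int_subset_L_dual] r, of "m - r"] by (simp add: L_dual_iff)

lemma Z_h_summable: "Z_h G h summable_on {m. P m \<and> \<not> l \<le> m}"
  by (rule finite_nonzero_values_imp_summable_on, rule finite_subset[OF _ finite_not_above[of l]])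
    (use Z_h_nonzero in blast)

lemma up_coset: "up x - r \<in> L_int"
  by (simp add: up_def L_int_def)

lemma le_up: "x \<le> up x"
proof -
  have "x $ u \<le> r $ u + of_int \<lceil>x $ u - r $ u\<rceil>" for u
    by linarith
  then show ?thesis by (simp add: less_eq_vec_def up_def)
qed

lemma up_le_iff:
  assumes "m - r \<in> L_int"
  shows "up x \<le> m \<longleftrightarrow> x \<le> m"
proof -
  have "r $ u + of_int \<lceil>x $ u - r $ u\<rceil> \<le> m $ u \<longleftrightarrow> x $ u \<le> m $ u" for u
  proof -
    obtain k where "m $ u - r $ u = of_int k" using assms by (auto simp: L_int_def elim!: Ints_cases)
    then have k: "m $ u = of_int k + r $ u" by simp
    show ?thesis unfolding k by (simp add: algebra_simps ceiling_le_iff)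
  qed
  then show ?thesis by (simp add: less_eq_vec_def up_def)
qed

lemma Q_up: "Q (up x) = Q x"
  by (rule counting_function_cong) (metis Z_h_nonzero up_le_iff)

text \<open>The increment is the sum of the coefficients at the coset points above \<open>w\<close>
  but not above w + E_v, that is at w + y with natural entries of y and y_v = 0. This is the sum
  over the tree rooted at \<open>v\<close>.\<close>

lemma Q_step:
  assumes w: "w - r \<in> L_int" and xw: "\<And>u. x $ u \<le> w $ u" "\<And>u. w $ u \<le> x $ u + 1" "x $ v = w $ v"
    and deep: "\<And>u. co x u > real (valency G u) - 2"
  shows "Q (w + E_base v) = Q w + (1 + co w v)"
proof -
  obtain d :: "'v \<Rightarrow> nat" where d: "d v = 0"
    "\<And>u. u \<noteq> v \<Longrightarrow> \<exists>p. adjacent G u p \<and> d p < d u \<and> (\<forall>q. adjacent G u q \<and> q \<noteq> p \<longrightarrow> d u < d q)"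
    using tree_depth[OF tree] by blast
  \<comment> \<open>The vector with product -1 with every E_u; its coordinates are positive.\<close>
  define \<eta> where "\<eta> = (\<Sum>u\<in>UNIV. E_star G u)"
  define a where "a u = \<lfloor>co w u\<rfloor>" for u
  have a: "of_int (a u) = co w u" for u
    using co_coset_Ints[OF w, of u] by (auto simp: a_def elim!: Ints_cases)
  have \<eta>: "\<eta> $ u > 0" "co \<eta> u = 1" for u
    using E_star_pos by (auto simp: \<eta>_def star_coord_sum E_star intro!: sum_pos)
  have diff: "co w u - co x u = - of_int (decoration G u) * (w $ u - x $ u) - (\<Sum>i\<in>nbrs u. w $ i - x $ i)" for u
    by (simp add: star_coord_eq sum_subtractf algebra_simps)
  interpret rooted_tree_sum "adjacent G" v d "\<lambda>u. - decoration G u" a "\<lambda>u. \<eta> $ u" "\<lambda>u. w $ u - x $ u"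
  proof unfold_locales
    fix u
    show "(\<Sum>i\<in>nbrs u. \<eta> $ i) \<le> of_int (- decoration G u) * \<eta> $ u"
      using \<eta>(2)[of u] by (simp add: star_coord_eq)
    show "of_int (- decoration G u) * (w $ u - x $ u) - (\<Sum>i\<in>nbrs u. w $ i - x $ i)
        + real (card (nbrs u)) - 2 < of_int (a u)"
      using deep[of u] diff[of u] a[of u] by (simp add: valency_def)
  next
    \<comment> \<open>At the root only the gaps of the neighbours enter, each at most 1, so -(w,
      E_v) > -2, and integrality gives -1.\<close>
    have "(\<Sum>i\<in>nbrs v. w $ i - x $ i) \<le> (\<Sum>i\<in>nbrs v. 1)"
      using xw(2) by (intro sum_mono) (simp add: algebra_simps)
    then have "co w v > - 2" using deep[of v] diff[of v] xw(3) by (simp add: valency_def)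
    then have "of_int (a v) > (of_int (- 2) :: real)" using a[of v] by simp
    then have "a v > - 2" by (simp only: of_int_less_iff)
    then show "- 1 \<le> a v" by simp
  qed (use xw d \<eta> adjacent_commute in \<open>auto simp: algebra_simps\<close>)
  define \<Phi> where "\<Phi> u (s :: nat) = factor u" for u s
  define shift where "shift y = w + (\<chi> u. real (y u))" for y :: "'v \<Rightarrow> nat"
  have co_shift: "co (shift y) u = of_int (charge UNIV y u)" for y u
  proof -
    have "co (shift y) u = co w u + co (\<chi> u. real (y u)) u" by (simp add: shift_def)
    then show ?thesis
      by (simp add: charge_def a[symmetric] star_coord_eq[of "\<chi> u. real (y u)"] nb_def)
  qed
  have weight: "weight UNIV \<Phi> y = Z_coeff G (shift y)" for y
    by (subst Z_coeff_eq) (simp_all add: co_shift weight_def \<Phi>_def)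
  have coset: "shift y - r \<in> L_int" for y
    using L_int_add[OF w, of "\<chi> u. real (y u)"] by (simp add: shift_def L_int_def algebra_simps)
  have inj: "inj_on shift (confs UNIV)"
    by (auto simp: inj_on_def shift_def vec_eq_iff fun_eq_iff)
  \<comment> \<open>All these exponents share the coordinate of \<open>w\<close> at
    \<open>v\<close>, so only finitely many of them are in the support.\<close>
  have "finite {y \<in> confs UNIV. weight UNIV \<Phi> y \<noteq> 0}"
  proof (rule finite_imageD)
    have "shift ` {y \<in> confs UNIV. weight UNIV \<Phi> y \<noteq> 0} \<subseteq> {m. (\<forall>u. co m u \<in> \<nat>) \<and> m $ v \<le> w $ v}"
    proof
      fix m assume "m \<in> shift ` {y \<in> confs UNIV. weight UNIV \<Phi> y \<noteq> 0}"
      then obtain y where "m = shift y" "y v = 0" "Z_coeff G m \<noteq> 0" by (auto simp: weight confs_def)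
      then show "m \<in> {m. (\<forall>u. co m u \<in> \<nat>) \<and> m $ v \<le> w $ v}"
        using Z_coeff_support[of m] by (auto simp: shift_def)
    qed
    then show "finite (shift ` {y \<in> confs UNIV. weight UNIV \<Phi> y \<noteq> 0})"
      by (rule finite_subset) (rule finite_bounded_coordinate)
    show "inj_on shift {y \<in> confs UNIV. weight UNIV \<Phi> y \<noteq> 0}"
      using inj by (rule inj_on_subset) auto
  qed
  moreover have "admissible UNIV \<Phi>"
    unfolding admissible_def
  proof (intro ballI allI)
    fix u s
    have "\<Phi> u s = fps_of_poly 1 * (1 - fps_X) powi (int (card (nb UNIV u)) - 2)"
      by (simp add: \<Phi>_def nb_def valency_def)
    then show "\<exists>g. \<Phi> u s = fps_of_poly g * (1 - fps_X) powi (int (card (nb UNIV u)) - 2) \<and>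
        poly g 1 = 1 \<and> degree g \<le> (\<Sum>w | adjacent G u w \<and> w \<notin> UNIV. threshold u w s)"
      by (rule_tac exI[of _ 1]) simp
  qed
  ultimately have sum: "infsum (weight UNIV \<Phi>) (confs UNIV) = of_int (a v + 1)"
    by (rule infsum_weight[OF UNIV_I UNIV_I, rotated])
  define D where "D = {m. w \<le> m \<and> \<not> w + E_base v \<le> m}"
  have split: "{m. \<not> w + E_base v \<le> m} = {m. \<not> w \<le> m} \<union> D"
  proof -
    have "w \<le> m" if "w + E_base v \<le> m" for m
    proof -
      have "w $ u \<le> w $ u + E_base v $ u" for u by (simp add: axis_def)
      with that show ?thesis unfolding less_eq_vec_def vector_add_component by (meson order.trans)
    qed
    then show ?thesis by (auto simp: D_def)
  qed
  have "infsum (Z_h G h) D = infsum (Z_h G h) (shift ` confs UNIV)"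
  proof (rule infsum_cong_neutral)
    fix m assume m: "m \<in> D - shift ` confs UNIV"
    show "Z_h G h m = 0"
    proof (rule ccontr)
      assume "Z_h G h m \<noteq> 0"
      then have "m - w \<in> L_int" using L_int_diff[OF _ w, of "m - r"] Z_h_nonzero by simp
      moreover have le: "w $ u \<le> m $ u" for u using m by (auto simp: D_def less_eq_vec_def)
      ultimately have "\<exists>n. m $ u = w $ u + real n" for u
      proof -
        have "m $ u - w $ u \<in> \<int>" using \<open>m - w \<in> L_int\<close> by (simp add: L_int_def)
        then obtain k where k: "m $ u - w $ u = of_int k" by (auto elim: Ints_cases)
        then have "k \<ge> 0" using le[of u] by (metis diff_ge_0_iff_ge of_int_0_le_iff)
        then show ?thesis using k by (intro exI[of _ "nat k"]) simp
      qed
      then obtain y where y: "\<And>u. m $ u = w $ u + real (y u)" by metis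
      have "y v = 0"
      proof (rule ccontr)
        assume "y v \<noteq> 0"
        then have "w + E_base v \<le> m" using y by (auto simp: less_eq_vec_def axis_def)
        with m show False by (simp add: D_def)
      qed
      then have "m \<in> shift ` confs UNIV"
        using y by (intro image_eqI[of _ _ y]) (auto simp: shift_def vec_eq_iff confs_def)
      with m show False by simp
    qed
  next
    fix m assume m: "m \<in> shift ` confs UNIV - D"
    then obtain y where y: "m = shift y" "y v = 0" by (auto simp: confs_def)
    have "w \<le> m" by (simp add: y shift_def less_eq_vec_def)
    moreover have "\<not> w + E_base v \<le> m"
      using y by (auto simp: shift_def less_eq_vec_def axis_def dest: spec[of _ v])
    ultimately have "m \<in> D" by (simp add: D_def)
    with m show "Z_h G h m = 0" by simp
  qed auto
  also have "\<dots> = infsum (weight UNIV \<Phi>) (confs UNIV)"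
    by (subst infsum_reindex[OF inj]) (auto intro!: infsum_cong simp: weight Z_h_eq coset)
  also have "\<dots> = 1 + co w v" using sum a[of v] by simp
  finally have "infsum (Z_h G h) D = 1 + co w v" .
  moreover have "Q (w + E_base v) = Q w + infsum (Z_h G h) D"
    unfolding counting_function_def split
    using Z_h_summable[of "\<lambda>_. True" w] Z_h_summable[of "\<lambda>m. w \<le> m" "w + E_base v"]
    by (intro infsum_Un_disjoint) (auto simp: D_def)
  ultimately show ?thesis by simp
qed

end

section \<open>The counting function at deep points\<close>

context plumbing_tree_class
begin

definition deep :: "(real ^ 'v) set" where
  "deep = {x. \<forall>u. co x u > real (valency G u) - 2}"

text \<open>The Riemann-Roch function -(w, w + K) / 2, where the canonical class K has (K, E_v) =
  -b_v - 2 by adjunction in genus 0. Its increments are those of \<open>Q\<close>.\<close>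

definition quad :: "real ^ 'v \<Rightarrow> real" where
  "quad w = (\<Sum>v\<in>UNIV. (1 + of_int (decoration G v) / 2) * w $ v) - form G w w / 2"

lemma quad_step: "quad (w + E_base v) = quad w + (1 + co w v)"
proof -
  have "form G (w + E_base v) (w + E_base v)
      = form G w w + 2 * form G w (E_base v) + form G (E_base v) (E_base v)"
    by (simp add: form_add_left form_add_right form_commute[of "E_base v" w])
  moreover have "form G w (E_base v) = - co w v" "form G (E_base v) (E_base v) = of_int (decoration G v)"
    using co_E_base[of v v] by (simp_all add: star_coord_def)
  moreover have "(\<Sum>u\<in>UNIV. (1 + of_int (decoration G u) / 2) * (w + E_base v) $ u)
      = (\<Sum>u\<in>UNIV. (1 + of_int (decoration G u) / 2) * w $ u) + (1 + of_int (decoration G v) / 2 :: real)"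
  proof -
    have "(\<Sum>u\<in>UNIV. (1 + of_int (decoration G u) / 2) * E_base v $ u) = (1 + of_int (decoration G v) / 2 :: real)"
      by (simp add: axis_def if_distrib sum.delta cong: if_cong)
    then show ?thesis by (simp add: distrib_left[of _ "w $ _"] sum.distrib)
  qed
  ultimately show ?thesis by (simp add: quad_def field_simps)
qed

lemma deep_convex: "x \<in> deep \<Longrightarrow> y \<in> deep \<Longrightarrow> 0 \<le> t \<Longrightarrow> t \<le> 1 \<Longrightarrow> x + t *\<^sub>R (y - x) \<in> deep"
proof -
  assume xy: "x \<in> deep" "y \<in> deep" and t: "0 \<le> t" "t \<le> 1"
  have "co x u + t * (co y u - co x u) > real (valency G u) - 2" for u
  proof -
    have "co x u > real (valency G u) - 2" "co y u > real (valency G u) - 2"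
      using xy by (auto simp: deep_def)
    moreover have "co x u + t * (co y u - co x u) = (1 - t) * co x u + t * co y u"
      by (simp add: algebra_simps)
    moreover have "(1 - t) * min (co x u) (co y u) + t * min (co x u) (co y u) \<le> (1 - t) * co x u + t * co y u"
      using t by (intro add_mono mult_left_mono) auto
    ultimately show ?thesis by (simp add: algebra_simps min_def split: if_splits)
  qed
  then show ?thesis by (simp add: deep_def)
qed

lemma coset_le_step:
  assumes "w - r \<in> L_int" "m - r \<in> L_int" "w \<le> m" "w $ v < m $ v"
  shows "w + E_base v \<le> m"
proof -
  have "m $ v - w $ v \<in> \<int>" using L_int_diff[OF assms(2,1)] by (simp add: L_int_def)
  then obtain k :: int where k: "m $ v - w $ v = of_int k" by (auto elim: Ints_cases)
  then have "k > 0" using assms(4) by (metis diff_gt_0_iff_gt of_int_0_less_iff)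
  then have "of_int k \<ge> (1 :: real)" by simp
  then have "w $ v + 1 \<le> m $ v" using k by simp
  then show ?thesis using assms(3) by (auto simp: less_eq_vec_def axis_def)
qed

text \<open>As the real point moves up the segment from \<open>x\<close> to \<open>x'\<close>, the coset point above it is
  raised one coordinate at a time, always in a coordinate that the moving point has just reached.\<close>

lemma Q_minus_quad_path:
  assumes deep: "x \<in> deep" "x' \<in> deep" and le: "x \<le> x'"
    and "w - r \<in> L_int" "0 \<le> t" "t \<le> 1" "w \<le> up x'"
    and "\<And>u. x $ u + t * (x' $ u - x $ u) \<le> w $ u" "\<And>u. w $ u \<le> x $ u + t * (x' $ u - x $ u) + 1"
  shows "Q w - quad w = Q (up x') - quad (up x')"
  using assms(4-)
proof (induction "nat \<lfloor>\<Sum>u\<in>UNIV. up x' $ u - w $ u\<rfloor>" arbitrary: w t rule: less_induct)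
  case less
  note w = less.prems
  have le': "x $ u \<le> x' $ u" for u using le by (simp add: less_eq_vec_def)
  show ?case
  proof (cases "x' \<le> w")
    case True
    then have "w = up x'" using w(1,4) up_le_iff[of w x'] by (simp add: antisym)
    then show ?thesis by simp
  next
    case False
    then obtain u\<^sub>0 where u0: "w $ u\<^sub>0 < x' $ u\<^sub>0" by (auto simp: less_eq_vec_def not_le)
    define A where "A = {u. x $ u < x' $ u}"
    \<comment> \<open>The parameter at which the moving point reaches \<open>w\<close> in the
      coordinate \<open>u\<close>; a coordinate reached first is raised.\<close>
    define f where "f u = (w $ u - x $ u) / (x' $ u - x $ u)" for u
    have xw: "x $ u \<le> w $ u" for u
      using w(5)[of u] mult_nonneg_nonneg[OF w(2), of "x' $ u - x $ u"] le'[of u] by linarith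
    have u0A: "u\<^sub>0 \<in> A" using u0 xw[of u\<^sub>0] by (auto simp: A_def)
    have "Min (f ` A) \<in> f ` A" using u0A by (intro Min_in) auto
    then obtain v where v: "v \<in> A" "f v = Min (f ` A)" by force
    then have fmin: "f v \<le> f u" if "u \<in> A" for u using that by simp
    define T where "T = f v"
    have "f u\<^sub>0 < 1" using u0 u0A by (simp add: f_def A_def)
    then have T1: "T < 1" using fmin[OF u0A] by (simp add: T_def)
    have tT: "t \<le> T" using w(5)[of v] v(1) by (simp add: T_def f_def A_def le_divide_eq)
    define y where "y = x + T *\<^sub>R (x' - x)"
    have y: "y $ u = x $ u + T * (x' $ u - x $ u)" for u by (simp add: y_def)
    have yw: "y $ u \<le> w $ u" for u
    proof (cases "u \<in> A")
      case True
      then have "T \<le> f u" using fmin T_def by simp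
      then have "T * (x' $ u - x $ u) \<le> w $ u - x $ u"
        using True by (simp add: f_def A_def le_divide_eq)
      then show ?thesis by (simp add: y)
    next
      case False
      then have "x' $ u = x $ u" using le'[of u] by (simp add: A_def)
      then show ?thesis using xw by (simp add: y)
    qed
    \<comment> \<open>The moving point only rises, so the gap stays at most 1; in the coordinate
      about to be raised it is 0 and becomes exactly 1.\<close>
    have wy: "w $ u \<le> y $ u + 1" for u
      using w(6)[of u] mult_right_mono[OF tT, of "x' $ u - x $ u"] le'[of u] by (simp add: y)
    have yv: "y $ v = w $ v" using v(1) by (simp add: y T_def f_def A_def)
    have "y \<in> deep" unfolding y_def using deep tT T1 w(2) by (intro deep_convex) auto
    then have step: "Q (w + E_base v) = Q w + (1 + co w v)"
      using Q_step[OF w(1) yw wy yv] by (simp add: deep_def)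
    let ?w = "w + E_base v"
    have "T * (x' $ v - x $ v) < 1 * (x' $ v - x $ v)"
      using T1 v(1) by (intro mult_strict_right_mono) (auto simp: A_def)
    then have "w $ v < x' $ v" by (simp add: yv[symmetric] y)
    also have "x' $ v \<le> up x' $ v" using le_up[of x'] by (simp add: less_eq_vec_def)
    finally have le_up': "?w \<le> up x'" using coset_le_step[OF w(1) up_coset w(4)] by blast
    have coset: "?w - r \<in> L_int"
      using L_int_add[OF w(1), of "E_base v"] by (simp add: L_int_def axis_def algebra_simps)
    \<comment> \<open>A raise lowers the total distance to \<open>up x'\<close> by exactly 1, which
      is the measure of the induction.\<close>
    have "(\<Sum>u\<in>UNIV. up x' $ u - w $ u) = (\<Sum>u\<in>UNIV. up x' $ u - ?w $ u) + 1"
      by (simp add: sum_subtractf sum.distrib axis_def)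
    moreover have "(\<Sum>u\<in>UNIV. up x' $ u - ?w $ u) \<ge> 0"
      using le_up' unfolding less_eq_vec_def by (intro sum_nonneg) (simp add: algebra_simps)
    ultimately have "nat \<lfloor>\<Sum>u\<in>UNIV. up x' $ u - ?w $ u\<rfloor> < nat \<lfloor>\<Sum>u\<in>UNIV. up x' $ u - w $ u\<rfloor>"
      by linarith
    then have "Q ?w - quad ?w = Q (up x') - quad (up x')"
    proof (rule less.hyps[OF _ coset _ _ le_up', of T])
      show "0 \<le> T" "T \<le> 1" using tT w(2) T1 by auto
      show "x $ u + T * (x' $ u - x $ u) \<le> ?w $ u" for u
        using yw[of u] by (auto simp: y axis_def)
      show "?w $ u \<le> x $ u + T * (x' $ u - x $ u) + 1" for u
        using wy[of u] yv by (simp add: y axis_def)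
    qed
    then show ?thesis by (simp add: step quad_step)
  qed
qed

lemma up_le_add_1: "up x $ u \<le> x $ u + 1"
  unfolding up_def vec_lambda_beta by linarith

lemma up_mono: "x \<le> x' \<Longrightarrow> up x \<le> up x'"
  using up_le_iff[OF up_coset] le_up order.trans by blast

lemma Q_minus_quad_mono:
  assumes "x \<in> deep" "x' \<in> deep" "x \<le> x'"
  shows "Q (up x) - quad (up x) = Q (up x') - quad (up x')"
  using le_up[of x] up_mono[OF assms(3)] up_le_add_1[of x]
  by (intro Q_minus_quad_path[OF assms up_coset, of 0]) (auto simp: less_eq_vec_def)

text \<open>Rising segments compare only ordered points. Any two deep points lie below a common deep
  one, reached by adding a large multiple of a positive vector with all star coordinates 1.\<close>

theorem Q_eq_quad: "\<exists>c. \<forall>x\<in>deep. Q x = c + quad (up x)"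
proof -
  have "Q (up x) - quad (up x) = Q (up x') - quad (up x')" if "x \<in> deep" "x' \<in> deep" for x x'
  proof -
    define \<eta> where "\<eta> = (\<Sum>u\<in>UNIV. E_star G u)"
    have \<eta>: "\<eta> $ u > 0" "co \<eta> u = 1" for u
      using E_star_pos by (auto simp: \<eta>_def star_coord_sum E_star intro!: sum_pos)
    define t where "t = (\<Sum>u\<in>UNIV. \<bar>x' $ u - x $ u\<bar> / \<eta> $ u)"
    have "t \<ge> 0" using \<eta>(1) by (auto simp: t_def intro!: sum_nonneg divide_nonneg_pos)
    have "\<bar>x' $ u - x $ u\<bar> / \<eta> $ u \<le> t" for u
      unfolding t_def using \<eta>(1) by (intro member_le_sum) (auto intro: divide_nonneg_pos)
    then have "\<bar>x' $ u - x $ u\<bar> \<le> t * \<eta> $ u" for u using \<eta>(1)[of u] by (simp add: divide_le_eq)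
    then have le: "x \<le> x + t *\<^sub>R \<eta>" "x' \<le> x + t *\<^sub>R \<eta>"
      by (auto simp: less_eq_vec_def abs_le_iff algebra_simps) (smt (verit))+
    have "co x u + t > real (valency G u) - 2" for u
      using that \<open>t \<ge> 0\<close> by (auto simp: deep_def add_strict_increasing2 add_pos_nonneg dest!: spec[of _ u])
    then have "x + t *\<^sub>R \<eta> \<in> deep" by (simp add: deep_def \<eta>(2))
    then show ?thesis using Q_minus_quad_mono that le by metis
  qed
  then have "\<exists>c. \<forall>x\<in>deep. Q (up x) - quad (up x) = c" by blast
  then show ?thesis by (auto simp: Q_up algebra_simps)
qed

end

section \<open>Convex cones and linear programming\<close>

lemma convex_cone_hull_sumI:
  assumes "\<And>i. i \<in> I \<Longrightarrow> 0 \<le> c i" "\<And>i. i \<in> I \<Longrightarrow> v i \<in> convex_cone hull M"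
  shows "(\<Sum>i\<in>I. c i *\<^sub>R v i) \<in> convex_cone hull M"
  using assms
proof (induction I rule: infinite_finite_induct)
  case (insert i I)
  then have "c i *\<^sub>R v i + (\<Sum>i\<in>I. c i *\<^sub>R v i) \<in> convex_cone hull M"
    by (intro convex_cone_hull_add convex_cone_hull_mul) auto
  with insert.hyps show ?case by simp
qed (simp_all add: convex_cone_hull_contains_0)

lemma convex_cone_hull_finite:
  assumes "finite B"
  shows "convex_cone hull B = {x. \<exists>c. (\<forall>b\<in>B. 0 \<le> c b) \<and> x = (\<Sum>b\<in>B. c b *\<^sub>R b)}" (is "_ = ?R")
proof
  show "convex_cone hull B \<subseteq> ?R"
  proof (rule hull_minimal)
    show "B \<subseteq> ?R"
    proof
      fix b assume "b \<in> B"
      then have "b = (\<Sum>b'\<in>B. (if b' = b then 1 else 0) *\<^sub>R b')"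
        using assms by (simp add: if_distrib[of "\<lambda>t. t *\<^sub>R _"] sum.delta cong: if_cong)
      then show "b \<in> ?R" by (intro CollectI exI[of _ "\<lambda>b'. if b' = b then 1 else 0"]) auto
    qed
    show "convex_cone ?R"
      unfolding convex_cone_iff
    proof (intro conjI ballI allI impI)
      show "0 \<in> ?R" by (intro CollectI exI[of _ "\<lambda>_. 0"]) auto
    next
      fix x y assume "x \<in> ?R" "y \<in> ?R"
      then obtain c d where "\<forall>b\<in>B. 0 \<le> c b" "x = (\<Sum>b\<in>B. c b *\<^sub>R b)"
        "\<forall>b\<in>B. 0 \<le> d b" "y = (\<Sum>b\<in>B. d b *\<^sub>R b)" by blast
      then show "x + y \<in> ?R"
        by (intro CollectI exI[of _ "\<lambda>b. c b + d b"]) (auto simp: scaleR_add_left sum.distrib)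
    next
      fix x and t :: real assume "x \<in> ?R" "0 \<le> t"
      then obtain c where "\<forall>b\<in>B. 0 \<le> c b" "x = (\<Sum>b\<in>B. c b *\<^sub>R b)" by blast
      with \<open>0 \<le> t\<close> show "t *\<^sub>R x \<in> ?R"
        by (intro CollectI exI[of _ "\<lambda>b. t * c b"]) (auto simp: scaleR_sum_right)
    qed
  qed
  show "?R \<subseteq> convex_cone hull B"
  proof clarify
    fix c assume "\<forall>b\<in>B. 0 \<le> (c b :: real)"
    then show "(\<Sum>b\<in>B. c b *\<^sub>R b) \<in> convex_cone hull B"
      by (intro convex_cone_hull_sumI) (auto intro: hull_inc)
  qed
qed

text \<open>In a subset of least cardinality whose cone contains \<open>x\<close>, a linear relation
  could be subtracted until a first coefficient vanishes.\<close>

lemma convex_cone_hull_caratheodory: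
  assumes "finite M" "x \<in> convex_cone hull M"
  obtains B where "B \<subseteq> M" "independent B" "x \<in> convex_cone hull B"
proof -
  define P where "P n \<longleftrightarrow> (\<exists>B\<subseteq>M. card B = n \<and> x \<in> convex_cone hull B)" for n
  have "P (card M)" using assms(2) by (auto simp: P_def)
  then have "P (LEAST n. P n)" by (rule LeastI)
  then obtain B where B: "B \<subseteq> M" "card B = (LEAST n. P n)" "x \<in> convex_cone hull B"
    by (auto simp: P_def)
  have finB: "finite B" using B(1) assms(1) finite_subset by blast
  have "independent B"
  proof (rule ccontr)
    assume "\<not> independent B"
    \<comment> \<open>The relation may be negated, so some coefficient is positive and the minimum
      of ratios below is over a nonempty set.\<close>
    then obtain d b where d: "(\<Sum>b\<in>B. d b *\<^sub>R b) = 0" "b \<in> B" "d b > 0"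
    proof -
      assume dep: "\<not> independent B"
        and *: "\<And>d b. (\<Sum>b\<in>B. d b *\<^sub>R b) = 0 \<Longrightarrow> b \<in> B \<Longrightarrow> d b > 0 \<Longrightarrow> thesis"
      obtain d b where d: "(\<Sum>b\<in>B. d b *\<^sub>R b) = 0" "b \<in> B" "d b \<noteq> 0"
        using dep finB by (auto simp: dependent_finite)
      show thesis
      proof (cases "d b > 0")
        case True with d * show ?thesis by blast
      next
        case False
        then show ?thesis using d *[of "\<lambda>b. - d b" b] by (simp add: sum_negf)
      qed
    qed
    obtain c where c: "\<forall>b\<in>B. 0 \<le> c b" "x = (\<Sum>b\<in>B. c b *\<^sub>R b)"
      using B(3) convex_cone_hull_finite[OF finB] by auto
    define A where "A = {b \<in> B. d b > 0}"
    have "Min ((\<lambda>b. c b / d b) ` A) \<in> (\<lambda>b. c b / d b) ` A"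
      using d finB by (intro Min_in) (auto simp: A_def)
    then obtain b0 where b0: "b0 \<in> A" "c b0 / d b0 = Min ((\<lambda>b. c b / d b) ` A)" by force
    define t where "t = c b0 / d b0"
    have "0 \<le> c b0" "0 < d b0" using b0(1) c(1) by (auto simp: A_def)
    then have t: "t \<ge> 0" by (simp add: t_def)
    have "c b - t * d b \<ge> 0" if "b \<in> B" for b
    proof (cases "b \<in> A")
      case True
      then have "t \<le> c b / d b" using b0(2) finB by (simp add: t_def A_def)
      then show ?thesis using True by (simp add: A_def le_divide_eq)
    next
      case False
      then show ?thesis using that c(1) t mult_nonneg_nonpos[of t "d b"] by (force simp: A_def)
    qed
    moreover have "c b0 - t * d b0 = 0" using \<open>0 < d b0\<close> by (simp add: t_def)
    moreover have "x = (\<Sum>b\<in>B. (c b - t * d b) *\<^sub>R b)"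
    proof -
      have "(\<Sum>b\<in>B. (c b - t * d b) *\<^sub>R b) = x - t *\<^sub>R (\<Sum>b\<in>B. d b *\<^sub>R b)"
        unfolding c(2) by (simp add: scaleR_diff_left sum_subtractf scaleR_sum_right)
      then show ?thesis using d(1) by simp
    qed
    moreover have "b0 \<in> B" using b0 by (simp add: A_def)
    ultimately have "x = (\<Sum>b\<in>B - {b0}. (c b - t * d b) *\<^sub>R b)"
      using finB by (simp add: sum.remove[of B b0])
    then have "x \<in> convex_cone hull (B - {b0})"
      using \<open>\<And>b. b \<in> B \<Longrightarrow> c b - t * d b \<ge> 0\<close> finB
      by (auto simp: convex_cone_hull_finite intro!: exI[of _ "\<lambda>b. c b - t * d b"])
    then have "P (card (B - {b0}))" using B(1) unfolding P_def by blast
    then have "card B \<le> card (B - {b0})" unfolding B(2) by (rule Least_le)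
    then show False using \<open>b0 \<in> B\<close> finB by (metis card_Diff1_less not_le)
  qed
  with B that show thesis by blast
qed

text \<open>Farkas' lemma: a functional bounded below on a cone is nonnegative there, so a strictly
  separating hyperplane can be moved to the origin.\<close>

lemma separate_from_convex_cone_hull:
  fixes x :: "'a::euclidean_space"
  assumes "finite T" "x \<notin> convex_cone hull T"
  obtains \<alpha> where "\<alpha> \<bullet> x > 0" "\<And>m. m \<in> T \<Longrightarrow> \<alpha> \<bullet> m \<le> 0"
proof -
  obtain a b where ab: "a \<bullet> x < b" "\<And>y. y \<in> convex_cone hull T \<Longrightarrow> b < a \<bullet> y"
    using separating_hyperplane_closed_point[OF convex_convex_cone_hull closed_convex_cone_hull[OF assms(1)] assms(2)]
    by blast
  have "b < 0" using ab(2)[OF convex_cone_hull_contains_0] by simp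
  have "a \<bullet> m \<ge> 0" if "m \<in> T" for m
  proof (rule ccontr)
    assume neg: "\<not> a \<bullet> m \<ge> 0"
    \<comment> \<open>On this multiple the functional takes the value \<open>b\<close>, which it
      must exceed on the cone.\<close>
    have "(b / (a \<bullet> m)) *\<^sub>R m \<in> convex_cone hull T"
      using neg \<open>b < 0\<close> that by (intro convex_cone_hull_mul hull_inc) (auto simp: divide_nonpos_neg)
    from ab(2)[OF this] show False using neg by simp
  qed
  then show thesis using ab(1) \<open>b < 0\<close> by (intro that[of "- a"]) auto
qed

text \<open>Strong duality of linear programming: the dual feasible region is compact, because the vectors
  of \<open>M\<close> positively span the space, and a maximiser \<open>g\<close> is tight on a basis
  whose cone contains \<open>x\<close>.\<close>

lemma optimal_basis:
  fixes M :: "'a::euclidean_space set"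
  assumes finM: "finite M" and M: "convex_cone hull M = UNIV" and c: "\<And>m. m \<in> M \<Longrightarrow> c m \<ge> (0::real)"
    and generic: "\<And>B. B \<subseteq> M \<Longrightarrow> x \<in> span B \<Longrightarrow> span B = UNIV"
  obtains B g where "B \<subseteq> M" "independent B" "span B = UNIV" "x \<in> convex_cone hull B"
    "\<And>m. m \<in> M \<Longrightarrow> g \<bullet> m \<le> c m" "\<And>b. b \<in> B \<Longrightarrow> g \<bullet> b = c b"
proof -
  define D where "D = {g. \<forall>m\<in>M. g \<bullet> m \<le> c m}"
  have "\<exists>K. \<forall>g\<in>D. g \<bullet> y \<le> K" for y
  proof -
    obtain l where l: "\<forall>m\<in>M. 0 \<le> l m" "y = (\<Sum>m\<in>M. l m *\<^sub>R m)"
      using M convex_cone_hull_finite[OF finM] by blast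
    have "g \<bullet> y \<le> (\<Sum>m\<in>M. l m * c m)" if "g \<in> D" for g
      unfolding l(2) inner_sum_right inner_scaleR_right
      using that l(1) by (intro sum_mono mult_left_mono) (auto simp: D_def)
    then show ?thesis by blast
  qed
  then obtain K where K: "\<And>y g. g \<in> D \<Longrightarrow> g \<bullet> y \<le> K y" by metis
  have "norm g \<le> (\<Sum>b\<in>Basis. max (K b) (K (- b)))" if "g \<in> D" for g
  proof -
    have "\<bar>g \<bullet> b\<bar> \<le> max (K b) (K (- b))" for b
      using K[OF that, of b] K[OF that, of "- b"] by (simp add: max_def) linarith
    then show ?thesis by (intro order.trans[OF norm_le_l1] sum_mono)
  qed
  then have "bounded D" by (auto simp: bounded_iff)
  moreover have "D = (\<Inter>m\<in>M. {g. m \<bullet> g \<le> c m})" by (auto simp: D_def inner_commute)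
  then have "closed D" by (auto intro!: closed_INT closed_halfspace_le)
  ultimately have "compact D" by (simp add: compact_eq_bounded_closed)
  moreover have "D \<noteq> {}" using c by (auto simp: D_def intro!: exI[of _ 0])
  ultimately obtain g where g: "g \<in> D" "\<And>g'. g' \<in> D \<Longrightarrow> g' \<bullet> x \<le> g \<bullet> x"
    using continuous_attains_sup[of D "\<lambda>g. g \<bullet> x"] by (force intro: continuous_intros)
  define T where "T = {m \<in> M. g \<bullet> m = c m}"
  have finT: "finite T" using finM by (simp add: T_def)
  have "x \<in> convex_cone hull T"
  proof (rule ccontr)
    assume "x \<notin> convex_cone hull T"
    then obtain \<alpha> where \<alpha>: "\<alpha> \<bullet> x > 0" "\<And>m. m \<in> T \<Longrightarrow> \<alpha> \<bullet> m \<le> 0"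
      using separate_from_convex_cone_hull[OF finT] by blast
    \<comment> \<open>The slack of the constraint \<open>m\<close> relative to its change in
      direction \<open>\<alpha>\<close>; the 1 avoids division by zero. A step no longer than every
      such quotient stays feasible.\<close>
    define s where "s m = (c m - g \<bullet> m) / (1 + \<bar>\<alpha> \<bullet> m\<bar>)" for m
    define \<epsilon> where "\<epsilon> = Min (insert 1 (s ` (M - T)))"
    have pos: "0 < s m" if "m \<in> M - T" for m
      using that g(1) unfolding s_def by (intro divide_pos_pos) (auto simp: T_def D_def order.strict_iff_order)
    then have \<epsilon>: "\<epsilon> > 0" using finM by (auto simp: \<epsilon>_def)
    have "(g + \<epsilon> *\<^sub>R \<alpha>) \<bullet> m \<le> c m" if m: "m \<in> M" for m
    proof (cases "m \<in> T")
      case True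
      then have "g \<bullet> m = c m" by (simp add: T_def)
      then show ?thesis using \<alpha>(2)[OF True] \<epsilon> by (simp add: inner_add_left mult_nonneg_nonpos)
    next
      case False
      then have "\<epsilon> \<le> s m" using m finM by (simp add: \<epsilon>_def)
      then have "\<epsilon> * (1 + \<bar>\<alpha> \<bullet> m\<bar>) \<le> c m - g \<bullet> m" by (simp add: s_def le_divide_eq)
      moreover have "\<epsilon> * (\<alpha> \<bullet> m) \<le> \<epsilon> * (1 + \<bar>\<alpha> \<bullet> m\<bar>)" using \<epsilon> by (intro mult_left_mono) auto
      ultimately show ?thesis by (simp add: inner_add_left)
    qed
    then have "(g + \<epsilon> *\<^sub>R \<alpha>) \<bullet> x \<le> g \<bullet> x" by (intro g(2)) (simp add: D_def)
    then show False using \<alpha>(1) \<epsilon> by (simp add: inner_add_left mult_le_0_iff)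
  qed
  then obtain B where B: "B \<subseteq> T" "independent B" "x \<in> convex_cone hull B"
    using convex_cone_hull_caratheodory[OF finT] by blast
  \<comment> \<open>Genericity enters: a set of tight vectors whose cone contains \<open>x\<close>
    spans the whole space.\<close>
  have "convex_cone hull B \<subseteq> span B" by (rule hull_minimal) (simp_all add: span_superset convex_cone_span)
  then have "span B = UNIV" using B generic[of B] by (auto simp: T_def)
  then show thesis using that[of B g] B g(1) by (auto simp: T_def D_def)
qed

section \<open>Rational cones\<close>

definition rational_vector :: "real ^ 'n \<Rightarrow> bool" where
  "rational_vector x \<longleftrightarrow> (\<forall>i. x $ i \<in> \<rat>)"

lemma rational_vector_intros:
  "rational_vector 0" "rational_vector x \<Longrightarrow> rational_vector y \<Longrightarrow> rational_vector (x + y)"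
  "rational_vector x \<Longrightarrow> rational_vector y \<Longrightarrow> rational_vector (x - y)"
  "c \<in> \<rat> \<Longrightarrow> rational_vector x \<Longrightarrow> rational_vector (c *\<^sub>R x)"
  by (auto simp: rational_vector_def intro: Rats_add Rats_diff Rats_mult)

lemma rational_inner: "rational_vector x \<Longrightarrow> rational_vector y \<Longrightarrow> (x \<bullet> y :: real) \<in> \<rat>"
  by (auto simp: rational_vector_def inner_vec_def intro!: Rats_sum Rats_mult)

text \<open>Induction on the equations: if some rational solution \<open>b\<close> of the old ones
  violates the new one, all old solutions can be projected along \<open>b\<close>, and this
  preserves rationality.\<close>

lemma rational_kernel:
  assumes "finite A" "\<And>a. a \<in> A \<Longrightarrow> rational_vector a"
  shows "{x :: real ^ 'n::finite. \<forall>a\<in>A. a \<bullet> x = 0} \<subseteq> span {x. rational_vector x \<and> (\<forall>a\<in>A. a \<bullet> x = 0)}"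
  using assms
proof (induction A rule: finite_induct)
  case empty
  have "x \<in> span {x. rational_vector x}" for x :: "real ^ 'n"
  proof -
    have "x = (\<Sum>i\<in>UNIV. x $ i *\<^sub>R axis i 1)"
      using basis_expansion[of x] by (simp add: scalar_mult_eq_scaleR)
    also have "\<dots> \<in> span {x. rational_vector x}"
      by (intro span_sum span_scale span_base) (auto simp: rational_vector_def axis_def)
    finally show ?thesis .
  qed
  then show ?case by auto
next
  case (insert a A)
  define W where "W = {x :: real ^ 'n. rational_vector x \<and> (\<forall>a\<in>A. a \<bullet> x = 0)}"
  have IH: "x \<in> span W" if "\<forall>a\<in>A. a \<bullet> x = 0" for x
    using insert.IH insert.prems that by (auto simp: W_def)
  show ?case
  proof (cases "\<exists>b\<in>W. a \<bullet> b \<noteq> 0")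
    case False
    then have "W = {x. rational_vector x \<and> (\<forall>a\<in>insert a A. a \<bullet> x = 0)}" by (auto simp: W_def)
    then show ?thesis using IH by auto
  next
    case True
    then obtain b where b: "b \<in> W" "a \<bullet> b \<noteq> 0" by blast
    define P where "P y = y - ((a \<bullet> y) / (a \<bullet> b)) *\<^sub>R b" for y
    have P: "linear P"
      by (rule linearI) (auto simp: P_def inner_add_right add_divide_distrib algebra_simps)
    have img: "P ` W \<subseteq> {x. rational_vector x \<and> (\<forall>a\<in>insert a A. a \<bullet> x = 0)}"
      using b insert.prems
      by (auto simp: P_def W_def inner_diff_right intro!: rational_vector_intros Rats_divide rational_inner)
    show ?thesis
    proof clarify
      fix x assume x: "\<forall>a\<in>insert a A. a \<bullet> x = 0"
      then have "P x = x" by (simp add: P_def)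
      moreover have "x \<in> span W" using IH x by auto
      ultimately have "x \<in> P ` span W" by (metis imageI)
      also have "\<dots> = span (P ` W)" by (rule linear_span_image[OF P, symmetric])
      also have "\<dots> \<subseteq> span {x. rational_vector x \<and> (\<forall>a\<in>insert a A. a \<bullet> x = 0)}"
        by (rule span_mono[OF img])
      finally show "x \<in> span {x. rational_vector x \<and> (\<forall>a\<in>insert a A. a \<bullet> x = 0)}" .
    qed
  qed
qed

text \<open>Real coefficients are approximated by rational ones. With \<open>rational_kernel\<close>
  this makes rational points dense in a subspace given by rational equations.\<close>

lemma span_subset_closure_rational_space:
  fixes V :: "'a::real_normed_vector set"
  assumes "0 \<in> V" "\<And>x y. x \<in> V \<Longrightarrow> y \<in> V \<Longrightarrow> x + y \<in> V"
    and "\<And>c x. c \<in> \<rat> \<Longrightarrow> x \<in> V \<Longrightarrow> c *\<^sub>R x \<in> V"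
  shows "span V \<subseteq> closure V"
proof
  fix x assume "x \<in> span V"
  then show "x \<in> closure V"
  proof (induction rule: span_induct_alt)
    case base
    then show ?case using assms(1) closure_subset by auto
  next
    case (step c b y)
    show ?case
      unfolding closure_approachable
    proof (intro allI impI)
      fix e :: real assume e: "e > 0"
      then obtain y' where y': "y' \<in> V" "dist y' y < e / 2"
        using step(2) unfolding closure_approachable by (meson half_gt_zero)
      define \<delta> where "\<delta> = e / (2 * (norm b + 1))"
      have "norm b + 1 > 0" by (simp add: add_nonneg_pos)
      then have \<delta>: "\<delta> > 0" "\<delta> * (norm b + 1) = e / 2" using e by (simp_all add: \<delta>_def field_simps)
      obtain q where q: "q \<in> \<rat>" "c < q" "q < c + \<delta>"
        using Rats_dense_in_real[of c "c + \<delta>"] \<delta> by auto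
      have "norm ((q - c) *\<^sub>R b) \<le> \<delta> * (norm b + 1)"
        using q \<delta> by (auto intro!: mult_mono)
      then have "norm ((q - c) *\<^sub>R b) + norm (y' - y) < e"
        using y'(2) \<delta>(2) by (simp add: dist_norm)
      moreover have "(q *\<^sub>R b + y') - (c *\<^sub>R b + y) = (q - c) *\<^sub>R b + (y' - y)"
        by (simp add: algebra_simps)
      ultimately have "dist (q *\<^sub>R b + y') (c *\<^sub>R b + y) < e"
        unfolding dist_norm by (metis norm_triangle_ineq order.strict_trans1)
      moreover have "q *\<^sub>R b + y' \<in> V" using assms step(1) q y' by blast
      ultimately show "\<exists>z\<in>V. dist z (c *\<^sub>R b + y) < e" by blast
    qed
  qed
qed

lemma rational_vector_multiple:
  fixes p :: "real ^ 'n::finite"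
  assumes "rational_vector p"
  obtains N where "N > 0" "real N *\<^sub>R p \<in> L_int"
proof -
  have "\<exists>n. n > 0 \<and> real n * p $ i \<in> \<int>" for i
  proof -
    have "p $ i \<in> \<rat>" using assms by (simp add: rational_vector_def)
    then obtain a :: int and n :: nat where "n \<noteq> 0" "p $ i = of_int a / real n"
      by (auto simp: Rats_eq_int_div_nat)
    then show ?thesis by (intro exI[of _ n]) auto
  qed
  then obtain n where n: "\<And>i. n i > (0::nat)" "\<And>i. real (n i) * p $ i \<in> \<int>" by metis
  have "real (\<Prod>j\<in>UNIV. n j) * p $ i \<in> \<int>" for i
  proof -
    have "real (\<Prod>j\<in>UNIV. n j) * p $ i = real (\<Prod>j\<in>UNIV - {i}. n j) * (real (n i) * p $ i)"
      by (subst prod.remove[of UNIV i]) auto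
    then show ?thesis using n(2)[of i] by (metis Ints_mult Ints_of_nat)
  qed
  then show thesis using that[of "\<Prod>j\<in>UNIV. n j"] n(1) by (auto simp: L_int_def)
qed

text \<open>Given by inequalities rather than generators, because chambers and their traces on
  \<open>S_nodes\<close> arise as intersections.\<close>

definition rational_cone :: "(real ^ 'n::finite) set \<Rightarrow> bool" where
  "rational_cone P \<longleftrightarrow> (\<exists>A. finite A \<and> (\<forall>a\<in>A. rational_vector a) \<and> P = {x. \<forall>a\<in>A. a \<bullet> x \<ge> 0})"

lemma rational_cone_halfspace: "rational_vector a \<Longrightarrow> rational_cone {x. a \<bullet> x \<ge> 0}"
  unfolding rational_cone_def by (intro exI[of _ "{a}"]) auto

lemma rational_cone_Inter:
  assumes "finite \<K>" "\<And>K. K \<in> \<K> \<Longrightarrow> rational_cone K"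
  shows "rational_cone (\<Inter>\<K>)"
proof -
  have "\<forall>K\<in>\<K>. \<exists>A. finite A \<and> (\<forall>a\<in>A. rational_vector a) \<and> K = {x. \<forall>a\<in>A. a \<bullet> x \<ge> 0}"
    using assms(2) by (simp add: rational_cone_def)
  then obtain A where A: "\<forall>K\<in>\<K>. finite (A K) \<and> (\<forall>a\<in>A K. rational_vector a) \<and> K = {x. \<forall>a\<in>A K. a \<bullet> x \<ge> 0}"
    by (rule bchoice[THEN exE])
  have mem: "x \<in> K \<longleftrightarrow> (\<forall>a\<in>A K. a \<bullet> x \<ge> 0)" if "K \<in> \<K>" for x K
    using A that by blast
  have "\<Inter>\<K> = {x. \<forall>a\<in>(\<Union>K\<in>\<K>. A K). a \<bullet> x \<ge> 0}"
    by (simp add: set_eq_iff mem)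
  then show ?thesis
    unfolding rational_cone_def using assms(1) A by (intro exI[of _ "\<Union>K\<in>\<K>. A K"]) auto
qed

lemma rational_cone_Int: "rational_cone P \<Longrightarrow> rational_cone R \<Longrightarrow> rational_cone (P \<inter> R)"
  using rational_cone_Inter[of "{P, R}"] by auto

lemma rational_cone_scaleR: "rational_cone P \<Longrightarrow> x \<in> P \<Longrightarrow> 0 \<le> c \<Longrightarrow> c *\<^sub>R x \<in> P"
  by (auto simp: rational_cone_def)

lemma rational_cone_closed: "rational_cone P \<Longrightarrow> closed P"
proof -
  assume "rational_cone P"
  then obtain A where "P = {x. \<forall>a\<in>A. a \<bullet> x \<ge> 0}" by (auto simp: rational_cone_def)
  then have "P = (\<Inter>a\<in>A. {x. a \<bullet> x \<ge> 0})" by blast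
  then show ?thesis by (simp add: closed_INT closed_halfspace_ge)
qed

text \<open>A lattice point in the relative interior: inequalities that are equalities on all of
  \<open>P\<close> are kept as equations, the others are strict at \<open>s\<close>, and a rational
  point near \<open>s\<close> inherits this. Strictness lets multiples of \<open>p\<close> absorb
  any element of \<open>P\<close>.\<close>

lemma rational_cone_lattice_point:
  fixes P :: "(real ^ 'n::finite) set"
  assumes "rational_cone P"
  obtains p where "p \<in> P" "p \<in> L_int"
    "\<And>l. l \<in> P \<Longrightarrow> \<exists>k\<^sub>0::nat. \<forall>k\<ge>k\<^sub>0. real k *\<^sub>R p - l \<in> P"
proof -
  obtain A where A: "finite A" "\<And>a. a \<in> A \<Longrightarrow> rational_vector a" and P: "P = {x. \<forall>a\<in>A. a \<bullet> x \<ge> 0}"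
    using assms by (auto simp: rational_cone_def)
  define A0 where "A0 = {a \<in> A. \<forall>x\<in>P. a \<bullet> x = 0}"
  have "\<exists>x\<in>P. a \<bullet> x > 0" if "a \<in> A - A0" for a
    using that by (force simp: A0_def P order.strict_iff_order)
  then obtain f where f: "\<And>a. a \<in> A - A0 \<Longrightarrow> f a \<in> P \<and> a \<bullet> f a > 0" by metis
  define s where "s = sum f (A - A0)"
  have sP: "s \<in> P"
    using f unfolding s_def P by (auto simp: inner_sum_right intro!: sum_nonneg)
  have spos: "a \<bullet> s > 0" if "a \<in> A - A0" for a
  proof -
    have "a \<bullet> f a \<le> (\<Sum>b\<in>A - A0. a \<bullet> f b)"
      using that f A(1) by (intro member_le_sum) (auto simp: P)
    with f[OF that] show ?thesis by (simp add: s_def inner_sum_right)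
  qed
  define W where "W = {x :: real ^ 'n. rational_vector x \<and> (\<forall>a\<in>A0. a \<bullet> x = 0)}"
  have "s \<in> span W"
    unfolding W_def using A sP by (intro subsetD[OF rational_kernel]) (auto simp: A0_def)
  also have "span W \<subseteq> closure W"
    by (rule span_subset_closure_rational_space)
      (auto simp: W_def inner_add_right intro: rational_vector_intros)
  finally have "s \<in> closure W" .
  moreover have "open (\<Inter>a\<in>A - A0. {x. a \<bullet> x > 0})"
    using A(1) by (intro open_INT) (auto simp: open_halfspace_gt)
  moreover have "s \<in> (\<Inter>a\<in>A - A0. {x. a \<bullet> x > 0})" using spos by auto
  ultimately obtain p' where p': "p' \<in> W" "\<And>a. a \<in> A - A0 \<Longrightarrow> a \<bullet> p' > 0"
    using open_Int_closure_eq_empty[of "\<Inter>a\<in>A - A0. {x. a \<bullet> x > 0}" W] by blast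
  obtain N where N: "N > 0" "real N *\<^sub>R p' \<in> L_int"
    using rational_vector_multiple[of p'] p'(1) by (auto simp: W_def)
  define p where "p = real N *\<^sub>R p'"
  have p0: "a \<bullet> p = 0" if "a \<in> A0" for a using p'(1) that by (simp add: p_def W_def)
  have p1: "a \<bullet> p > 0" if "a \<in> A - A0" for a using p'(2)[OF that] N(1) by (simp add: p_def)
  have "p \<in> P" unfolding P using p0 p1 by (auto simp: less_imp_le) (metis DiffI less_eq_real_def)
  moreover have "\<exists>k\<^sub>0::nat. \<forall>k\<ge>k\<^sub>0. real k *\<^sub>R p - l \<in> P" if l: "l \<in> P" for l
  proof -
    have "\<exists>k\<^sub>0::nat. \<forall>k\<ge>k\<^sub>0. a \<bullet> (real k *\<^sub>R p - l) \<ge> 0" if a: "a \<in> A" for a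
    proof (cases "a \<in> A0")
      case True
      then have "a \<bullet> l = 0" using l by (simp add: A0_def)
      then show ?thesis using p0[OF True] by (simp add: inner_diff_right)
    next
      case False
      then have pos: "a \<bullet> p > 0" using p1 a by blast
      obtain k0 where k0: "a \<bullet> l / (a \<bullet> p) \<le> real k0" by (meson real_arch_simple)
      have "a \<bullet> l \<le> real k * (a \<bullet> p)" if "k \<ge> k0" for k
      proof -
        have "a \<bullet> l \<le> real k0 * (a \<bullet> p)" using k0 pos by (simp add: divide_le_eq)
        also have "\<dots> \<le> real k * (a \<bullet> p)" using that pos by (intro mult_right_mono) auto
        finally show ?thesis .
      qed
      then show ?thesis by (intro exI[of _ k0]) (simp add: inner_diff_right)
    qed
    then obtain k where k: "\<And>a j. a \<in> A \<Longrightarrow> j \<ge> k a \<Longrightarrow> a \<bullet> (real j *\<^sub>R p - l) \<ge> 0" by metis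
    have "real j *\<^sub>R p - l \<in> P" if j: "j \<ge> Max (insert 0 (k ` A))" for j
    proof -
      have "j \<ge> k a" if "a \<in> A" for a using j that A(1) by simp
      then show ?thesis using k by (auto simp: P)
    qed
    then show ?thesis by blast
  qed
  ultimately show thesis using that N(2) by (simp add: p_def)
qed

text \<open>Orthogonality to the other basis vectors is a rational system with a nonzero real
  solution, hence with a nonzero rational one; it cannot annihilate \<open>b\<close> as well, since
  \<open>B\<close> spans.\<close>

lemma rational_dual_vector:
  fixes B :: "(real ^ 'n::finite) set"
  assumes B: "independent B" "span B = UNIV" "\<And>b. b \<in> B \<Longrightarrow> rational_vector b" and b: "b \<in> B"
  obtains a where "rational_vector a" "a \<bullet> b = 1" "\<And>b'. b' \<in> B \<Longrightarrow> b' \<noteq> b \<Longrightarrow> a \<bullet> b' = 0"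
proof -
  have finB: "finite B" using B(1) by (rule independent_imp_finite)
  have "b \<notin> span (B - {b})" using B(1) b by (auto simp: dependent_def)
  then have "span (B - {b}) \<noteq> UNIV" by auto
  then obtain z where z: "z \<noteq> 0" "\<And>y. y \<in> span (B - {b}) \<Longrightarrow> orthogonal z y"
    using orthogonal_to_subspace_exists_gen[of "B - {b}" UNIV] by auto
  define W where "W = {x :: real ^ 'n. rational_vector x \<and> (\<forall>b'\<in>B - {b}. b' \<bullet> x = 0)}"
  have "b' \<bullet> z = 0" if "b' \<in> B - {b}" for b'
    using z(2)[OF span_base[OF that]] by (simp add: orthogonal_def inner_commute)
  then have "z \<in> span W"
    unfolding W_def using finB B(3) by (intro subsetD[OF rational_kernel]) auto
  then have "\<not> W \<subseteq> {0}" using z(1) by (metis span_empty span_insert_0 singletonD span_mono subsetD)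
  then obtain a where a: "a \<in> W" "a \<noteq> 0" by auto
  have "a \<bullet> b \<noteq> 0"
  proof
    assume "a \<bullet> b = 0"
    then have "a \<bullet> y = 0" if "y \<in> B" for y using a(1) that by (cases "y = b") (auto simp: W_def inner_commute)
    then have "orthogonal a y" if "y \<in> span B" for y
      using that orthogonal_to_span by (metis orthogonal_def)
    then have "orthogonal a a" using B(2) by auto
    then show False using a(2) by (simp add: orthogonal_def)
  qed
  moreover have "rational_vector ((1 / (a \<bullet> b)) *\<^sub>R a)"
    using a(1) b B(3) by (intro rational_vector_intros Rats_divide rational_inner) (auto simp: W_def)
  ultimately show thesis
    using that[of "(1 / (a \<bullet> b)) *\<^sub>R a"] a(1) by (auto simp: W_def inner_commute)
qed

text \<open>Passage from generators to inequalities: the dual vectors read off the coordinates in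
  the basis.\<close>

lemma rational_cone_basis:
  fixes B :: "(real ^ 'n::finite) set"
  assumes B: "independent B" "span B = UNIV" "\<And>b. b \<in> B \<Longrightarrow> rational_vector b"
  shows "rational_cone (convex_cone hull B)"
proof -
  have finB: "finite B" using B(1) by (rule independent_imp_finite)
  have "\<exists>a. rational_vector a \<and> a \<bullet> b = 1 \<and> (\<forall>b'\<in>B. b' \<noteq> b \<longrightarrow> a \<bullet> b' = 0)" if "b \<in> B" for b
    using rational_dual_vector[OF B that] by metis
  then obtain a where a: "\<And>b. b \<in> B \<Longrightarrow> rational_vector (a b) \<and> a b \<bullet> b = 1 \<and> (\<forall>b'\<in>B. b' \<noteq> b \<longrightarrow> a b \<bullet> b' = 0)"
    by metis
  have coord: "a b \<bullet> (\<Sum>b\<in>B. c b *\<^sub>R b) = c b" if "b \<in> B" for b c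
  proof -
    have "a b \<bullet> (\<Sum>b\<in>B. c b *\<^sub>R b) = (\<Sum>b'\<in>B. if b' = b then c b' else 0)"
      unfolding inner_sum_right inner_scaleR_right using a[OF that] by (intro sum.cong) auto
    then show ?thesis using that finB by simp
  qed
  have "convex_cone hull B = {x. \<forall>\<alpha>\<in>a ` B. \<alpha> \<bullet> x \<ge> 0}"
  proof (intro equalityI subsetI)
    fix x assume x: "x \<in> {x. \<forall>\<alpha>\<in>a ` B. \<alpha> \<bullet> x \<ge> 0}"
    have "x \<in> span B" using B(2) by simp
    then obtain c where c: "x = (\<Sum>b\<in>B. c b *\<^sub>R b)" by (auto simp: span_finite[OF finB])
    have "\<forall>b\<in>B. 0 \<le> c b" using x coord by (auto simp: c)
    then show "x \<in> convex_cone hull B" using c by (auto simp: convex_cone_hull_finite[OF finB])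
  qed (auto simp: convex_cone_hull_finite[OF finB] coord)
  then show ?thesis unfolding rational_cone_def using a finB by (intro exI[of _ "a ` B"]) auto
qed

section \<open>Chambers\<close>

context plumbing_tree
begin

lemma S_cone_iff: "x \<in> S_cone G \<longleftrightarrow> (\<forall>u. co x u \<ge> 0)"
  by (simp add: S_cone_def star_coord_def)

text \<open>Subtracting a small multiple of \<open>E_star G u\<close> stays in the cone and lowers
  only the star coordinate at \<open>u\<close>.\<close>

lemma interior_S_cone_pos:
  assumes "y \<in> interior (S_cone G)"
  shows "co y u > 0"
proof -
  obtain \<epsilon> where \<epsilon>: "\<epsilon> > 0" "ball y \<epsilon> \<subseteq> S_cone G"
    using assms by (auto simp: mem_interior)
  have "E_star G u \<noteq> 0" using E_star_pos[of u u] by auto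
  then have norm: "norm (E_star G u) > 0" by simp
  define t where "t = \<epsilon> / (2 * norm (E_star G u))"
  have t: "t > 0" "norm (t *\<^sub>R E_star G u) < \<epsilon>"
    using \<epsilon>(1) norm by (auto simp: t_def)
  then have "y - t *\<^sub>R E_star G u \<in> S_cone G"
    using \<epsilon>(2) by (auto simp: dist_norm)
  then have "co (y - t *\<^sub>R E_star G u) u \<ge> 0" by (simp only: S_cone_iff)
  then show ?thesis using t(1) by (simp add: E_star)
qed

lemma finite_M_vectors: "finite (M_vectors G)"
  by (simp add: M_vectors_def)

lemma rational_E_star: "rational_vector (E_star G v)"
  using E_star(1)[of v] by (simp add: L_dual_iff rational_vector_def)

lemma rational_M_vectors: "m \<in> M_vectors G \<Longrightarrow> rational_vector m"
  unfolding M_vectors_def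
proof (elim UnE imageE)
  fix v show "m = - E_base v \<Longrightarrow> rational_vector m" by (auto simp: rational_vector_def axis_def)
qed (simp add: rational_E_star)

text \<open>Distinct vertices have nonnegative intersection numbers, so -E_w, with its negative
  decoration, is the only generator on the wrong side of the facet of \<open>S_cone\<close> at
  \<open>w\<close>.\<close>

lemma M_vectors_co_nonneg: "m \<in> M_vectors G - {- E_base w} \<Longrightarrow> co m w \<ge> 0"
  by (auto simp: M_vectors_def E_star co_E_base)

end

locale plumbing_tree_with_node = plumbing_tree G for G :: "'v::finite plumbing_graph" +
  assumes nodes_nonempty: "nodes G \<noteq> {}"
begin

lemma valency_pos: "valency G v \<ge> 1"
proof -
  obtain n where n: "valency G n \<ge> 3" using nodes_nonempty by (auto simp: nodes_def)
  have "\<exists>w. adjacent G v w"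
  proof (cases "v = n")
    case True
    have "card (nbrs v) \<noteq> 0" using n unfolding True valency_def by linarith
    then have "nbrs v \<noteq> {}" by (metis card.empty)
    then show ?thesis by auto
  next
    case False
    have "(adjacent G)\<^sup>*\<^sup>* v n" using tree by (auto simp: is_tree_def)
    with False show ?thesis by (meson converse_rtranclpE)
  qed
  then have "nbrs v \<noteq> {}" by auto
  then show ?thesis by (simp add: valency_def card_gt_0_iff Suc_le_eq)
qed

text \<open>If \<open>v\<close> separates the end \<open>e\<close> from \<open>w\<close>, then \<open>E\<^sub>v\<^sup>*\<close> and \<open>E\<^sub>e\<^sup>*\<close> are proportional on the
  branch of \<open>w\<close>, and on the remaining vertices the corresponding multiple of \<open>E\<^sub>e\<^sup>*\<close> is the larger one.\<close>

lemma E_star_in_cone: "E_star G v \<in> convex_cone hull (M_vectors G - {- E_base w})"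
proof -
  have E_in: "E_star G e \<in> M_vectors G - {- E_base w}" if "e \<in> ends G" for e
  proof -
    have "E_star G e $ w \<noteq> (- E_base w) $ w" using E_star_pos[of e w] by (simp add: axis_def)
    then show ?thesis using that by (auto simp: M_vectors_def)
  qed
  show ?thesis
  proof (cases "v \<in> ends G")
    case True
    then show ?thesis by (intro hull_inc E_in)
  next
    case False
    then have val: "valency G v \<ge> 2" using valency_pos[of v] by (simp add: ends_def)
    have "card (nbrs v) \<noteq> 0" using val unfolding valency_def by linarith
    then have "nbrs v \<noteq> {}" by (metis card.empty)
    then obtain x where "adjacent G v x" by auto
    then have "x \<noteq> v" using not_adjacent_self by auto
    \<comment> \<open>For w = v any other vertex may mark the branch, since the difference
      \<open>d\<close> below vanishes at \<open>v\<close> anyway.\<close>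
    then obtain w' where w': "w' \<noteq> v" "w = v \<or> w' = w"
      by (cases "w = v") auto
    obtain e U where eU: "e \<in> ends G" "w' \<in> U" "v \<notin> U" "e \<notin> U"
      "\<And>a b. a \<in> U \<Longrightarrow> adjacent G a b \<Longrightarrow> b \<in> U \<or> b = v"
      using tree_separating_end[OF tree val w'(1)] by blast
    \<comment> \<open>The factor that makes \<open>d\<close> vanish at \<open>v\<close>.\<close>
    define \<kappa> where "\<kappa> = E_star G v $ v / E_star G e $ v"
    have \<kappa>: "\<kappa> > 0" using E_star_pos by (simp add: \<kappa>_def)
    define d where "d = \<kappa> *\<^sub>R E_star G e - E_star G v"
    have co_d: "co d u = (if u = e then \<kappa> else 0) - (if u = v then 1 else 0)" for u
      by (simp add: d_def E_star)
    have dv: "d $ v = 0" using E_star_pos[of e v] by (simp add: d_def \<kappa>_def)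
    have d_nonneg: "d $ u \<ge> 0" for u
      using \<kappa> dv by (intro minimum_principle) (auto simp: co_d)
    \<comment> \<open>On \<open>U\<close> the vector \<open>d\<close> has zero products, and its
      boundary value at \<open>v\<close> is 0. Cut off outside \<open>U\<close> it has square 0, so
      it vanishes there; hence -E_w does not occur in the expansion.\<close>
    define d' :: "real ^ 'v" where "d' = (\<chi> u. if u \<in> U then d $ u else 0)"
    have "co d' u * d' $ u = 0" for u
    proof (cases "u \<in> U")
      case True
      have "d' $ b = d $ b" if "adjacent G u b" for b
        using eU(5)[OF True that] dv by (auto simp: d'_def)
      then have "co d' u = co d u" using True by (simp add: star_coord_eq d'_def)
      then show ?thesis using True eU by (auto simp: co_d)
    qed (simp add: d'_def)
    then have "form G d' d' = 0" by (simp only: form_eq_star_coord_sum sum.neutral_const minus_zero)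
    then have "d' = 0" using neg_def unfolding negative_definite_def by (metis less_irrefl)
    then have "d' $ w' = 0" by simp
    then have "d $ w' = 0" using eU(2) by (simp add: d'_def)
    then have dw: "d $ w = 0" using w'(2) dv by auto
    have "(\<Sum>u\<in>UNIV. d $ u *\<^sub>R E_base u) = d $ w *\<^sub>R E_base w + (\<Sum>u\<in>UNIV - {w}. d $ u *\<^sub>R E_base u)"
      by (rule sum.remove) auto
    then have sum: "(\<Sum>u\<in>UNIV - {w}. d $ u *\<^sub>R E_base u) = d"
      using basis_expansion[of d] dw by (simp add: scalar_mult_eq_scaleR)
    have eq: "E_star G v = \<kappa> *\<^sub>R E_star G e + (\<Sum>u\<in>UNIV - {w}. d $ u *\<^sub>R (- E_base u))"
      unfolding scaleR_minus_right sum_negf sum by (simp add: d_def)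
    show ?thesis
      unfolding eq
    proof (intro convex_cone_hull_add convex_cone_hull_mul convex_cone_hull_sumI)
      fix u assume "u \<in> UNIV - {w}"
      then show "- E_base u \<in> convex_cone hull (M_vectors G - {- E_base w})"
        by (intro hull_inc) (auto simp: M_vectors_def axis_eq_axis)
    qed (use \<kappa> d_nonneg E_in[OF eU(1)] in \<open>auto intro: hull_inc\<close>)
  qed
qed

text \<open>With \<open>M_vectors_co_nonneg\<close> this exhibits \<open>S_cone\<close> as the
  intersection over all \<open>w\<close> of cones generated by subsets of
  \<open>M_vectors G\<close>, which makes the chambers compatible with it.\<close>

lemma S_cone_in_cone:
  assumes "x \<in> S_cone G"
  shows "x \<in> convex_cone hull (M_vectors G - {- E_base w})"
proof -
  have "(\<Sum>v\<in>UNIV. co x v *\<^sub>R E_star G v) \<in> convex_cone hull (M_vectors G - {- E_base w})"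
    using assms by (intro convex_cone_hull_sumI E_star_in_cone) (simp add: S_cone_iff)
  then show ?thesis by (simp only: E_star_expansion[of x, symmetric])
qed

text \<open>Every \<open>x\<close> lies below a large multiple of an \<open>E_star\<close> vector,
  whose coordinates are all positive, and the vectors -E_u lead from there down to
  \<open>x\<close>.\<close>

lemma cone_M_vectors: "convex_cone hull (M_vectors G) = UNIV"
proof -
  have "x \<in> convex_cone hull (M_vectors G)" for x
  proof -
    obtain v :: 'v where True by blast
    define t where "t = (\<Sum>u\<in>UNIV. \<bar>x $ u\<bar> / E_star G v $ u)"
    have t: "t \<ge> 0" "x $ u \<le> t * E_star G v $ u" for u
    proof -
      show "t \<ge> 0" using E_star_pos by (auto simp: t_def intro!: sum_nonneg divide_nonneg_pos)
      have "\<bar>x $ u\<bar> / E_star G v $ u \<le> t"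
        unfolding t_def using E_star_pos by (intro member_le_sum) (auto intro: divide_nonneg_pos)
      then show "x $ u \<le> t * E_star G v $ u" using E_star_pos[of v u] by (simp add: divide_le_eq)
    qed
    have "t *\<^sub>R E_star G v - x = (\<Sum>u\<in>UNIV. (t * E_star G v $ u - x $ u) *\<^sub>R E_base u)"
      using basis_expansion[of "t *\<^sub>R E_star G v - x"] by (simp add: scalar_mult_eq_scaleR)
    then have eq: "t *\<^sub>R E_star G v + (\<Sum>u\<in>UNIV. (t * E_star G v $ u - x $ u) *\<^sub>R (- E_base u)) = x"
      unfolding scaleR_minus_right sum_negf by (simp only: add_uminus_conv_diff) (metis add_diff_cancel_left' diff_add_cancel)
    have "E_star G v \<in> convex_cone hull (M_vectors G)"
      using E_star_in_cone[of v v] hull_mono[of "M_vectors G - {- E_base v}" "M_vectors G"] by auto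
    moreover have "(\<Sum>u\<in>UNIV. (t * E_star G v $ u - x $ u) *\<^sub>R (- E_base u)) \<in> convex_cone hull (M_vectors G)"
      using t by (intro convex_cone_hull_sumI) (auto simp: M_vectors_def intro: hull_inc)
    ultimately have "t *\<^sub>R E_star G v + (\<Sum>u\<in>UNIV. (t * E_star G v $ u - x $ u) *\<^sub>R (- E_base u))
        \<in> convex_cone hull (M_vectors G)"
      using t(1) by (intro convex_cone_hull_add convex_cone_hull_mul)
    then show ?thesis by (simp only: eq)
  qed
  then show ?thesis by auto
qed

text \<open>Both the independent set around \<open>x\<close> and its completion to a basis are taken
  from the generators other than -E_w, all of which lie in the half-space.\<close>

lemma basic_cone_in_halfspace:
  assumes "x \<in> S_cone G"
  obtains K where "K \<in> basic_cones G" "x \<in> K" "\<And>y. y \<in> K \<Longrightarrow> co y w \<ge> 0"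
proof -
  let ?M = "M_vectors G - {- E_base w}"
  obtain B where B: "B \<subseteq> ?M" "independent B" "x \<in> convex_cone hull B"
    using convex_cone_hull_caratheodory[OF _ S_cone_in_cone[OF assms]] finite_M_vectors by blast
  obtain B' where B': "B \<subseteq> B'" "B' \<subseteq> ?M" "independent B'" "?M \<subseteq> span B'"
    using maximal_independent_subset_extend[OF B(1,2)] by blast
  have "convex_cone hull ?M \<subseteq> span B'"
    using B'(4) by (intro hull_minimal) (auto intro: convex_cone_span)
  then have "E_star G v \<in> span B'" for v using E_star_in_cone by blast
  then have comb: "(\<Sum>v\<in>UNIV. co y v *\<^sub>R E_star G v) \<in> span B'" for y
    by (intro span_sum span_scale)
  have "y \<in> span B'" for y
    using comb[of y] by (simp only: E_star_expansion[of y, symmetric])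
  then have span: "span B' = UNIV" by auto
  have fin: "finite B'" using B'(3) by (rule independent_imp_finite)
  show thesis
  proof (rule that)
    show "convex_cone hull B' \<in> basic_cones G" using B' span by (auto simp: basic_cones_def)
    show "x \<in> convex_cone hull B'" using B(3) hull_mono[OF B'(1)] by auto
    fix y assume "y \<in> convex_cone hull B'"
    then obtain c where "\<forall>b\<in>B'. 0 \<le> c b" "y = (\<Sum>b\<in>B'. c b *\<^sub>R b)"
      by (auto simp: convex_cone_hull_finite[OF fin])
    then show "co y w \<ge> 0" using M_vectors_co_nonneg B'(2)
      by (auto simp: star_coord_sum intro!: sum_nonneg mult_nonneg_nonneg)
  qed
qed

section \<open>Position of the chambers relative to \<open>S_cone\<close>\<close>

lemma finite_basic_cones: "finite (basic_cones G)"
proof (rule finite_subset)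
  show "basic_cones G \<subseteq> (\<lambda>B. convex_cone hull B) ` Pow (M_vectors G)"
    by (auto simp: basic_cones_def)
qed (simp add: finite_M_vectors)

lemma basic_cone_rational: "K \<in> basic_cones G \<Longrightarrow> rational_cone K"
  unfolding basic_cones_def by (auto intro!: rational_cone_basis dest: rational_M_vectors)

lemma basic_cone_closed: "K \<in> basic_cones G \<Longrightarrow> closed K"
  by (intro rational_cone_closed basic_cone_rational)

text \<open>The finitely many proper subspaces spanned by generators form a null set, which contains
  no nonempty open set.\<close>

lemma ex_generic_point:
  fixes O' :: "(real ^ 'v) set"
  assumes "open O'" "O' \<noteq> {}"
  obtains x where "x \<in> O'" "\<And>B. B \<subseteq> M_vectors G \<Longrightarrow> x \<in> span B \<Longrightarrow> span B = UNIV"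
proof -
  let ?\<B> = "{B. B \<subseteq> M_vectors G \<and> span B \<noteq> UNIV}"
  have "negligible (span B)" if "span B \<noteq> UNIV" for B :: "(real ^ 'v) set"
  proof (rule negligible_lowdim)
    have "dim B < DIM(real ^ 'v)"
      using that dim_eq_full[of B] dim_subset_UNIV[of B] by (simp add: order.strict_iff_order)
    then show "dim (span B) < DIM(real ^ 'v)" by simp
  qed
  then have "negligible (\<Union>B\<in>?\<B>. span B)"
    using finite_M_vectors by (intro negligible_Union) auto
  then have "\<not> O' \<subseteq> (\<Union>B\<in>?\<B>. span B)"
    using assms negligible_subset open_not_negligible by blast
  then show thesis using that by blast
qed

text \<open>Were the base point outside \<open>S\<close>, an optimal basis for the cost \<open>|(m, E\<^sub>w)|\<close>, where \<open>E\<^sub>w\<close> is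
  dual to the facet through which one enters \<open>S\<close>, would cut the chamber at that facet.\<close>

lemma refinement_cell_base_in_S_cone:
  assumes "interior (refinement_cell G x\<^sub>0 \<inter> S_cone G) \<noteq> {}"
  shows "x\<^sub>0 \<in> S_cone G"
proof (rule ccontr)
  assume "x\<^sub>0 \<notin> S_cone G"
  then obtain w\<^sub>0 where w0: "co x\<^sub>0 w\<^sub>0 < 0" by (auto simp: S_cone_iff not_le)
  obtain y where y: "y \<in> interior (refinement_cell G x\<^sub>0 \<inter> S_cone G)" using assms by auto
  then have yC: "y \<in> refinement_cell G x\<^sub>0" using interior_subset by blast
  have y_pos: "co y u > 0" for u
    using interior_mono[of "refinement_cell G x\<^sub>0 \<inter> S_cone G" "S_cone G"] y
    by (intro interior_S_cone_pos) auto
  \<comment> \<open>A neighbourhood of \<open>x\<^sub>0\<close> in which every basic cone containing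
    the point also contains \<open>x\<^sub>0\<close>; this permits passing to a generic
    point.\<close>
  define O' where "O' = {x. co x w\<^sub>0 < 0} \<inter> (\<Inter>K\<in>{K \<in> basic_cones G. x\<^sub>0 \<notin> K}. - K)"
  have cont: "continuous_on UNIV (\<lambda>x. co x w\<^sub>0)"
    using linear_star_coord by (intro linear_continuous_on) (simp add: linear_conv_bounded_linear)
  have "open O'"
    unfolding O'_def using finite_basic_cones basic_cone_closed
    by (intro open_Int open_Collect_less cont continuous_on_const open_INT) (auto simp: open_Compl)
  moreover have "x\<^sub>0 \<in> O'" using w0 by (auto simp: O'_def)
  ultimately obtain x where x: "x \<in> O'"
    and generic: "\<And>B. B \<subseteq> M_vectors G \<Longrightarrow> x \<in> span B \<Longrightarrow> span B = UNIV"
    using ex_generic_point[of O'] by blast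
  define A where "A = {u. co x u < 0}"
  \<comment> \<open>The parameter at which the segment from \<open>x\<close> to \<open>y\<close>
    crosses the facet at \<open>u\<close>; the largest one is the entry into
    \<open>S_cone\<close>.\<close>
  define f where "f u = co x u / (co x u - co y u)" for u
  have "w\<^sub>0 \<in> A" using x by (simp add: A_def O'_def)
  then have "Max (f ` A) \<in> f ` A" by (intro Max_in) auto
  then obtain w where w: "w \<in> A" "f w = Max (f ` A)" by force
  define s where "s = f w"
  have xw: "co x w < 0" using w(1) by (simp add: A_def)
  have s: "0 < s" "s < 1"
    using xw y_pos[of w] by (auto simp: s_def f_def zero_less_divide_iff divide_less_eq)
  define z where "z = (1 - s) *\<^sub>R x + s *\<^sub>R y"
  have co_z: "co z u = co x u - s * (co x u - co y u)" for u
    by (simp add: z_def algebra_simps)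
  have "co z w = 0" using xw y_pos[of w] by (simp add: co_z s_def f_def)
  have "z \<in> S_cone G"
    unfolding S_cone_iff
  proof
    fix u
    show "co z u \<ge> 0"
    proof (cases "u \<in> A")
      case True
      then have "f u \<le> s" using w(2) by (simp add: s_def)
      moreover have "co x u - co y u < 0" using True y_pos[of u] by (simp add: A_def)
      ultimately have "s * (co x u - co y u) \<le> co x u"
        by (simp add: f_def divide_le_eq)
      then show ?thesis by (simp add: co_z)
    next
      case False
      have "co z u = (1 - s) * co x u + s * co y u" by (simp add: z_def)
      also have "\<dots> \<ge> 0" using False s y_pos[of u] by (intro add_nonneg_nonneg) (auto simp: A_def not_less)
      finally show ?thesis .
    qed
  qed
  define c where "c m = \<bar>co m w\<bar>" for m
  obtain B g where B: "B \<subseteq> M_vectors G" "independent B" "span B = UNIV" "x \<in> convex_cone hull B"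
    and g: "\<And>m. m \<in> M_vectors G \<Longrightarrow> g \<bullet> m \<le> c m" "\<And>b. b \<in> B \<Longrightarrow> g \<bullet> b = c b"
    using optimal_basis[OF finite_M_vectors cone_M_vectors _ generic, of c] by (auto simp: c_def)
  define K where "K = convex_cone hull B"
  have K: "K \<in> basic_cones G" "x \<in> K" using B by (auto simp: K_def basic_cones_def)
  then have "x\<^sub>0 \<in> K" using x by (auto simp: O'_def)
  then have "y \<in> K" using yC K(1) by (auto simp: refinement_cell_def)
  \<comment> \<open>Being tight on \<open>B\<close>, the functional \<open>g\<close> extends the
    cost linearly over \<open>K\<close>, so the triangle inequality applies.\<close>
  have gK: "\<bar>co v w\<bar> \<le> g \<bullet> v" if v: "v \<in> K" for v
  proof -
    have fin: "finite B" using B(2) by (rule independent_imp_finite)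
    obtain l where l: "\<forall>b\<in>B. 0 \<le> l b" "v = (\<Sum>b\<in>B. l b *\<^sub>R b)"
      using v by (auto simp: K_def convex_cone_hull_finite[OF fin])
    have "\<bar>co v w\<bar> \<le> (\<Sum>b\<in>B. \<bar>l b * co b w\<bar>)"
      unfolding l(2) star_coord_sum by (simp add: sum_abs)
    also have "\<dots> = g \<bullet> v"
      unfolding l(2) inner_sum_right inner_scaleR_right using l(1) g(2)
      by (intro sum.cong) (auto simp: c_def abs_mult)
    finally show ?thesis .
  qed
  \<comment> \<open>On the generators other than -E_w the cost is linear, and \<open>z\<close> is a
    combination of these. So \<open>g\<close> is at most 0 at \<open>z\<close>, although
    \<open>z\<close> lies between two points of \<open>K\<close> with positive values.\<close>
  have "g \<bullet> z \<le> co z w"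
  proof -
    let ?M = "M_vectors G - {- E_base w}"
    have fin: "finite ?M" using finite_M_vectors by simp
    obtain l where l: "\<forall>m\<in>?M. 0 \<le> l m" "z = (\<Sum>m\<in>?M. l m *\<^sub>R m)"
      using S_cone_in_cone[OF \<open>z \<in> S_cone G\<close>, of w] by (auto simp: convex_cone_hull_finite[OF fin])
    have "(\<Sum>m\<in>?M. l m * (g \<bullet> m)) \<le> (\<Sum>m\<in>?M. l m * co m w)"
    proof (intro sum_mono mult_left_mono)
      fix m assume m: "m \<in> ?M"
      then show "g \<bullet> m \<le> co m w" using g(1)[of m] M_vectors_co_nonneg[OF m] by (simp add: c_def)
      show "0 \<le> l m" using l(1) m by blast
    qed
    then show ?thesis unfolding l(2) star_coord_sum by (simp add: inner_sum_right)
  qed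
  moreover have "g \<bullet> z > 0"
  proof -
    have "g \<bullet> z = (1 - s) * (g \<bullet> x) + s * (g \<bullet> y)" by (simp add: z_def inner_add_right)
    moreover have "g \<bullet> x > 0" using gK[OF K(2)] xw by simp
    moreover have "g \<bullet> y > 0" using gK[OF \<open>y \<in> K\<close>] y_pos[of w] by simp
    ultimately show ?thesis using s by (simp add: add_pos_pos)
  qed
  ultimately show False using \<open>co z w = 0\<close> by simp
qed

text \<open>Once the base point lies in \<open>S_cone\<close>, for every \<open>w\<close> one of the
  cones cutting out the cell lies in the half-space at \<open>w\<close>.\<close>

lemma chamber_subset_S_cone:
  assumes "is_chamber G C" "interior (C \<inter> S_cone G) \<noteq> {}"
  shows "C \<subseteq> S_cone G"
proof
  fix y assume y: "y \<in> C"
  obtain x\<^sub>0 where x0: "C = refinement_cell G x\<^sub>0" using assms(1) by (auto simp: is_chamber_def)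
  then have "x\<^sub>0 \<in> S_cone G" using refinement_cell_base_in_S_cone assms(2) by blast
  have "co y w \<ge> 0" for w
    using basic_cone_in_halfspace[OF \<open>x\<^sub>0 \<in> S_cone G\<close>, of w] y
    by (auto simp: x0 refinement_cell_def)
  then show "y \<in> S_cone G" by (simp add: S_cone_iff)
qed

lemma chamber_rational:
  assumes "is_chamber G C"
  shows "rational_cone C"
proof -
  obtain x\<^sub>0 where "C = refinement_cell G x\<^sub>0" using assms(1) by (auto simp: is_chamber_def)
  then show ?thesis
    unfolding refinement_cell_def using finite_basic_cones basic_cone_rational
    by (auto intro!: rational_cone_Inter)
qed

end

section \<open>Periodic constants\<close>

definition additive_subgroup :: "'a::ab_group_add set \<Rightarrow> bool" where
  "additive_subgroup A \<longleftrightarrow> 0 \<in> A \<and> (\<forall>x\<in>A. \<forall>y\<in>A. x - y \<in> A)"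

lemma additive_subgroup_add:
  assumes "additive_subgroup A" "x \<in> A" "y \<in> A"
  shows "x + y \<in> A"
proof -
  have "0 - y \<in> A" using assms unfolding additive_subgroup_def by blast
  then have "x - (0 - y) \<in> A" using assms unfolding additive_subgroup_def by blast
  then show ?thesis by simp
qed

lemma additive_subgroup_multiple:
  fixes A :: "'a::real_vector set"
  assumes "additive_subgroup A" "x \<in> A"
  shows "real k *\<^sub>R x \<in> A"
proof (induction k)
  case 0
  then show ?case using assms(1) by (simp add: additive_subgroup_def)
next
  case (Suc k)
  then show ?case using additive_subgroup_add[OF assms(1,2)] by (simp add: scaleR_add_left)
qed

lemma finite_index_sublattice_subgroup: "finite_index_sublattice B A \<Longrightarrow> additive_subgroup B"
  by (simp add: finite_index_sublattice_def additive_subgroup_def)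

text \<open>Pigeonhole: two multiples of \<open>p\<close> fall into the same class.\<close>

lemma finite_index_sublattice_multiple:
  fixes A :: "'a::real_vector set"
  assumes A: "additive_subgroup A" and B: "finite_index_sublattice B A" and p: "p \<in> A"
  obtains N where "N > 0" "real N *\<^sub>R p \<in> B"
proof -
  define f where "f k = congruence A B `` {real k *\<^sub>R p}" for k
  have mult: "real k *\<^sub>R p \<in> A" for k using additive_subgroup_multiple[OF A p] .
  have "range f \<subseteq> A // congruence A B" using mult by (auto simp: f_def quotientI)
  then have "finite (range f)" using B finite_subset by (auto simp: finite_index_sublattice_def)
  then have "\<not> inj f" using finite_imageD[of f UNIV] by auto
  then obtain i j where ij: "i \<noteq> j" "f i = f j" by (auto simp: inj_def)
  have "0 \<in> B" using B by (simp add: finite_index_sublattice_def)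
  have diff: "real i *\<^sub>R p - real j *\<^sub>R p \<in> B" if "f i = f j" for i j
  proof -
    have "real j *\<^sub>R p \<in> f j" using mult \<open>0 \<in> B\<close> by (auto simp: f_def congruence_def)
    with that show ?thesis by (auto simp: f_def congruence_def)
  qed
  consider "i < j" | "j < i" using ij by linarith
  then show thesis
  proof cases
    case 1
    then have "real (j - i) *\<^sub>R p \<in> B"
      using diff[OF ij(2)[symmetric]] by (simp add: of_nat_diff scaleR_diff_left)
    with 1 that show thesis by (metis zero_less_diff)
  next
    case 2
    then have "real (i - j) *\<^sub>R p \<in> B"
      using diff[OF ij(2)] by (simp add: of_nat_diff scaleR_diff_left)
    with 2 that show thesis by (metis zero_less_diff)
  qed
qed

text \<open>Points with equal residues modulo \<open>N\<close> in all coordinates are congruent, and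
  there are finitely many residue vectors.\<close>

lemma finite_index_sublatticeI:
  fixes A :: "(real ^ 'n::finite) set"
  assumes A: "A \<subseteq> L_int" and B: "B \<subseteq> A" "additive_subgroup B" and "N > 0"
    and multiples: "\<And>x. x \<in> A \<Longrightarrow> (\<forall>i. \<exists>k. x $ i = of_int (k * int N)) \<Longrightarrow> x \<in> B"
    and subgroup: "additive_subgroup A"
  shows "finite_index_sublattice B A"
proof -
  define res where "res x i = \<lfloor>x $ i\<rfloor> mod int N" for x :: "real ^ 'n" and i
  define cl where "cl x = congruence A B `` {x}" for x
  have "cl x = cl y" if xy: "x \<in> A" "y \<in> A" and eq: "res x = res y" for x y
  proof -
    have "\<exists>k. (x - y) $ i = of_int (k * int N)" for i
    proof -
      have "x $ i \<in> \<int>" "y $ i \<in> \<int>" using A xy by (auto simp: L_int_def)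
      then obtain a b :: int where ab: "x $ i = of_int a" "y $ i = of_int b"
        by (meson Ints_cases)
      have "a mod int N = b mod int N" using fun_cong[OF eq, of i] ab by (simp add: res_def)
      then have "int N dvd a - b" by (simp add: mod_eq_dvd_iff)
      then obtain k where "a - b = int N * k" by (auto elim: dvdE)
      then have "x $ i - y $ i = of_int (k * int N)" using ab by (metis mult.commute of_int_diff)
      then show ?thesis by auto
    qed
    then have d: "x - y \<in> B"
      using multiples[of "x - y"] subgroup xy by (auto simp: additive_subgroup_def)
    have "x - z \<in> B \<longleftrightarrow> y - z \<in> B" for z
    proof
      assume "x - z \<in> B"
      then have "(x - z) - (x - y) \<in> B" using d B(2) unfolding additive_subgroup_def by blast
      then show "y - z \<in> B" by simp
    next
      assume "y - z \<in> B"
      then have "(x - y) + (y - z) \<in> B" using additive_subgroup_add[OF B(2) d] by blast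
      then show "x - z \<in> B" by simp
    qed
    then show ?thesis using xy by (auto simp: cl_def congruence_def)
  qed
  then have "\<forall>f\<in>res ` A. \<exists>C. \<forall>x\<in>A. res x = f \<longrightarrow> cl x = C" by blast
  then obtain g where g: "\<forall>f\<in>res ` A. \<forall>x\<in>A. res x = f \<longrightarrow> cl x = g f"
    by (rule bchoice[THEN exE])
  have "A // congruence A B \<subseteq> g ` res ` A"
    using g by (auto simp: quotient_def cl_def)
  moreover have "finite (res ` A)"
  proof (rule finite_subset)
    show "res ` A \<subseteq> (\<Pi>\<^sub>E i\<in>UNIV. {0..<int N})" using \<open>N > 0\<close> by (auto simp: res_def)
  qed (intro finite_PiE; simp)
  ultimately have "finite (A // congruence A B)" using finite_subset by blast
  then show ?thesis using B by (auto simp: finite_index_sublattice_def additive_subgroup_def)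
qed

lemma finite_index_sublattice_refl:
  assumes "additive_subgroup A"
  shows "finite_index_sublattice A A"
proof -
  have "A // congruence A A \<subseteq> {A}"
    using assms by (auto simp: quotient_def congruence_def additive_subgroup_def)
  then have "finite (A // congruence A A)" using finite_subset by blast
  then show ?thesis using assms by (auto simp: finite_index_sublattice_def additive_subgroup_def)
qed

lemma affine_hull_subgroup:
  fixes K :: "'a::real_vector set"
  assumes "0 \<in> K" "additive_subgroup B"
  shows "additive_subgroup (B \<inter> affine hull K)"
proof -
  have "affine hull K = span K" using assms(1) by (intro affine_hull_span_0 hull_inc)
  then show ?thesis using assms(2) by (auto simp: additive_subgroup_def span_zero span_diff)
qed

lemma has_periodic_constant_polynomialI:
  assumes "closed K" "cone K" "aff_dim K > 0" "l\<^sub>0 \<in> K" and B: "finite_index_sublattice B A"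
    and g: "real_polynomial_function g" and Q: "\<And>l. l \<in> B \<Longrightarrow> l - l\<^sub>0 \<in> K \<Longrightarrow> Q l = g l"
  shows "has_periodic_constant A Q K (g 0)"
proof -
  have "0 \<in> K" using assms(2,4) unfolding cone_def by (metis order_refl scaleR_zero_left)
  have "quasipolynomial_on (B \<inter> affine hull K) g"
    unfolding quasipolynomial_on_def
    using affine_hull_subgroup[OF \<open>0 \<in> K\<close> finite_index_sublattice_subgroup[OF B]] g
    by (intro exI[of _ "B \<inter> affine hull K"] conjI finite_index_sublattice_refl) auto
  moreover have "\<forall>l\<in>B \<inter> (\<lambda>k. l\<^sub>0 + k) ` K. Q l = g l" using Q by auto
  ultimately show ?thesis
    unfolding has_periodic_constant_def using assms by blast
qed

text \<open>Only the polynomial of the class of 0 is kept: it yields the constant, and suitable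
  multiples of \<open>p\<close> lie in that class and, far out, in the shifted cone.\<close>

lemma has_periodic_constant_polynomial_on_ray:
  fixes K :: "'a::euclidean_space set"
  assumes A: "additive_subgroup A" and p: "p \<in> A" "p \<in> K"
    and absorb: "\<And>l. l \<in> K \<Longrightarrow> \<exists>k\<^sub>0::nat. \<forall>k\<ge>k\<^sub>0. real k *\<^sub>R p - l \<in> K"
    and pc: "has_periodic_constant A Q K c"
  obtains N g k\<^sub>0 where "N > 0" "real_polynomial_function g" "g 0 = c"
    "\<And>k. k \<ge> k\<^sub>0 \<Longrightarrow> Q (real (k * N) *\<^sub>R p) = g (real (k * N) *\<^sub>R p)"
proof -
  obtain l0 B q where pc: "cone K" "l0 \<in> K" "finite_index_sublattice B A"
    "quasipolynomial_on (B \<inter> affine hull K) q"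
    "\<forall>l\<in>B \<inter> (\<lambda>k. l0 + k) ` K. Q l = q l" "c = q 0"
    using pc unfolding has_periodic_constant_def by blast
  have K0: "0 \<in> K" using pc(1,2) unfolding cone_def by (metis order_refl scaleR_zero_left)
  have Bsub: "additive_subgroup B" using pc(3) by (rule finite_index_sublattice_subgroup)
  let ?BK = "B \<inter> affine hull K"
  have BK: "additive_subgroup ?BK" using affine_hull_subgroup[OF K0 Bsub] .
  obtain B' where B': "finite_index_sublattice B' ?BK"
    "\<forall>x\<in>?BK. \<exists>g. real_polynomial_function g \<and> (\<forall>y\<in>?BK. y - x \<in> B' \<longrightarrow> q y = g y)"
    using pc(4) unfolding quasipolynomial_on_def by blast
  have "0 \<in> ?BK" using BK by (simp add: additive_subgroup_def)
  then obtain g where g: "real_polynomial_function g" "\<forall>y\<in>?BK. y - 0 \<in> B' \<longrightarrow> q y = g y"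
    using B'(2) by blast
  have "0 \<in> B'" using B'(1) by (simp add: finite_index_sublattice_def)
  then have c: "c = g 0" using g(2) \<open>0 \<in> ?BK\<close> pc(6) by auto
  \<comment> \<open>Two finite-index conditions are met in turn: that of \<open>B\<close>, then that
    of the period lattice \<open>B'\<close>.\<close>
  obtain N1 where N1: "N1 > 0" "real N1 *\<^sub>R p \<in> B"
    using finite_index_sublattice_multiple[OF A pc(3) p(1)] by blast
  have "real N1 *\<^sub>R p \<in> K" using pc(1) p(2) by (simp add: cone_def)
  then have "real N1 *\<^sub>R p \<in> ?BK" using N1(2) by (auto intro: hull_inc)
  then obtain N2 where N2: "N2 > 0" "real N2 *\<^sub>R real N1 *\<^sub>R p \<in> B'"
    using finite_index_sublattice_multiple[OF BK B'(1)] by blast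
  define N where "N = N2 * N1"
  have N: "real N *\<^sub>R p \<in> B'" "N > 0" using N1(1) N2 by (simp_all add: N_def)
  obtain k0 where k0: "\<And>k. k \<ge> k0 \<Longrightarrow> real k *\<^sub>R p - l0 \<in> K" using absorb[OF pc(2)] by blast
  have "Q (real (k * N) *\<^sub>R p) = g (real (k * N) *\<^sub>R p)" if k: "k \<ge> k0" for k
  proof -
    have kN: "real (k * N) *\<^sub>R p \<in> B'"
      using additive_subgroup_multiple[OF finite_index_sublattice_subgroup[OF B'(1)] N(1), of k] by simp
    then have BK': "real (k * N) *\<^sub>R p \<in> ?BK" using B'(1) by (auto simp: finite_index_sublattice_def)
    have "k \<le> k * N" using N(2) by simp
    then have "real (k * N) *\<^sub>R p - l0 \<in> K" using k by (intro k0) linarith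
    then have "real (k * N) *\<^sub>R p \<in> (\<lambda>k. l0 + k) ` K" by (force intro: image_eqI[of _ _ "real (k * N) *\<^sub>R p - l0"])
    then have "Q (real (k * N) *\<^sub>R p) = q (real (k * N) *\<^sub>R p)" using pc(5) BK' by blast
    also have "\<dots> = g (real (k * N) *\<^sub>R p)" using g(2) BK' kN by simp
    finally show ?thesis .
  qed
  with N(2) g(1) c that show thesis by blast
qed

text \<open>Along the line through \<open>p\<close> the difference is a polynomial in one variable
  with infinitely many zeros.\<close>

lemma real_polynomial_function_eventually_eq_at_0:
  fixes g g' :: "'a::euclidean_space \<Rightarrow> real"
  assumes g: "real_polynomial_function g" "real_polynomial_function g'"
    and eq: "\<And>k. k \<ge> k\<^sub>0 \<Longrightarrow> g (real k *\<^sub>R p) = g' (real k *\<^sub>R p)"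
  shows "g 0 = g' 0"
proof -
  have lin: "polynomial_function (\<lambda>t. t *\<^sub>R p)"
    by (intro polynomial_function_bounded_linear bounded_linear_scaleR_left)
  have "real_polynomial_function (\<lambda>t. g (t *\<^sub>R p) - g' (t *\<^sub>R p))"
    using real_polynomial_function_compose[OF lin g(1)] real_polynomial_function_compose[OF lin g(2)]
    by (intro real_polynomial_function_diff) (simp_all add: o_def)
  then obtain a n where a: "(\<lambda>t. g (t *\<^sub>R p) - g' (t *\<^sub>R p)) = (\<lambda>t. \<Sum>i\<le>n. a i * t ^ i)"
    by (auto simp: real_polynomial_function_iff_sum)
  have "infinite {t. (\<Sum>i\<le>n. a i * t ^ i) = 0}"
  proof
    assume "finite {t. (\<Sum>i\<le>n. a i * t ^ i) = 0}"
    moreover have "real ` {k\<^sub>0..} \<subseteq> {t. (\<Sum>i\<le>n. a i * t ^ i) = 0}"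
      using eq by (auto simp: fun_cong[OF a, symmetric])
    ultimately have "finite (real ` {k\<^sub>0..})" by (rule rev_finite_subset)
    then show False using finite_imageD[of real "{k\<^sub>0..}"] infinite_Ici by (auto simp: inj_on_def)
  qed
  then have "\<forall>i\<le>n. a i = 0" using polyfun_finite_roots[of a n] by blast
  then have "(\<Sum>i\<le>n. a i * 0 ^ i) = 0" by simp
  then have "g (0 *\<^sub>R p) - g' (0 *\<^sub>R p) = 0" using fun_cong[OF a, of 0] by simp
  then show ?thesis by simp
qed

lemma periodic_constant_eq:
  fixes K :: "'a::euclidean_space set"
  assumes A: "additive_subgroup A" and p: "p \<in> A" "p \<in> K"
    and absorb: "\<And>l. l \<in> K \<Longrightarrow> \<exists>k\<^sub>0::nat. \<forall>k\<ge>k\<^sub>0. real k *\<^sub>R p - l \<in> K"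
    and pc: "has_periodic_constant A Q K c"
  shows "periodic_constant A Q K = c"
  unfolding periodic_constant_def
proof (rule the_equality, rule pc)
  fix c' assume pc': "has_periodic_constant A Q K c'"
  obtain N g k0 where g: "N > 0" "real_polynomial_function g" "g 0 = c"
    "\<And>k. k \<ge> k0 \<Longrightarrow> Q (real (k * N) *\<^sub>R p) = g (real (k * N) *\<^sub>R p)"
    using has_periodic_constant_polynomial_on_ray[OF A p absorb pc] by metis
  obtain N' g' k0' where g': "N' > 0" "real_polynomial_function g'" "g' 0 = c'"
    "\<And>k. k \<ge> k0' \<Longrightarrow> Q (real (k * N') *\<^sub>R p) = g' (real (k * N') *\<^sub>R p)"
    using has_periodic_constant_polynomial_on_ray[OF A p absorb pc'] by metis
  \<comment> \<open>Both polynomials describe \<open>Q\<close> at far multiples of N N' p, common to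
    the two periods.\<close>
  have "g' 0 = g 0"
  proof (rule real_polynomial_function_eventually_eq_at_0[OF g'(2) g(2), of "max k0 k0'" "real (N * N') *\<^sub>R p"])
    fix k assume k: "k \<ge> max k0 k0'"
    have "k \<le> k * N" "k \<le> k * N'" using g(1) g'(1) by auto
    then have "k * N \<ge> k0'" "k * N' \<ge> k0" using k by linarith+
    then have "Q (real (k * N * N') *\<^sub>R p) = g' (real (k * N * N') *\<^sub>R p)"
      "Q (real (k * N' * N) *\<^sub>R p) = g (real (k * N' * N) *\<^sub>R p)"
      using g(4) g'(4) by blast+
    then show "g' (real k *\<^sub>R real (N * N') *\<^sub>R p) = g (real k *\<^sub>R real (N * N') *\<^sub>R p)"
      by (simp add: mult_ac)
  qed
  then show "c' = c" using g(3) g'(3) by simp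
qed

section \<open>Restriction to the nodes\<close>

lemma additive_subgroup_L_int: "additive_subgroup L_int"
  by (auto simp: additive_subgroup_def L_int_def)

lemma L_int_scaleR_of_int: "x \<in> L_int \<Longrightarrow> of_int k *\<^sub>R x \<in> L_int"
  by (simp add: L_int_def)

lemma linear_pr_nodes: "linear (pr_nodes G)"
  by (rule linearI) (auto simp: pr_nodes_def vec_eq_iff)

section \<open>The node cone and the inverse of the projection\<close>

context plumbing_tree
begin

lemma pr_nodes_inject:
  assumes "l \<in> V_nodes G" "l' \<in> V_nodes G" "pr_nodes G l = pr_nodes G l'"
  shows "l = l'"
proof (rule antisym)
  show "l \<le> l'" "l' \<le> l"
    using le_iff_pr_nodes_le[OF assms(1), of l'] le_iff_pr_nodes_le[OF assms(2), of l] assms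
    by (simp_all add: V_nodes_iff)
qed

lemma S_nodes_iff:
  "x \<in> S_nodes G \<longleftrightarrow> (\<forall>u. co x u \<ge> 0) \<and> (\<forall>u. u \<notin> nodes G \<longrightarrow> co x u = 0)"
proof
  assume "x \<in> S_nodes G"
  then obtain c where c: "\<forall>b\<in>E_star G ` nodes G. 0 \<le> c b" "x = (\<Sum>b\<in>E_star G ` nodes G. c b *\<^sub>R b)"
    unfolding S_nodes_def by (subst (asm) convex_cone_hull_finite) auto
  have "co b u \<ge> 0 \<and> (u \<notin> nodes G \<longrightarrow> co b u = 0)" if "b \<in> E_star G ` nodes G" for b u
    using that by (auto simp: E_star)
  then show "(\<forall>u. co x u \<ge> 0) \<and> (\<forall>u. u \<notin> nodes G \<longrightarrow> co x u = 0)"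
    unfolding c(2) star_coord_sum using c(1)
    by (auto intro!: sum_nonneg mult_nonneg_nonneg sum.neutral)
next
  assume x: "(\<forall>u. co x u \<ge> 0) \<and> (\<forall>u. u \<notin> nodes G \<longrightarrow> co x u = 0)"
  have eq: "(\<Sum>v\<in>nodes G. co x v *\<^sub>R E_star G v) = x"
    by (rule star_coord_inject) (use x in \<open>auto simp: star_coord_combination\<close>)
  have "(\<Sum>v\<in>nodes G. co x v *\<^sub>R E_star G v) \<in> S_nodes G"
    unfolding S_nodes_def using x by (intro convex_cone_hull_sumI) (auto intro: hull_inc)
  then show "x \<in> S_nodes G" by (simp only: eq)
qed

lemma S_nodes_subset_V_nodes: "S_nodes G \<subseteq> V_nodes G"
  by (auto simp: S_nodes_iff V_nodes_iff)

definition co_vector :: "'v \<Rightarrow> real ^ 'v" where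
  "co_vector u = (\<chi> i. co (E_base i) u)"

lemma co_vector: "co_vector u \<bullet> x = co x u"
proof -
  have "co x u = (\<Sum>i\<in>UNIV. x $ i * co (E_base i) u)"
    using star_coord_sum[of G "\<lambda>i. x $ i *\<^sub>R E_base i" UNIV u] basis_expansion[of x]
    by (simp add: scalar_mult_eq_scaleR)
  then show ?thesis by (simp add: co_vector_def inner_vec_def mult.commute)
qed

lemma rational_co_vector: "rational_vector (co_vector u)"
  by (simp add: rational_vector_def co_vector_def co_E_base)

lemma S_nodes_rational: "rational_cone (S_nodes G)"
proof -
  have neg: "rational_vector (- co_vector u)" for u
    using rational_vector_intros(3)[OF rational_vector_intros(1) rational_co_vector, of u] by simp
  have "x \<in> S_nodes G \<longleftrightarrow> (\<forall>u. co x u \<ge> 0) \<and> (\<forall>u\<in>- nodes G. - co x u \<ge> 0)" for x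
    unfolding S_nodes_iff by (metis ComplD ComplI antisym_conv neg_0_le_iff_le order_refl)
  then have "S_nodes G = (\<Inter>u. {x. co_vector u \<bullet> x \<ge> 0}) \<inter> (\<Inter>u\<in>- nodes G. {x. (- co_vector u) \<bullet> x \<ge> 0})"
    unfolding inner_minus_left co_vector by blast
  also have "rational_cone \<dots>"
  proof (intro rational_cone_Int rational_cone_Inter)
    show "rational_cone K" if "K \<in> range (\<lambda>u. {x. co_vector u \<bullet> x \<ge> 0})" for K
      using that rational_cone_halfspace[OF rational_co_vector] by blast
    show "rational_cone K" if "K \<in> (\<lambda>u. {x. (- co_vector u) \<bullet> x \<ge> 0}) ` (- nodes G)" for K
      using that rational_cone_halfspace[OF neg] by blast
  qed auto
  finally show ?thesis .
qed

lemma rel_interior_S_nodes_pos: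
  assumes p: "p \<in> rel_interior (S_nodes G)" and n: "n \<in> nodes G"
  shows "co p n > 0"
proof -
  obtain e where e: "p \<in> S_nodes G" "e > 0" "ball p e \<inter> affine hull S_nodes G \<subseteq> S_nodes G"
    using p by (auto simp: mem_rel_interior_ball)
  have En: "E_star G n \<in> S_nodes G" using n by (simp add: S_nodes_def hull_inc)
  have "norm (E_star G n) > 0" using E_star_pos[of n n] by auto
  define t where "t = e / (2 * norm (E_star G n))"
  have t: "t > 0" "norm (t *\<^sub>R E_star G n) < e"
    using e(2) \<open>norm (E_star G n) > 0\<close> by (auto simp: t_def)
  have "0 \<in> S_nodes G" by (simp add: S_nodes_def convex_cone_hull_contains_0)
  then have "affine hull S_nodes G = span (S_nodes G)" by (intro affine_hull_span_0 hull_inc)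
  then have "p - t *\<^sub>R E_star G n \<in> affine hull S_nodes G"
    using e(1) En by (simp add: span_diff span_scale span_base)
  then have "p - t *\<^sub>R E_star G n \<in> S_nodes G" using e(3) t(2) by (auto simp: dist_norm)
  then have "co (p - t *\<^sub>R E_star G n) n \<ge> 0" by (simp only: S_nodes_iff)
  then show ?thesis using t(1) by (simp add: E_star)
qed

text \<open>The rows of \<open>A\<close> prescribe the coordinate at a node and the product at any
  other vertex; by \<open>pr_nodes_inject\<close> this square rational system has trivial
  kernel.\<close>

lemma rational_node_lift:
  assumes "n \<in> nodes G"
  obtains e where "e \<in> V_nodes G" "pr_nodes G e = E_base n" "rational_vector e"
proof -
  define A :: "real ^ 'v ^ 'v" where "A = (\<chi> u. if u \<in> nodes G then E_base u else co_vector u)"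
  have A: "(A *v x) $ u = (if u \<in> nodes G then x $ u else co x u)" for x u
    by (simp add: A_def matrix_vector_mul_component co_vector inner_axis')
  obtain e where e: "A *v e = E_base n" "\<And>i. e $ i \<in> \<rat>"
  proof (rule rational_linear_system[of A "E_base n"])
    show "A $ i $ j \<in> \<rat>" for i j
      using rational_co_vector[of i] by (simp add: A_def rational_vector_def axis_def)
    show "x = 0" if "A *v x = 0" for x
    proof (rule pr_nodes_inject)
      have *: "(if u \<in> nodes G then x $ u else co x u) = 0" for u using A[of x u] that by simp
      show "x \<in> V_nodes G" using * by (simp add: V_nodes_iff) metis
      show "pr_nodes G x = pr_nodes G 0" using * by (simp add: pr_nodes_def vec_eq_iff) metis
    qed (simp add: V_nodes_iff)
  qed (auto simp: axis_def)
  have *: "(if u \<in> nodes G then e $ u else co e u) = E_base n $ u" for u using A[of e u] e(1) by simp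
  have "co e u = 0" if "u \<notin> nodes G" for u using *[of u] that assms by (auto simp: axis_def)
  moreover have "pr_nodes G e $ u = E_base n $ u" for u
    using *[of u] assms by (auto simp: pr_nodes_def axis_def)
  ultimately show thesis using that[of e] e(2) by (simp add: V_nodes_iff vec_eq_iff rational_vector_def)
qed

text \<open>The inverse of the projection, extended to all vectors by ignoring the other
  coordinates. It need not preserve integrality; \<open>N\<close> clears the denominators of the
  lifted basis vectors.\<close>

lemma node_lift_exists:
  obtains \<iota> N where "linear \<iota>" "\<And>m. \<iota> m \<in> V_nodes G" "\<And>m. pr_nodes G (\<iota> m) = pr_nodes G m"
    "N > 0" "\<And>m. (\<forall>i. \<exists>k. m $ i = of_int (k * int N)) \<Longrightarrow> \<iota> m \<in> L_int"
proof -
  have "\<exists>e. e \<in> V_nodes G \<and> pr_nodes G e = E_base n \<and> rational_vector e" if "n \<in> nodes G" for n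
    using rational_node_lift[OF that] by metis
  then obtain e where e: "\<And>n. n \<in> nodes G \<Longrightarrow> e n \<in> V_nodes G \<and> pr_nodes G (e n) = E_base n \<and> rational_vector (e n)"
    by metis
  then have "\<exists>N>0. real N *\<^sub>R e n \<in> L_int" if "n \<in> nodes G" for n
    using rational_vector_multiple[of "e n"] that by metis
  then obtain M where M: "\<And>n. n \<in> nodes G \<Longrightarrow> M n > 0 \<and> real (M n) *\<^sub>R e n \<in> L_int" by metis
  define \<iota> where "\<iota> m = (\<Sum>n\<in>nodes G. m $ n *\<^sub>R e n)" for m :: "real ^ 'v"
  define N where "N = (\<Prod>n\<in>nodes G. M n)"
  show thesis
  proof (rule that[of \<iota> N])
    show "linear \<iota>"
      by (rule linearI) (auto simp: \<iota>_def scaleR_add_left sum.distrib scaleR_sum_right)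
    show "\<iota> m \<in> V_nodes G" for m
      unfolding \<iota>_def V_nodes_def using e by (intro span_sum span_scale) (simp add: V_nodes_def)
    show "pr_nodes G (\<iota> m) = pr_nodes G m" for m
    proof -
      have "pr_nodes G (\<iota> m) = (\<Sum>n\<in>nodes G. m $ n *\<^sub>R E_base n)"
        using e by (simp add: \<iota>_def linear_sum[OF linear_pr_nodes] linear_scale[OF linear_pr_nodes])
      also have "\<dots> = pr_nodes G m"
        by (auto simp: vec_eq_iff pr_nodes_def axis_def if_distrib sum.delta cong: if_cong)
      finally show ?thesis .
    qed
    show "N > 0" using M by (auto simp: N_def intro!: prod_pos)
    show "\<iota> m \<in> L_int" if m: "\<forall>i. \<exists>k. m $ i = of_int (k * int N)" for m
    proof -
      have "m $ n *\<^sub>R e n \<in> L_int" if n: "n \<in> nodes G" for n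
      proof -
        obtain k where "m $ n = of_int (k * int N)" using m by blast
        moreover have "N = (\<Prod>j\<in>nodes G - {n}. M j) * M n"
          unfolding N_def using n by (simp add: prod.remove mult.commute)
        ultimately have "m $ n *\<^sub>R e n = of_int (k * int (\<Prod>j\<in>nodes G - {n}. M j)) *\<^sub>R (real (M n) *\<^sub>R e n)"
          by simp
        also have "\<dots> \<in> L_int" using M[OF n] by (intro L_int_scaleR_of_int) simp
        finally show ?thesis .
      qed
      then show ?thesis by (auto simp: \<iota>_def L_int_def intro!: Ints_sum)
    qed
  qed
qed

section \<open>Counting in node coordinates: parts (a) and (b)\<close>

lemma end_sum_co_nonneg: "co (end_sum G x) u \<ge> 0"
  by (simp add: end_sum_def star_coord_combination)

lemma Z_h_support_nonneg: "Z_h G h m \<noteq> 0 \<Longrightarrow> co m u \<ge> 0"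
  by (auto simp: Z_h_def Z_coeff_support_nonneg split: if_splits)

text \<open>\<open>P\<close> serves both for the full order and for the order on node coordinates;
  at exponents where these may disagree the coefficients vanish.\<close>

lemma counting_function_Z_h_eq_infsum:
  assumes "\<And>m. (\<And>u. co m u \<ge> 0) \<Longrightarrow> l \<le> m \<longleftrightarrow> P m"
  shows "counting_function (Z_h G h) l = (\<Sum>\<^sub>\<infinity>m\<in>{m. cls G m = h \<and> \<not> P m}. Z_coeff G m)"
  unfolding counting_function_def
proof (rule infsum_cong_neutral)
  fix m assume "m \<in> {m. cls G m = h \<and> \<not> P m} - {m. \<not> l \<le> m}"
  then show "Z_coeff G m = 0" using assms Z_coeff_support_nonneg by blast
next
  fix m assume m: "m \<in> {m. \<not> l \<le> m} - {m. cls G m = h \<and> \<not> P m}"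
  then show "Z_h G h m = 0" using assms[of m] Z_coeff_support_nonneg by (auto simp: Z_h_def)
qed (auto simp: Z_h_def)

text \<open>The reduced coefficients are sums over the fibres of the projection; finite support
  merges the double sum into one over all exponents.\<close>

lemma counting_function_Z_h_nodes:
  assumes l: "l \<in> V_nodes G"
  shows "counting_function (Z_h_nodes G h) (pr_nodes G l) = counting_function (Z_h G h) l"
proof -
  let ?A = "{m. \<not> pr_nodes G l \<le> m}"
  let ?B = "\<lambda>m. {l'. pr_nodes G l' = m}"
  have bij: "bij_betw snd (Sigma ?A ?B) {l'. \<not> pr_nodes G l \<le> pr_nodes G l'}"
    by (rule bij_betwI[where g = "\<lambda>l'. (pr_nodes G l', l')"]) auto
  have "finite {z \<in> Sigma ?A ?B. Z_h G h (snd z) \<noteq> 0}"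
  proof (rule finite_imageD)
    have "snd ` {z \<in> Sigma ?A ?B. Z_h G h (snd z) \<noteq> 0} \<subseteq> {m. Z_coeff G m \<noteq> 0 \<and> \<not> l \<le> m}"
      using le_iff_pr_nodes_le[OF l] Z_h_support_nonneg by (auto simp: Z_h_def split: if_splits)
    then show "finite (snd ` {z \<in> Sigma ?A ?B. Z_h G h (snd z) \<noteq> 0})"
      by (rule finite_subset) (rule finite_not_above)
  qed (auto simp: inj_on_def)
  then have "(\<lambda>z. Z_h G h (snd z)) summable_on Sigma ?A ?B"
    by (rule finite_nonzero_values_imp_summable_on)
  then have "counting_function (Z_h_nodes G h) (pr_nodes G l) = infsum (\<lambda>z. Z_h G h (snd z)) (Sigma ?A ?B)"
    unfolding counting_function_def Z_h_nodes_def by (subst infsum_Sigma_banach[symmetric]) auto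
  also have "\<dots> = infsum (Z_h G h) {l'. \<not> pr_nodes G l \<le> pr_nodes G l'}"
    by (rule infsum_reindex_bij_betw[OF bij])
  also have "\<dots> = counting_function (Z_h G h) l"
    unfolding counting_function_def using le_iff_pr_nodes_le[OF l] Z_h_support_nonneg
    by (intro infsum_cong_neutral) blast+
  finally show ?thesis .
qed

end

section \<open>The polynomial formula on lattice points and on \<open>V_nodes\<close>\<close>

lemma polynomial_function_affine:
  fixes f :: "'a::euclidean_space \<Rightarrow> 'b::euclidean_space"
  assumes "linear f"
  shows "polynomial_function (\<lambda>x. f x + s)"
  using assms by (intro polynomial_function_add polynomial_function_bounded_linear polynomial_function_const)
    (simp add: linear_conv_bounded_linear)

lemma real_polynomial_function_linear:
  fixes f :: "'a::euclidean_space \<Rightarrow> real"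
  shows "linear f \<Longrightarrow> real_polynomial_function f"
  by (intro real_polynomial_function.intros(1)) (simp add: linear_conv_bounded_linear)

context plumbing_tree_class
begin

lemma real_polynomial_function_quad: "real_polynomial_function quad"
proof -
  have "real_polynomial_function (\<lambda>w. \<Sum>v\<in>UNIV. (1 + of_int (decoration G v) / 2) * w $ v + co w v * w $ v / 2)"
    by (intro real_polynomial_function_sum real_polynomial_function.intros(2-4) real_polynomial_function_divide
        real_polynomial_function.intros(1)[OF bounded_linear_vec_nth]
        real_polynomial_function_linear[OF linear_star_coord]) simp_all
  moreover have "quad = (\<lambda>w. \<Sum>v\<in>UNIV. (1 + of_int (decoration G v) / 2) * w $ v + co w v * w $ v / 2)"
    by (simp add: fun_eq_iff quad_def form_eq_star_coord_sum sum.distrib sum_divide_distrib)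
  ultimately show ?thesis by simp
qed

text \<open>Rounding commutes with lattice translations, so on lattice points
  \<open>quad (up l)\<close> is a genuine polynomial in \<open>l\<close>.\<close>

lemma up_lattice: "l \<in> L_int \<Longrightarrow> up l = l + up 0"
proof -
  assume l: "l \<in> L_int"
  have "\<lceil>l $ u - r $ u\<rceil> = \<lfloor>l $ u\<rfloor> + \<lceil>- r $ u\<rceil> \<and> of_int \<lfloor>l $ u\<rfloor> = l $ u" for u
  proof -
    have "l $ u \<in> \<int>" using l by (simp add: L_int_def)
    then obtain k where "l $ u = of_int k" by (auto elim: Ints_cases)
    then show ?thesis using ceiling_add_of_int[of "- r $ u" k] by simp
  qed
  then show ?thesis by (simp add: up_def vec_eq_iff)
qed

text \<open>A point of \<open>V_nodes\<close> is not deep along the chains, but a small shift of it with the same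
  upper coset point is.\<close>

lemma Q_eq_quad_V_nodes:
  assumes c: "\<And>x. x \<in> deep \<Longrightarrow> Q x = c + quad (up x)"
    and l: "l \<in> V_nodes G" and pos: "\<And>n. n \<in> nodes G \<Longrightarrow> co l n > real (valency G n) - 2"
    and n: "n \<in> nodes G"
  shows "Q l = c + quad (up l)"
proof -
  define \<eta> where "\<eta> = (\<Sum>u\<in>UNIV. E_star G u)"
  have \<eta>: "\<eta> $ u > 0" "co \<eta> u = 1" for u
    using E_star_pos by (auto simp: \<eta>_def star_coord_sum E_star intro!: sum_pos)
  \<comment> \<open>\<open>M\<close> is large enough to make all coordinates of \<open>k\<close>
    nonpositive, while its star coordinates stay 1 away from \<open>n\<close>. At \<open>n\<close>
    the strict inequality for \<open>l\<close> leaves room for a small multiple of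
    \<open>k\<close>.\<close>
  define M where "M = (\<Sum>u\<in>UNIV. \<eta> $ u / E_star G n $ u)"
  define k where "k = \<eta> - M *\<^sub>R E_star G n"
  have k_le: "k $ u \<le> 0" for u
  proof -
    have "\<eta> $ u / E_star G n $ u \<le> M"
      unfolding M_def using \<eta> E_star_pos by (intro member_le_sum) (auto intro!: divide_nonneg_pos less_imp_le)
    then show ?thesis using E_star_pos[of n u] by (simp add: k_def divide_le_eq)
  qed
  have co_k: "co k u = 1" if "u \<noteq> n" for u using that by (simp add: k_def \<eta> E_star)
  have "\<forall>\<^sub>F \<epsilon> in at_right (0::real). (\<forall>u\<in>nodes G. co l u + \<epsilon> * co k u > real (valency G u) - 2) \<and>
      (\<forall>u\<in>UNIV. up l $ u - 1 < l $ u + \<epsilon> * k $ u) \<and> \<epsilon> > 0"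
  proof (intro eventually_conj eventually_ball_finite ballI)
    fix u assume u: "u \<in> nodes G"
    have "((\<lambda>\<epsilon>. co l u + \<epsilon> * co k u) \<longlongrightarrow> co l u + 0 * co k u) (at_right 0)" by (intro tendsto_intros)
    then show "\<forall>\<^sub>F \<epsilon> in at_right 0. co l u + \<epsilon> * co k u > real (valency G u) - 2"
      using pos[OF u] by (intro order_tendstoD(1)) auto
  next
    fix u
    have "((\<lambda>\<epsilon>. l $ u + \<epsilon> * k $ u) \<longlongrightarrow> l $ u + 0 * k $ u) (at_right 0)" by (intro tendsto_intros)
    moreover have "up l $ u - 1 < l $ u" unfolding up_def vec_lambda_beta by linarith
    ultimately show "\<forall>\<^sub>F \<epsilon> in at_right 0. up l $ u - 1 < l $ u + \<epsilon> * k $ u"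
      by (intro order_tendstoD(1)) auto
  qed (auto simp: eventually_at_right_less)
  then obtain \<epsilon> where \<epsilon>: "\<And>u. u \<in> nodes G \<Longrightarrow> co l u + \<epsilon> * co k u > real (valency G u) - 2"
    "\<And>u. up l $ u - 1 < l $ u + \<epsilon> * k $ u" "\<epsilon> > 0"
    using eventually_happens[of _ "at_right (0::real)"] by force
  define x where "x = l + \<epsilon> *\<^sub>R k"
  have "x \<in> deep"
    unfolding deep_def mem_Collect_eq
  proof
    fix u
    show "co x u > real (valency G u) - 2"
    proof (cases "u \<in> nodes G")
      case False
      then have "co x u = \<epsilon>" using l n co_k[of u] by (auto simp: x_def V_nodes_iff)
      moreover have "real (valency G u) \<le> 2" using False by (simp add: nodes_def)
      ultimately show ?thesis using \<epsilon>(3) by simp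
    qed (use \<epsilon>(1) in \<open>simp add: x_def\<close>)
  qed
  moreover have "up x = up l"
  proof (rule antisym)
    have "x \<le> l" using k_le \<epsilon>(3) by (simp add: x_def less_eq_vec_def mult_nonneg_nonpos)
    then show "up x \<le> up l" by (rule up_mono)
    show "up l \<le> up x"
      unfolding less_eq_vec_def
    proof
      fix u
      have "up l $ u - 1 < x $ u" using \<epsilon>(2)[of u] by (simp add: x_def)
      also have "\<dots> \<le> up x $ u" using le_up[of x] by (simp add: less_eq_vec_def)
      \<comment> \<open>Both coordinates lie in the same coset of the integers, so a difference
        below 1 is nonpositive.\<close>
      finally show "up l $ u \<le> up x $ u" by (simp add: up_def)
    qed
  qed
  ultimately show ?thesis using c[of x] Q_up[of x] Q_up[of l] by simp
qed

end

section \<open>The two periodic constants: part (c)\<close>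

locale plumbing_tree_class_with_node = plumbing_tree_class G h r + plumbing_tree_with_node G
  for G :: "'v::finite plumbing_graph" and h :: "(real ^ 'v) set" and r :: "real ^ 'v"
begin

text \<open>Far out, the first counting function is \<open>c + quad (l + up 0)\<close> and the
  second is this polynomial composed with the linear lift \<open>\<iota>\<close>; at 0 the two
  values coincide.\<close>

lemma periodic_constants_agree:
  assumes C: "is_chamber G C" and int: "interior (C \<inter> S_cone G) \<noteq> {}"
    and rel: "C \<inter> rel_interior (S_nodes G) \<noteq> {}"
  obtains c where "has_periodic_constant L_int Q C c"
    "has_periodic_constant (L_nodes G) (counting_function (Z_h_nodes G h)) (pr_nodes G ` (C \<inter> S_nodes G)) c"
proof -
  obtain c where c: "\<And>x. x \<in> deep \<Longrightarrow> Q x = c + quad (up x)" using Q_eq_quad by blast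
  have CS: "C \<subseteq> S_cone G" using chamber_subset_S_cone[OF C int] .
  have Crat: "rational_cone C" using chamber_rational[OF C] .
  have C_cone: "cone C" using rational_cone_scaleR[OF Crat] by (auto simp: cone_def)
  \<comment> \<open>The multiple t p serves as apex of the shifted cone: for \<open>C\<close> all
    star coordinates must exceed the bound, for \<open>S_nodes\<close> only those at nodes.\<close>
  have scale: "\<exists>t\<ge>0. \<forall>n\<in>A. t * co p n > real (valency G n) - 2" if pos: "\<And>n. n \<in> A \<Longrightarrow> co p n > 0" for p A
  proof -
    define t where "t = (\<Sum>n\<in>A. real (valency G n) / co p n)"
    have t: "real (valency G n) / co p n \<le> t" if "n \<in> A" for n
      unfolding t_def using that pos less_imp_le by (intro member_le_sum) (auto intro!: divide_nonneg_pos)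
    have "real (valency G n) - 2 < t * co p n" if "n \<in> A" for n
      using t[OF that] pos[OF that] by (simp add: divide_le_eq)
    moreover have "t \<ge> 0" using pos by (auto simp: t_def intro!: sum_nonneg divide_nonneg_pos)
    ultimately show ?thesis by blast
  qed
  have "has_periodic_constant L_int Q C (c + quad (0 + up 0))"
  proof -
    obtain p where p: "p \<in> interior (C \<inter> S_cone G)" using int by auto
    have "co p u > 0" for u
      using p interior_mono[of "C \<inter> S_cone G" "S_cone G"] by (intro interior_S_cone_pos) auto
    then obtain t where t: "t \<ge> 0" "\<And>u. t * co p u > real (valency G u) - 2" using scale[of UNIV p] by auto
    have pC: "p \<in> C" using p interior_subset by blast
    have "interior C \<noteq> {}" using p interior_mono[of "C \<inter> S_cone G" C] by auto
    then have "aff_dim C > 0" by (simp add: aff_dim_nonempty_interior)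
    then show ?thesis
    proof (rule has_periodic_constant_polynomialI[OF rational_cone_closed[OF Crat] C_cone, where g = "\<lambda>l. c + quad (l + up 0)"])
      show "t *\<^sub>R p \<in> C" using C_cone pC t by (simp add: cone_def)
      show "finite_index_sublattice L_int L_int"
        by (intro finite_index_sublattice_refl additive_subgroup_L_int)
      have lin: "linear (\<lambda>x :: real ^ 'v. x)" by (simp add: linear_id[unfolded id_def])
      show "real_polynomial_function (\<lambda>l. c + quad (l + up 0))"
        using real_polynomial_function_compose[OF polynomial_function_affine[OF lin] real_polynomial_function_quad]
        by (intro real_polynomial_function.intros(3) real_polynomial_function.intros(2)) (simp add: o_def)
      \<comment> \<open>Since \<open>C\<close> lies in \<open>S_cone\<close>, moving from the deep
        apex in directions of \<open>C\<close> never lowers a star coordinate.\<close>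
      fix l assume l: "l \<in> L_int" "l - t *\<^sub>R p \<in> C"
      have "l - t *\<^sub>R p \<in> S_cone G" using l(2) CS by blast
      then have diff: "co l u - t * co p u \<ge> 0" for u by (simp add: S_cone_iff)
      have "co l u > real (valency G u) - 2" for u using t(2)[of u] diff[of u] by linarith
      then have "l \<in> deep" by (simp add: deep_def)
      then show "Q l = c + quad (l + up 0)" using c up_lattice[OF l(1)] by simp
    qed
  qed
  moreover have "has_periodic_constant (L_nodes G) (counting_function (Z_h_nodes G h))
      (pr_nodes G ` (C \<inter> S_nodes G)) (c + quad (0 + up 0))"
  proof -
    let ?K = "pr_nodes G ` (C \<inter> S_nodes G)"
    obtain p where p: "p \<in> C" "p \<in> rel_interior (S_nodes G)" using rel by blast
    have pS: "p \<in> S_nodes G" using p(2) rel_interior_subset by blast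
    have p_pos: "co p n > 0" if "n \<in> nodes G" for n using rel_interior_S_nodes_pos[OF p(2) that] .
    obtain t where t: "t \<ge> 0" "\<And>n. n \<in> nodes G \<Longrightarrow> t * co p n > real (valency G n) - 2"
      using scale[of "nodes G" p] p_pos by blast
    obtain n where n: "n \<in> nodes G" using nodes_nonempty by blast
    obtain \<iota> N where \<iota>: "linear \<iota>" "\<And>m. \<iota> m \<in> V_nodes G" "\<And>m. pr_nodes G (\<iota> m) = pr_nodes G m"
      and N: "N > 0" "\<And>m. (\<forall>i. \<exists>k. m $ i = of_int (k * int N)) \<Longrightarrow> \<iota> m \<in> L_int"
      using node_lift_exists by metis
    have prpr: "pr_nodes G (pr_nodes G x) = pr_nodes G x" for x by (simp add: pr_nodes_def vec_eq_iff)
    have \<iota>pr: "\<iota> (pr_nodes G l) = l" if "l \<in> V_nodes G" for l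
      using pr_nodes_inject[OF \<iota>(2) that] \<iota>(3) prpr by simp
    have K_eq: "?K = {m. pr_nodes G m = m} \<inter> \<iota> -` (C \<inter> S_nodes G)"
    proof (intro equalityI subsetI)
      fix m assume "m \<in> ?K"
      then show "m \<in> {m. pr_nodes G m = m} \<inter> \<iota> -` (C \<inter> S_nodes G)"
        using \<iota>pr S_nodes_subset_V_nodes prpr by auto
    next
      fix m assume m: "m \<in> {m. pr_nodes G m = m} \<inter> \<iota> -` (C \<inter> S_nodes G)"
      then have "m = pr_nodes G (\<iota> m)" using \<iota>(3) by simp
      with m show "m \<in> ?K" by blast
    qed
    have CN: "rational_cone (C \<inter> S_nodes G)" using rational_cone_Int[OF Crat S_nodes_rational] .
    have "closed ?K"
      unfolding K_eq
      by (intro closed_Int closed_Collect_eq closed_vimage rational_cone_closed[OF CN]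
          linear_continuous_on continuous_on_id)
        (use \<iota>(1) linear_pr_nodes in \<open>auto simp: linear_conv_bounded_linear\<close>)
    moreover have K_cone: "cone ?K"
      unfolding cone_def
    proof (intro ballI allI impI)
      fix x and s :: real assume "x \<in> ?K" "0 \<le> s"
      then obtain z where z: "z \<in> C \<inter> S_nodes G" "x = pr_nodes G z" by blast
      have "s *\<^sub>R x = pr_nodes G (s *\<^sub>R z)" using z(2) by (simp add: linear_scale[OF linear_pr_nodes])
      then show "s *\<^sub>R x \<in> ?K" using rational_cone_scaleR[OF CN z(1) \<open>0 \<le> s\<close>] by blast
    qed
    moreover have "aff_dim ?K > 0"
    proof -
      have prp: "pr_nodes G p \<in> ?K" using p(1) pS by blast
      then have "0 \<in> ?K" using K_cone unfolding cone_def by (metis order_refl scaleR_zero_left)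
      have "p \<noteq> 0" using p_pos[OF n] by auto
      then have "pr_nodes G p \<noteq> 0"
        using pr_nodes_inject[of p 0] subsetD[OF S_nodes_subset_V_nodes pS] linear_0[OF linear_pr_nodes, of G]
        by (metis V_nodes_iff star_coord_simps(5))
      then have "aff_dim {0, pr_nodes G p} = 1" by simp
      moreover have "aff_dim {0, pr_nodes G p} \<le> aff_dim ?K"
        using prp \<open>0 \<in> ?K\<close> by (intro aff_dim_subset) auto
      ultimately show ?thesis by simp
    qed
    moreover have "pr_nodes G (t *\<^sub>R p) \<in> ?K"
      using rational_cone_scaleR[OF CN, of p t] p(1) pS t(1) by blast
    \<comment> \<open>\<open>up_lattice\<close> asks for an integral lift, so the formula is
      established on the sublattice of points having one.\<close>
    moreover have "finite_index_sublattice {m \<in> L_nodes G. \<iota> m \<in> L_int} (L_nodes G)"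
    proof (rule finite_index_sublatticeI[OF _ _ _ N(1)])
      show "additive_subgroup (L_nodes G)" by (auto simp: additive_subgroup_def L_nodes_def L_int_def)
      then show "additive_subgroup {m \<in> L_nodes G. \<iota> m \<in> L_int}"
        by (auto simp: additive_subgroup_def linear_0[OF \<iota>(1)] linear_diff[OF \<iota>(1)] L_int_def)
      show "x \<in> {m \<in> L_nodes G. \<iota> m \<in> L_int}" if "x \<in> L_nodes G" "\<forall>i. \<exists>k. x $ i = of_int (k * int N)" for x
        using that N(2) by blast
    qed (auto simp: L_nodes_def)
    moreover have "real_polynomial_function (\<lambda>m. c + quad (\<iota> m + up 0))"
      using real_polynomial_function_compose[OF polynomial_function_affine[OF \<iota>(1)] real_polynomial_function_quad]
      by (intro real_polynomial_function.intros(3) real_polynomial_function.intros(2)) (simp add: o_def)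
    moreover have "counting_function (Z_h_nodes G h) m = c + quad (\<iota> m + up 0)"
      if m: "m \<in> {m \<in> L_nodes G. \<iota> m \<in> L_int}" and mK: "m - pr_nodes G (t *\<^sub>R p) \<in> ?K" for m
    proof -
      obtain x where x: "x \<in> S_nodes G" "m - pr_nodes G (t *\<^sub>R p) = pr_nodes G x" using mK by blast
      then have "m = pr_nodes G (t *\<^sub>R p + x)" by (simp add: linear_add[OF linear_pr_nodes] algebra_simps)
      moreover have V: "t *\<^sub>R p + x \<in> V_nodes G" using pS x(1) by (simp add: S_nodes_iff V_nodes_iff)
      ultimately have \<iota>m: "\<iota> m = t *\<^sub>R p + x" using \<iota>pr by simp
      have m_eq: "pr_nodes G (\<iota> m) = m" using \<open>m = pr_nodes G (t *\<^sub>R p + x)\<close> \<iota>m by simp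
      have "co (\<iota> m) u > real (valency G u) - 2" if "u \<in> nodes G" for u
      proof -
        have "co x u \<ge> 0" "co (\<iota> m) u = t * co p u + co x u" using x(1) by (simp_all add: \<iota>m S_nodes_iff)
        then show ?thesis using t(2)[OF that] by linarith
      qed
      then have "Q (\<iota> m) = c + quad (up (\<iota> m))"
        using Q_eq_quad_V_nodes[OF c \<iota>(2) _ n] by blast
      also have "up (\<iota> m) = \<iota> m + up 0" using m by (intro up_lattice) simp
      finally have "Q (\<iota> m) = c + quad (\<iota> m + up 0)" .
      then show ?thesis using counting_function_Z_h_nodes[OF \<iota>(2), of h m] m_eq by simp
    qed
    ultimately have "has_periodic_constant (L_nodes G) (counting_function (Z_h_nodes G h)) ?K (c + quad (\<iota> 0 + up 0))"
      by (rule has_periodic_constant_polynomialI)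
    then show ?thesis by (simp add: linear_0[OF \<iota>(1)])
  qed
  ultimately show thesis using that by blast
qed

lemma periodic_constant_chamber_eq:
  assumes "is_chamber G C" "has_periodic_constant L_int f C c"
  shows "periodic_constant L_int f C = c"
proof -
  obtain p where "p \<in> C" "p \<in> L_int" "\<And>l. l \<in> C \<Longrightarrow> \<exists>k\<^sub>0::nat. \<forall>k\<ge>k\<^sub>0. real k *\<^sub>R p - l \<in> C"
    using rational_cone_lattice_point[OF chamber_rational[OF assms(1)]] by blast
  then show ?thesis using periodic_constant_eq[OF additive_subgroup_L_int] assms(2) by blast
qed

text \<open>The lattice ray is found in the rational cone \<open>C \<inter> S_nodes G\<close> and
  then projected, since \<open>pr_nodes\<close> maps integral points into
  \<open>L_nodes\<close>.\<close>

lemma periodic_constant_node_chamber_eq: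
  assumes "is_chamber G C" "has_periodic_constant (L_nodes G) f (pr_nodes G ` (C \<inter> S_nodes G)) c"
  shows "periodic_constant (L_nodes G) f (pr_nodes G ` (C \<inter> S_nodes G)) = c"
proof -
  have "rational_cone (C \<inter> S_nodes G)"
    using rational_cone_Int[OF chamber_rational[OF assms(1)] S_nodes_rational] .
  then obtain p where p: "p \<in> C \<inter> S_nodes G" "p \<in> L_int"
    "\<And>l. l \<in> C \<inter> S_nodes G \<Longrightarrow> \<exists>k\<^sub>0::nat. \<forall>k\<ge>k\<^sub>0. real k *\<^sub>R p - l \<in> C \<inter> S_nodes G"
    by (rule rational_cone_lattice_point) blast
  show ?thesis
  proof (rule periodic_constant_eq[OF _ _ _ _ assms(2)])
    show "additive_subgroup (L_nodes G)" by (auto simp: additive_subgroup_def L_nodes_def L_int_def)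
    show "pr_nodes G p \<in> L_nodes G" using p(2) by (auto simp: L_nodes_def pr_nodes_def L_int_def)
    show "pr_nodes G p \<in> pr_nodes G ` (C \<inter> S_nodes G)" using p(1) by blast
    fix l assume "l \<in> pr_nodes G ` (C \<inter> S_nodes G)"
    then obtain z where z: "z \<in> C \<inter> S_nodes G" "l = pr_nodes G z" by blast
    have "real k *\<^sub>R pr_nodes G p - l = pr_nodes G (real k *\<^sub>R p - z)" for k
      using z(2) by (simp add: linear_diff[OF linear_pr_nodes] linear_scale[OF linear_pr_nodes])
    then show "\<exists>k\<^sub>0::nat. \<forall>k\<ge>k\<^sub>0. real k *\<^sub>R pr_nodes G p - l \<in> pr_nodes G ` (C \<inter> S_nodes G)"
      using p(3)[OF z(1)] by (metis imageI)
  qed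
qed

end

theorem theorem4p5p1p2:
  fixes G :: "'v::finite plumbing_graph" and h :: "(real ^ 'v) set"
  assumes tree: "is_tree G"
    and neg_def: "negative_definite G"
    and nodes: "nodes G \<noteq> {}"
    and h: "h \<in> H_classes G"
  shows
    "((\<forall>l\<in>V_nodes G. \<forall>l'\<in>V_nodes G. pr_nodes G l = pr_nodes G l' \<longrightarrow>
        ehrhart_count G h l = ehrhart_count G h l')
     \<and> (\<forall>l\<in>V_nodes G. ehrhart_count G h l =
        card {x \<in> ends G \<rightarrow>\<^sub>E (UNIV :: nat set).
                \<not> pr_nodes G l \<le> pr_nodes G (end_sum G x) \<and> cls G (end_sum G x) = h}))
     \<and>
     ((\<forall>l\<in>V_nodes G. counting_function (Z_h G h) l =
        (\<Sum>\<^sub>\<infinity>l''\<in>{l''. cls G l'' = h \<and> \<not> pr_nodes G l \<le> pr_nodes G l''}. Z_coeff G l''))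
     \<and> (\<forall>l\<^sub>N\<in>L_nodes G. \<forall>l\<in>V_nodes G. pr_nodes G l = l\<^sub>N \<longrightarrow>
        counting_function (Z_h G h) l = counting_function (Z_h_nodes G h) l\<^sub>N \<and>
        (\<Sum>\<^sub>\<infinity>l''\<in>{l''. cls G l'' = h \<and> \<not> l \<le> l''}. Z_coeff G l'') =
        (\<Sum>\<^sub>\<infinity>l''\<in>{l''. cls G l'' = h \<and> \<not> l\<^sub>N \<le> pr_nodes G l''}. Z_coeff G l'')))
     \<and>
     (\<forall>C. is_chamber G C \<and> interior (C \<inter> S_cone G) \<noteq> {} \<and> C \<inter> rel_interior (S_nodes G) \<noteq> {} \<longrightarrow>
        (\<exists>c. has_periodic_constant L_int (counting_function (Z_h G h)) C c) \<and>
        (\<exists>c. has_periodic_constant (L_nodes G) (counting_function (Z_h_nodes G h))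
               (pr_nodes G ` (C \<inter> S_nodes G)) c) \<and>
        periodic_constant L_int (counting_function (Z_h G h)) C =
        periodic_constant (L_nodes G) (counting_function (Z_h_nodes G h))
          (pr_nodes G ` (C \<inter> S_nodes G)))"
proof -
  obtain r where r: "r \<in> L_dual G" "h = cls G r"
    using plumbing_tree.H_classes_cases[OF plumbing_tree.intro[OF tree neg_def] h] by blast
  interpret plumbing_tree_class_with_node G h r using tree neg_def r nodes by unfold_locales
  have a: "ehrhart_count G h l =
      card {x \<in> ends G \<rightarrow>\<^sub>E (UNIV :: nat set).
              \<not> pr_nodes G l \<le> pr_nodes G (end_sum G x) \<and> cls G (end_sum G x) = h}"
    if "l \<in> V_nodes G" for l
    unfolding ehrhart_count_def by (simp only: le_iff_pr_nodes_le[OF that end_sum_co_nonneg])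
  have b: "counting_function (Z_h G h) l =
      (\<Sum>\<^sub>\<infinity>l''\<in>{l''. cls G l'' = h \<and> \<not> pr_nodes G l \<le> pr_nodes G l''}. Z_coeff G l'')"
    if "l \<in> V_nodes G" for l
    by (rule counting_function_Z_h_eq_infsum) (rule le_iff_pr_nodes_le[OF that])
  have b': "counting_function (Z_h G h) l =
      (\<Sum>\<^sub>\<infinity>l''\<in>{l''. cls G l'' = h \<and> \<not> l \<le> l''}. Z_coeff G l'')" for l
    by (rule counting_function_Z_h_eq_infsum) (rule refl)
  have c: "(\<exists>c. has_periodic_constant L_int (counting_function (Z_h G h)) C c) \<and>
        (\<exists>c. has_periodic_constant (L_nodes G) (counting_function (Z_h_nodes G h))
               (pr_nodes G ` (C \<inter> S_nodes G)) c) \<and>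
        periodic_constant L_int (counting_function (Z_h G h)) C =
        periodic_constant (L_nodes G) (counting_function (Z_h_nodes G h))
          (pr_nodes G ` (C \<inter> S_nodes G))"
    if C: "is_chamber G C" "interior (C \<inter> S_cone G) \<noteq> {}" "C \<inter> rel_interior (S_nodes G) \<noteq> {}" for C
  proof -
    obtain c where c: "has_periodic_constant L_int (counting_function (Z_h G h)) C c"
      "has_periodic_constant (L_nodes G) (counting_function (Z_h_nodes G h)) (pr_nodes G ` (C \<inter> S_nodes G)) c"
      using periodic_constants_agree[OF C] by blast
    then show ?thesis
      using periodic_constant_chamber_eq[OF C(1)] periodic_constant_node_chamber_eq[OF C(1)] by auto
  qed
  show ?thesis
  proof (intro conjI ballI allI impI)
    fix l l' assume "l \<in> V_nodes G" "l' \<in> V_nodes G" "pr_nodes G l = pr_nodes G l'"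
    then show "ehrhart_count G h l = ehrhart_count G h l'" using a by simp
  next
    fix l\<^sub>N l assume l: "l \<in> V_nodes G" "pr_nodes G l = l\<^sub>N"
    show "counting_function (Z_h G h) l = counting_function (Z_h_nodes G h) l\<^sub>N"
      using counting_function_Z_h_nodes[OF l(1), of h] l(2) by simp
    show "(\<Sum>\<^sub>\<infinity>l''\<in>{l''. cls G l'' = h \<and> \<not> l \<le> l''}. Z_coeff G l'') =
        (\<Sum>\<^sub>\<infinity>l''\<in>{l''. cls G l'' = h \<and> \<not> l\<^sub>N \<le> pr_nodes G l''}. Z_coeff G l'')"
      using b[OF l(1)] b'[of l] l(2) by simp
  qed (use a b c in blast)+
qed

end
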